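(* (a) Suppose that there exists a constant $t_0 \geq 1$ such that every $t_0$-tough graph is Hamiltonian. Then there exist positive constants $c_1 = c_1(t_0)$ and $c_2 = c_2(t_0)$ such that the following holds. Let $G$ be an $n$-vertex graph with minimum degree $k$. If $\alpha(G) \leq c_2 k$, then $G \cup \mathbb{G}(n,p)$ is a.a.s. pancyclic whenever $p \geq \frac{c_1 \log n}{nk}$. (b) For every sufficiently large integer $n$, constant $0 < \varepsilon < 1/2$, integer $n^{\varepsilon} \leq k \leq n^{1-\varepsilon}$, and constant $0 < c < 1$, there exist a constant $c' > 0$ and an $n$-vertex graph $H$ with $\delta(H) = k$ and $\alpha(H) \leq ck$ such that $H \cup \mathbb{G}(n,p)$ is a.a.s. not Hamiltonian whenever $p := p(n) \leq \frac{c' \log n}{nk}$. (c) For every sufficiently large integer $n$ and every integer $k := k(n) \leq n/2$ with $k \to \infty$ as $n \to \infty$, there exists an $n$-vertex graph $H$ with $\alpha(H) = k$ and $\delta(H) \geq k/2$ such that $H \cup \mathbb{G}(n,p)$ is a.a.s. not Hamiltonian whenever $p := p(n) \leq \frac{1}{3n}$.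
   Context: A graph $G$ is $t$-tough if for every $S \subseteq V(G)$ the number of connected components of $G \setminus S$ is at most $\max\{1, |S|/t\}$. For an $n$-vertex graph $G$, $G \cup \mathbb{G}(n,p)$ denotes the union $G \cup R$ where $R$ is the binomial random graph on the vertex set $V(G)$ in which each pair of vertices is an edge independently with probability $p$. "A.a.s." means with probability tending to $1$ as $n \to \infty$. $\alpha$ is the independence number and $\delta$ the minimum degree. Hamiltonian: has a cycle through all vertices; pancyclic: has a cycle of every length from $3$ to the number of vertices. *)

theory Defs
  imports Complex_Main
begin

definition pairs :: "nat \<Rightarrow> nat set set" where
  "pairs n = {e. \<exists>u v. e = {u, v} \<and> u < v \<and> v < n}"

definition graph :: "nat \<Rightarrow> nat set set \<Rightarrow> bool" where
  "graph n E \<longleftrightarrow> E \<subseteq> pairs n"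

definition deg :: "nat set set \<Rightarrow> nat \<Rightarrow> nat" where
  "deg E v = card {u. u \<noteq> v \<and> {u, v} \<in> E}"

definition min_deg :: "nat \<Rightarrow> nat set set \<Rightarrow> nat" where
  "min_deg n E = Min ((\<lambda>v. deg E v) ` {..<n})"

definition indep_num :: "nat \<Rightarrow> nat set set \<Rightarrow> nat" where
  "indep_num n E = Max {card S | S. S \<subseteq> {..<n} \<and> (\<forall>u\<in>S. \<forall>v\<in>S. u \<noteq> v \<longrightarrow> {u, v} \<notin> E)}"

definition is_cycle :: "nat set set \<Rightarrow> nat list \<Rightarrow> bool" where
  "is_cycle E xs \<longleftrightarrow> 3 \<le> length xs \<and> distinct xs \<and>
     (\<forall>i < length xs. {xs ! i, xs ! ((i + 1) mod length xs)} \<in> E)"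

definition hamiltonian :: "nat \<Rightarrow> nat set set \<Rightarrow> bool" where
  "hamiltonian n E \<longleftrightarrow> (\<exists>xs. is_cycle E xs \<and> set xs = {..<n})"

definition pancyclic :: "nat \<Rightarrow> nat set set \<Rightarrow> bool" where
  "pancyclic n E \<longleftrightarrow> (\<forall>l. 3 \<le> l \<and> l \<le> n \<longrightarrow>
      (\<exists>xs. is_cycle E xs \<and> set xs \<subseteq> {..<n} \<and> length xs = l))"

definition adj_in :: "nat set set \<Rightarrow> nat set \<Rightarrow> nat \<Rightarrow> nat \<Rightarrow> bool" where
  "adj_in E W u v \<longleftrightarrow> u \<in> W \<and> v \<in> W \<and> {u, v} \<in> E"

definition num_comps :: "nat set set \<Rightarrow> nat set \<Rightarrow> nat" where
  "num_comps E W = card {C. \<exists>v\<in>W. C = {u \<in> W. (adj_in E W)\<^sup>*\<^sup>* v u}}"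

definition tough :: "nat \<Rightarrow> nat set set \<Rightarrow> real \<Rightarrow> bool" where
  "tough n E t \<longleftrightarrow> (\<forall>S \<subseteq> {..<n}.
      real (num_comps E ({..<n} - S)) \<le> max 1 (real (card S) / t))"

definition rg_prob :: "nat \<Rightarrow> real \<Rightarrow> (nat set set \<Rightarrow> bool) \<Rightarrow> real" where
  "rg_prob n p P = (\<Sum>R \<in> {R. R \<subseteq> pairs n \<and> P R}.
      p ^ card R * (1 - p) ^ (card (pairs n) - card R))"

end

theory Submission
  imports Defs "HOL-Real_Asymp.Real_Asymp"
begin

text \<open>
  For the positive result, let \<open>a\<close> be the independence number of \<open>G\<close>, tiny compared with the minimum
  degree \<open>k\<close>. Deleting at least \<open>t0 * a\<close> vertices can never violate toughness, and after deleting fewer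
  the components of \<open>G\<close> have order \<open>k\<close>, so a union bound shows that random edges merge them; this also
  applies to every large vertex set \<open>X\<close> in which all degrees are of order \<open>k\<close>. Fix such a set \<open>V1\<close> whose
  complement contains a highly connected subgraph \<open>Z\<close>. Cycles of length at least \<open>card V1\<close> are
  Hamilton cycles of supersets of \<open>V1\<close>. A Hamilton cycle of \<open>V1\<close> can be shortened by chords with
  gaps of at most \<open>2 * a\<close> in the lengths, and a detour through chains of triangles in \<open>Z\<close> fills the gaps;
  the short cycles are found inside \<open>Z\<close> alone.

  For the negative results, the second moment method provides an isolated clique in a union of
  cliques, respectively more isolated vertices in an independent set than there are vertices
  to separate them.
\<close>

subsection \<open>Paths and cycles\<close>

text \<open>The toughness hypothesis yields Hamilton cycles and no other length, so it is applied to
  induced subgraphs. This works only down to linear size: on \<open>m\<close> vertices the union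
  bound needs \<open>p * m * k\<close> of order \<open>ln n\<close>. Lengths below
  \<open>card V1\<close> must therefore come mostly from the small independence number. In the union
  bound, summing over all unions \<open>U\<close> of components could cost up to
  \<open>2 ^ n\<close>, whereas the bound for one \<open>U\<close> being cut off is only
  \<open>n\<close> to the power minus a constant times the number \<open>card T\<close> of old
  components in it. Hence \<open>U\<close> is recovered from \<open>S\<close> and \<open>T\<close>;
  as \<open>card S\<close> is at most \<open>3 * t0 * card T\<close>, choosing both costs a bounded
  power of \<open>n\<close> per element of \<open>T\<close>, which the constant
  \<open>64 * (9 * t0 + 3)\<close> outweighs. Every vertex must keep a quarter of \<open>k\<close>
  as degree into \<open>V1\<close>, although \<open>k\<close> may be far below \<open>ln n\<close>.
  A random set may then fail at some vertex, so that range needs an argument from the small number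
  of vertices of low degree. In both negative examples the expected number of obstructions clearly
  exceeds what a Hamilton cycle tolerates; what remains is their correlation, and it is weak because
  two obstructions share few pairs.\<close>

definition gpath :: "nat set set \<Rightarrow> nat list \<Rightarrow> bool" where
  "gpath E xs \<longleftrightarrow> xs \<noteq> [] \<and> distinct xs \<and> successively (\<lambda>u v. {u, v} \<in> E) xs"

definition nbh :: "nat set set \<Rightarrow> nat set \<Rightarrow> nat \<Rightarrow> nat set" where
  "nbh E W v = {u \<in> W. u \<noteq> v \<and> {u, v} \<in> E}"

definition indep :: "nat set set \<Rightarrow> nat set \<Rightarrow> bool" where
  "indep E S \<longleftrightarrow> (\<forall>u\<in>S. \<forall>v\<in>S. u \<noteq> v \<longrightarrow> {u, v} \<notin> E)"

definition indep_le :: "nat set set \<Rightarrow> nat set \<Rightarrow> nat \<Rightarrow> bool" where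
  "indep_le E V a \<longleftrightarrow> (\<forall>S \<subseteq> V. finite S \<longrightarrow> indep E S \<longrightarrow> card S \<le> a)"

lemma indep_le_edge:
  assumes "indep_le E V a" "S \<subseteq> V" "finite S" "a < card S"
  obtains u v where "u \<in> S" "v \<in> S" "u \<noteq> v" "{u, v} \<in> E"
  using assms unfolding indep_le_def indep_def by (meson linorder_not_le)

lemma indep_le_mono:
  assumes "indep_le E V a" "E \<subseteq> E'" "V' \<subseteq> V"
  shows "indep_le E' V' a"
  using assms unfolding indep_le_def indep_def by (meson subset_eq)

lemma is_cycle_iff_gpath:
  "is_cycle E xs \<longleftrightarrow> 3 \<le> length xs \<and> gpath E xs \<and> {last xs, hd xs} \<in> E"
proof (cases "3 \<le> length xs")
  case True
  hence ne: "xs \<noteq> []" by auto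
  have "(\<forall>i < length xs. {xs ! i, xs ! ((i + 1) mod length xs)} \<in> E) \<longleftrightarrow>
        (\<forall>i. Suc i < length xs \<longrightarrow> {xs ! i, xs ! Suc i} \<in> E) \<and> {last xs, hd xs} \<in> E" (is "?L \<longleftrightarrow> ?R")
  proof
    assume L: ?L
    have "{xs ! i, xs ! Suc i} \<in> E" if "Suc i < length xs" for i
      using L[rule_format, of i] that by simp
    moreover have "{last xs, hd xs} \<in> E"
      using L[rule_format, of "length xs - 1"] ne by (simp add: last_conv_nth hd_conv_nth)
    ultimately show ?R by blast
  next
    assume R: ?R
    show ?L
    proof (intro allI impI)
      fix i assume i: "i < length xs"
      show "{xs ! i, xs ! ((i + 1) mod length xs)} \<in> E"
      proof (cases "Suc i < length xs")
        case True thus ?thesis using R by simp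
      next
        case False
        hence "i + 1 = length xs" using i by simp
        hence "(i + 1) mod length xs = 0" "xs ! i = last xs" using ne
          by (simp_all add: last_conv_nth flip: \<open>i + 1 = length xs\<close>)
        thus ?thesis using R ne by (simp add: hd_conv_nth)
      qed
    qed
  qed
  thus ?thesis using True ne
    by (auto simp: is_cycle_def gpath_def successively_conv_nth)
qed (simp add: is_cycle_def)

lemma gpath_rev [simp]: "gpath E (rev xs) \<longleftrightarrow> gpath E xs"
  by (simp add: gpath_def insert_commute)

lemma gpath_append:
  assumes "gpath E xs" "gpath E ys" "{last xs, hd ys} \<in> E" "set xs \<inter> set ys = {}"
  shows "gpath E (xs @ ys)"
  using assms by (auto simp: gpath_def successively_append_iff)

lemma gpath_single [simp]: "gpath E [x]"
  by (simp add: gpath_def)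

lemma gpath_mono: "gpath E xs \<Longrightarrow> E \<subseteq> E' \<Longrightarrow> gpath E' xs"
  unfolding gpath_def by (meson successively_mono subsetD)

lemma is_cycle_append:
  assumes "gpath E xs" "gpath E ys" "{last xs, hd ys} \<in> E" "{last ys, hd xs} \<in> E"
    "set xs \<inter> set ys = {}" "3 \<le> length xs + length ys"
  shows "is_cycle E (xs @ ys)"
proof -
  have "xs \<noteq> []" "ys \<noteq> []" using assms by (auto simp: gpath_def)
  thus ?thesis using assms gpath_append[OF assms(1-3,5)]
    by (simp add: is_cycle_iff_gpath)
qed

text \<open>Two vertices of \<open>W\<close> whose successors on the cycle are adjacent are joined by the path
  obtained by deleting the two outgoing cycle edges and adding that chord.\<close>

lemma cycle_spanning_path:
  assumes cyc: "is_cycle E xs" and W: "W \<subseteq> set xs" "a < card W" and al: "indep_le E (set xs) a"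
  obtains ys where "gpath E ys" "set ys = set xs" "hd ys \<in> W" "last ys \<in> W" "hd ys \<noteq> last ys"
proof -
  define m where "m = length xs"
  have m3: "3 \<le> m" and d: "distinct xs" using cyc by (auto simp: is_cycle_def m_def)
  define I where "I = {i. i < m \<and> xs ! i \<in> W}"
  have fI: "finite I" by (simp add: I_def)
  have "W \<subseteq> (\<lambda>i. xs ! i) ` I"
  proof
    fix w assume w: "w \<in> W"
    then obtain i where "i < m" "xs ! i = w" using W(1) unfolding m_def by (metis in_set_conv_nth subsetD)
    thus "w \<in> (\<lambda>i. xs ! i) ` I" using w by (auto simp: I_def)
  qed
  hence cI: "a < card I" using W(2) fI by (meson card_mono card_image_le finite_imageI le_trans less_le_trans)
  define s where "s i = (i + 1) mod m" for i
  have inj_s: "inj_on s I"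
  proof (rule inj_onI)
    fix i j assume "i \<in> I" "j \<in> I" "s i = s j"
    thus "i = j" unfolding s_def I_def
      by (cases "i + 1 = m"; cases "j + 1 = m"; simp)
  qed
  have sm: "s i < m" for i using m3 by (simp add: s_def)
  have inj: "inj_on (\<lambda>i. xs ! s i) I"
    using inj_s sm d by (auto simp: inj_on_def nth_eq_iff_index_eq m_def)
  define S where "S = (\<lambda>i. xs ! s i) ` I"
  have "card S = card I" using inj by (simp add: S_def card_image)
  moreover have "S \<subseteq> set xs" using sm by (auto simp: S_def m_def)
  ultimately obtain u v where uv: "u \<in> S" "v \<in> S" "u \<noteq> v" "{u, v} \<in> E"
    using indep_le_edge[OF al] cI fI unfolding S_def by (metis finite_imageI)
  then obtain i0 j0 where ij0: "i0 \<in> I" "j0 \<in> I" "u = xs ! s i0" "v = xs ! s j0" by (auto simp: S_def)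
  have "\<exists>i j. i \<in> I \<and> j \<in> I \<and> i < j \<and> {xs ! s i, xs ! s j} \<in> E"
  proof (cases "i0 < j0")
    case True thus ?thesis using ij0 uv by blast
  next
    case False
    hence "j0 < i0" using ij0 uv by (metis linorder_neqE_nat)
    thus ?thesis using ij0 uv by (metis insert_commute)
  qed
  then obtain i j where ij: "i \<in> I" "j \<in> I" "i < j" and e: "{xs ! s i, xs ! s j} \<in> E" by blast
  have jm: "j < m" using ij by (simp add: I_def)
  \<comment> \<open>\<open>P\<close> ends at position \<open>i\<close> and \<open>Q\<close> at
    position \<open>j\<close>; \<open>R @ P\<close> is the arc from the successor of
    \<open>j\<close> through the end of the list to \<open>i\<close>. If \<open>j\<close> is the
    last position, \<open>R\<close> is empty.\<close>
  define P where "P = take (Suc i) xs"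
  define Q where "Q = take (j - i) (drop (Suc i) xs)"
  define R where "R = drop (Suc j) xs"
  have xs: "xs = P @ Q @ R"
  proof -
    have "R = drop (j - i) (drop (Suc i) xs)" using ij(3) by (simp add: R_def)
    thus ?thesis unfolding P_def Q_def by (metis append_take_drop_id)
  qed
  have lP: "length P = Suc i" and lQ: "length Q = j - i" and lR: "length R = m - Suc j"
    using ij jm by (auto simp: P_def Q_def R_def m_def)
  have nP: "P \<noteq> []" and nQ: "Q \<noteq> []" using lP lQ ij by auto
  have lastP: "last P = xs ! i" using nP lP xs by (metis diff_Suc_1 last_conv_nth lessI nth_append)
  have lastQ: "last Q = xs ! j"
  proof -
    have "last Q = last (P @ Q)" using nQ by simp
    also have "\<dots> = (P @ Q) ! j" using lP lQ ij nQ by (subst last_conv_nth) auto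
    also have "\<dots> = xs ! j" using lP lQ ij unfolding xs by (auto simp: nth_append)
    finally show ?thesis .
  qed
  have hdQ: "hd Q = xs ! s i"
  proof -
    have "s i = Suc i" using ij jm by (simp add: s_def)
    thus ?thesis unfolding xs using nQ lP by (simp add: nth_append hd_conv_nth)
  qed
  have hdRP: "hd (R @ P) = xs ! s j"
  proof (cases "R = []")
    case True
    hence "Suc j = m" using lR jm by simp
    hence "s j = 0" by (simp add: s_def)
    thus ?thesis using True nP xs by (simp add: hd_conv_nth nth_append)
  next
    case False
    hence "Suc j < m" using lR by (metis length_greater_0_conv zero_less_diff)
    hence "s j = Suc j" by (simp add: s_def)
    thus ?thesis using False lP lQ ij xs by (simp add: hd_conv_nth nth_append)
  qed
  have gp: "gpath E (P @ Q @ R)" and clos: "{last (P @ Q @ R), hd (P @ Q @ R)} \<in> E"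
    using cyc xs by (auto simp: is_cycle_iff_gpath)
  have gQ: "gpath E Q" using gp nQ by (auto simp: gpath_def successively_append_iff)
  have gP: "gpath E P" using gp nP by (auto simp: gpath_def successively_append_iff)
  have gRP: "gpath E (R @ P)"
  proof (cases "R = []")
    case True thus ?thesis using gP by simp
  next
    case False
    have "gpath E R" using gp False by (auto simp: gpath_def successively_append_iff)
    moreover have "{last R, hd P} \<in> E" using clos False nP by simp
    moreover have "set R \<inter> set P = {}" using gp by (auto simp: gpath_def)
    ultimately show ?thesis using gP gpath_append by blast
  qed
  \<comment> \<open>Walk the arc \<open>R @ P\<close> backwards from \<open>xs ! i\<close> to the
    successor of \<open>j\<close>, cross the chord, and follow \<open>Q\<close> up to
    \<open>xs ! j\<close>.\<close>
  define ys where "ys = rev (R @ P) @ Q"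
  have "gpath E ys" unfolding ys_def
  proof (rule gpath_append)
    show "gpath E (rev (R @ P))" using gRP by (simp del: rev_append)
    show "{last (rev (R @ P)), hd Q} \<in> E"
      using hdQ hdRP e nP by (simp add: last_rev insert_commute del: rev_append)
    show "set (rev (R @ P)) \<inter> set Q = {}" using gp by (auto simp: gpath_def)
  qed fact
  moreover have "set ys = set xs" unfolding ys_def by (subst xs) auto
  moreover have "hd ys = xs ! i" using nP lastP by (simp add: ys_def hd_rev)
  moreover have "last ys = xs ! j" using nQ lastQ by (simp add: ys_def)
  moreover have "xs ! i \<noteq> xs ! j" using ij jm d by (simp add: nth_eq_iff_index_eq m_def)
  ultimately show ?thesis using that ij by (simp add: I_def)
qed

text \<open>Two of the \<open>a + 1\<close> vertices at positions 0, 2, ..., \<open>2 * a\<close>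
  are adjacent. Even positions ensure that the chord skips at least one vertex, their range that it
  skips at most \<open>2 * a - 1\<close>.\<close>

lemma path_shorten_step:
  assumes p: "gpath E xs" and len: "2 * a + 1 \<le> length xs" and al: "indep_le E (set xs) a"
  obtains ys where "gpath E ys" "set ys \<subseteq> set xs" "hd ys = hd xs" "last ys = last xs"
    "length ys < length xs" "length xs < length ys + 2 * a"
proof -
  have d: "distinct xs" using p by (simp add: gpath_def)
  define S where "S = (\<lambda>i. xs ! (2 * i)) ` {..a}"
  have "inj_on (\<lambda>i. xs ! (2 * i)) {..a}"
    using d len by (auto simp: inj_on_def nth_eq_iff_index_eq)
  hence "card S = Suc a" by (simp add: S_def card_image)
  moreover have "S \<subseteq> set xs" using len by (auto simp: S_def)
  ultimately obtain u v where uv: "u \<in> S" "v \<in> S" "u \<noteq> v" "{u, v} \<in> E"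
    using indep_le_edge[OF al] unfolding S_def by (metis finite_atMost finite_imageI lessI)
  then obtain i0 j0 where ij0: "i0 \<le> a" "j0 \<le> a" "u = xs ! (2 * i0)" "v = xs ! (2 * j0)"
    by (auto simp: S_def)
  have "\<exists>i j. i \<le> a \<and> j \<le> a \<and> i < j \<and> {xs ! (2 * i), xs ! (2 * j)} \<in> E"
  proof (cases "i0 < j0")
    case True thus ?thesis using ij0 uv by blast
  next
    case False
    hence "j0 < i0" using ij0 uv by (metis linorder_neqE_nat)
    thus ?thesis using ij0 uv by (metis insert_commute)
  qed
  then obtain i j where ij: "i \<le> a" "j \<le> a" "i < j" and e: "{xs ! (2 * i), xs ! (2 * j)} \<in> E" by blast
  define A where "A = take (Suc (2 * i)) xs"
  define B where "B = drop (2 * j) xs"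
  have jl: "2 * j < length xs" using ij len by auto
  have nA: "A \<noteq> []" and nB: "B \<noteq> []" using jl by (auto simp: A_def B_def)
  have lA: "last A = xs ! (2 * i)" using jl ij by (simp add: A_def take_Suc_conv_app_nth)
  have hB: "hd B = xs ! (2 * j)" using jl by (simp add: B_def hd_drop_conv_nth)
  have "set A \<inter> set B = {}" using d ij unfolding A_def B_def
    by (intro set_take_disj_set_drop_if_distinct) auto
  moreover have "gpath E A"
    using p nA unfolding gpath_def A_def by (metis append_take_drop_id distinct_take successively_append_iff)
  moreover have "gpath E B"
    using p nB unfolding gpath_def B_def by (metis append_take_drop_id distinct_drop successively_append_iff)
  ultimately have "gpath E (A @ B)" using gpath_append lA hB e by metis
  moreover have "set (A @ B) \<subseteq> set xs" unfolding A_def B_def by (auto dest: in_set_takeD in_set_dropD)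
  moreover have "hd (A @ B) = hd xs" using nA jl by (simp add: A_def)
  moreover have "last (A @ B) = last xs" using nB jl by (simp add: B_def)
  moreover have "length (A @ B) < length xs" "length xs < length (A @ B) + 2 * a"
    using jl ij by (auto simp: A_def B_def)
  ultimately show ?thesis by (rule that)
qed

text \<open>Every step loses fewer than \<open>2 * a\<close> vertices, so the first length not above
  \<open>t\<close> is still close to \<open>t\<close>. Until then the path has the
  \<open>2 * a + 1\<close> vertices that a further step requires.\<close>

lemma path_shorten:
  assumes "gpath E xs" "2 * a + 1 \<le> t" "t \<le> length xs" "indep_le E (set xs) a"
  shows "\<exists>ys. gpath E ys \<and> set ys \<subseteq> set xs \<and> hd ys = hd xs \<and> last ys = last xs \<and>
    length ys \<le> t \<and> t \<le> length ys + 2 * a"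
  using assms
proof (induction "length xs" arbitrary: xs rule: less_induct)
  case less
  show ?case
  proof (cases "length xs = t")
    case True thus ?thesis using less.prems by auto
  next
    case False
    have "2 * a + 1 \<le> length xs" using less.prems by simp
    then obtain ys where ys: "gpath E ys" "set ys \<subseteq> set xs" "hd ys = hd xs" "last ys = last xs"
      "length ys < length xs" "length xs < length ys + 2 * a"
      using path_shorten_step[OF less.prems(1) _ less.prems(4)] by blast
    show ?thesis
    proof (cases "t \<le> length ys")
      case True
      have "indep_le E (set ys) a" using less.prems(4) ys(2) by (meson indep_le_mono order_refl)
      from less.hyps[OF ys(5) ys(1) less.prems(2) True this] show ?thesis using ys by fastforce
    next
      case F: False
      thus ?thesis using ys less.prems by (intro exI[of _ ys]) auto
    qed
  qed
qed

section \<open>Independent sets, long paths and triangle chains\<close>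

lemma nbh_subset: "nbh E W v \<subseteq> W"
  by (auto simp: nbh_def)

lemma finite_nbh [simp]: "finite W \<Longrightarrow> finite (nbh E W v)"
  by (simp add: nbh_def)

lemma maximal_indep_subset:
  assumes "finite M"
  obtains I where "I \<subseteq> M" "indep E I" "\<And>v. v \<in> M - I \<Longrightarrow> \<exists>u\<in>I. u \<noteq> v \<and> {v, u} \<in> E"
proof -
  define P where "P I \<longleftrightarrow> I \<subseteq> M \<and> indep E I" for I
  have "\<exists>I. P I \<and> (\<forall>J. P J \<longrightarrow> card J \<le> card I)"
    by (rule ex_has_greatest_nat[of P "{}" card "Suc (card M)"])
       (auto simp: P_def indep_def card_mono[OF assms] less_Suc_eq_le)
  then obtain I where I: "I \<subseteq> M" "indep E I" and max: "\<And>J. J \<subseteq> M \<Longrightarrow> indep E J \<Longrightarrow> card J \<le> card I"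
    by (auto simp: P_def)
  have "\<exists>u\<in>I. u \<noteq> v \<and> {v, u} \<in> E" if v: "v \<in> M - I" for v
  proof (rule ccontr)
    assume "\<not> ?thesis"
    hence "indep E (insert v I)" using I(2) unfolding indep_def by (auto simp: insert_commute)
    hence "card (insert v I) \<le> card I" using max I(1) v by simp
    thus False using v finite_subset[OF I(1) assms] by simp
  qed
  thus ?thesis using I that by blast
qed

text \<open>Peel off maximal independent sets; a path in the remainder extends into the set removed last.\<close>

lemma path_or_large_indep:
  assumes "finite M"
  shows "(\<exists>xs. gpath E xs \<and> set xs \<subseteq> M \<and> length xs = Suc j) \<or>
    (\<exists>I \<subseteq> M. indep E I \<and> card M \<le> j * card I)"
  using assms
proof (induction j arbitrary: M)
  case 0
  show ?case
  proof (cases "M = {}")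
    case True thus ?thesis by (auto simp: indep_def)
  next
    case False
    then obtain x where "x \<in> M" by blast
    hence "gpath E [x] \<and> set [x] \<subseteq> M \<and> length [x] = Suc 0" by simp
    thus ?thesis by blast
  qed
next
  case (Suc j)
  obtain I where I: "I \<subseteq> M" "indep E I" and mx: "\<And>v. v \<in> M - I \<Longrightarrow> \<exists>u\<in>I. u \<noteq> v \<and> {v, u} \<in> E"
    using maximal_indep_subset[OF Suc.prems, of E] by metis
  have fI: "finite I" using I(1) Suc.prems finite_subset by blast
  from Suc.IH[of "M - I"] Suc.prems consider
      (path) xs where "gpath E xs" "set xs \<subseteq> M - I" "length xs = Suc j"
    | (ind) J where "J \<subseteq> M - I" "indep E J" "card (M - I) \<le> j * card J"
    by blast
  thus ?case
  proof cases
    case path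
    have "last xs \<in> M - I" using path by (metis gpath_def last_in_set subsetD)
    then obtain u where u: "u \<in> I" "{last xs, u} \<in> E" using mx by blast
    have "gpath E (xs @ [u])" using path u by (intro gpath_append) auto
    thus ?thesis using path u I by (intro disjI1 exI[of _ "xs @ [u]"]) auto
  next
    case ind
    have c: "card M = card (M - I) + card I" using I fI Suc.prems
      by (metis add.commute card_Diff_subset card_mono le_add_diff_inverse)
    show ?thesis
    proof (cases "card J \<le> card I")
      case True
      hence "j * card J \<le> j * card I" by (rule mult_le_mono2)
      hence "card M \<le> Suc j * card I" using c ind(3) by (simp del: mult_le_cancel1 add: order_trans)
      thus ?thesis using I by blast
    next
      case False
      hence "card M \<le> Suc j * card J" using c ind(3) by simp
      thus ?thesis using ind by blast
    qed
  qed
qed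

lemma triangle_chain:
  assumes Z: "finite Z" "indep_le E Z a" and deg: "\<And>v. v \<in> Z \<Longrightarrow> d \<le> card (nbh E Z v)"
    and x: "x \<in> Z" and F: "finite F" and sz: "card F + 2 * r + a + 2 \<le> d" and r: "1 \<le> r"
  shows "\<exists>y U. y \<in> U \<and> U \<subseteq> Z - F \<and> x \<notin> U \<and> card U = 2 * r \<and>
    (\<forall>s. r \<le> s \<and> s \<le> 2 * r \<longrightarrow>
      (\<exists>xs. gpath E xs \<and> hd xs = x \<and> last xs = y \<and> length xs = Suc s \<and> set xs \<subseteq> insert x U))"
  using r sz
proof (induction r rule: dec_induct)
  case base
  define N where "N = nbh E Z x - F"
  have fN: "finite N" using Z by (simp add: N_def)
  have "d - card F \<le> card N" using deg[OF x] diff_card_le_card_Diff[OF F, of "nbh E Z x"]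
    unfolding N_def by linarith
  hence "a < card N" using base by linarith
  moreover have "N \<subseteq> Z" by (auto simp: N_def nbh_def)
  ultimately obtain u v where uv: "u \<in> N" "v \<in> N" "u \<noteq> v" "{u, v} \<in> E"
    using indep_le_edge[OF Z(2) _ fN] by metis
  have e: "{x, u} \<in> E" "{x, v} \<in> E" "u \<noteq> x" "v \<noteq> x" "u \<in> Z" "v \<in> Z" "u \<notin> F" "v \<notin> F"
    using uv by (auto simp: N_def nbh_def insert_commute)
  show ?case
  proof (rule exI[of _ v], rule exI[of _ "{u, v}"], intro conjI allI impI)
    show "v \<in> {u, v}" "{u, v} \<subseteq> Z - F" "x \<notin> {u, v}" "card {u, v} = 2 * 1" using e uv by auto
    fix s assume "(1::nat) \<le> s \<and> s \<le> 2 * 1"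
    hence "s = 1 \<or> s = 2" by auto
    thus "\<exists>xs. gpath E xs \<and> hd xs = x \<and> last xs = v \<and> length xs = Suc s \<and> set xs \<subseteq> insert x {u, v}"
    proof
      assume "s = 1"
      thus ?thesis using e by (intro exI[of _ "[x, v]"]) (auto simp: gpath_def)
    next
      assume "s = 2"
      thus ?thesis using e uv by (intro exI[of _ "[x, u, v]"]) (auto simp: gpath_def)
    qed
  qed
next
  case (step r)
  then obtain y U where IH: "y \<in> U" "U \<subseteq> Z - F" "x \<notin> U" "card U = 2 * r"
    and P: "\<And>s. r \<le> s \<Longrightarrow> s \<le> 2 * r \<Longrightarrow>
      \<exists>xs. gpath E xs \<and> hd xs = x \<and> last xs = y \<and> length xs = Suc s \<and> set xs \<subseteq> insert x U"
    by fastforce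
  have fU: "finite U" using IH(2) Z(1) finite_subset by blast
  define N where "N = nbh E Z y - (F \<union> insert x U)"
  have fN: "finite N" using Z by (simp add: N_def)
  have yZ: "y \<in> Z" using IH by blast
  have "card (F \<union> insert x U) \<le> card F + (2 * r + 1)"
    using card_Un_le[of F "insert x U"] IH fU by simp
  hence "a < card N" using deg[OF yZ] diff_card_le_card_Diff[of "F \<union> insert x U" "nbh E Z y"] F fU step
    unfolding N_def by simp
  moreover have "N \<subseteq> Z" by (auto simp: N_def nbh_def)
  ultimately obtain u v where uv: "u \<in> N" "v \<in> N" "u \<noteq> v" "{u, v} \<in> E"
    using indep_le_edge[OF Z(2) _ fN] by metis
  have e: "{y, u} \<in> E" "{y, v} \<in> E" "u \<noteq> x" "v \<noteq> x" "u \<in> Z" "v \<in> Z" "u \<notin> F" "v \<notin> F" "u \<notin> U" "v \<notin> U"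
    using uv by (auto simp: N_def nbh_def insert_commute)
  let ?U = "U \<union> {u, v}"
  show ?case
  proof (rule exI[of _ v], rule exI[of _ ?U], intro conjI allI impI)
    show "v \<in> ?U" "?U \<subseteq> Z - F" "x \<notin> ?U" using e IH by auto
    show "card ?U = 2 * Suc r" using e uv IH fU by simp
    fix s assume s: "Suc r \<le> s \<and> s \<le> 2 * Suc r"
    show "\<exists>xs. gpath E xs \<and> hd xs = x \<and> last xs = v \<and> length xs = Suc s \<and> set xs \<subseteq> insert x ?U"
    proof (cases "s \<le> 2 * r + 1")
      case True
      then obtain xs where xs: "gpath E xs" "hd xs = x" "last xs = y" "length xs = Suc (s - 1)" "set xs \<subseteq> insert x U"
        using P[of "s - 1"] s by (metis Suc_le_eq add.commute add_le_imp_le_diff diff_le_mono diff_add_inverse2 le_diff_conv plus_1_eq_Suc)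
      have "gpath E (xs @ [v])" using xs e by (intro gpath_append) auto
      thus ?thesis using xs s by (intro exI[of _ "xs @ [v]"]) (auto simp: gpath_def)
    next
      case False
      hence s2: "s = 2 * r + 2" using s by simp
      then obtain xs where xs: "gpath E xs" "hd xs = x" "last xs = y" "length xs = Suc (2 * r)" "set xs \<subseteq> insert x U"
        using P[of "2 * r"] by auto
      have "gpath E (xs @ [u, v])" using xs e uv by (intro gpath_append) (auto simp: gpath_def)
      thus ?thesis using xs s2 by (intro exI[of _ "xs @ [u, v]"]) (auto simp: gpath_def)
    qed
  qed
qed

text \<open>In essence \<open>f + 1\<close>-connectedness of the subgraph on \<open>Z\<close>,
  together with a minimum degree.\<close>

definition robust :: "nat set set \<Rightarrow> nat set \<Rightarrow> nat \<Rightarrow> nat \<Rightarrow> bool" where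
  "robust E Z d f \<longleftrightarrow> finite Z \<and> Z \<noteq> {} \<and> (\<forall>v\<in>Z. d \<le> card (nbh E Z v)) \<and>
     (\<forall>F \<subseteq> Z. card F \<le> f \<longrightarrow> (\<forall>x\<in>Z - F. \<forall>y\<in>Z - F. (adj_in E (Z - F))\<^sup>*\<^sup>* x y))"

section \<open>Shortest walks\<close>

lemma shortest_walk:
  assumes "(adj_in E W)\<^sup>*\<^sup>* x y"
  obtains h f where "f 0 = x" "f h = y" "\<And>i. i < h \<Longrightarrow> adj_in E W (f i) (f (Suc i))"
    "\<And>h'. (adj_in E W ^^ h') x y \<Longrightarrow> h \<le> h'"
proof -
  define h where "h = (LEAST m. (adj_in E W ^^ m) x y)"
  have "(adj_in E W ^^ h) x y" unfolding h_def
    by (rule LeastI_ex) (use rtranclp_imp_relpowp[OF assms] in blast)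
  then obtain f where "f 0 = x" "f h = y" "\<forall>i<h. adj_in E W (f i) (f (Suc i))"
    by (auto simp: relpowp_fun_conv)
  moreover have "h \<le> h'" if "(adj_in E W ^^ h') x y" for h'
    unfolding h_def using that by (rule Least_le)
  ultimately show ?thesis using that by blast
qed

lemma relpowp_segment:
  assumes "\<And>i. i < h \<Longrightarrow> R (f i) (f (Suc i))" "i \<le> j" "j \<le> h"
  shows "(R ^^ (j - i)) (f i) (f j)"
  unfolding relpowp_fun_conv
  by (rule exI[of _ "\<lambda>t. f (i + t)"]) (use assms in auto)

text \<open>If a vertex were repeated, cutting out the loop between its two occurrences would
  contradict the minimality of \<open>h\<close>.\<close>

lemma shortest_walk_path:
  assumes f: "f 0 = x" "f h = y" "\<And>i. i < h \<Longrightarrow> adj_in E W (f i) (f (Suc i))"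
    and min: "\<And>h'. (adj_in E W ^^ h') x y \<Longrightarrow> h \<le> h'" and "x \<in> W"
  shows "gpath E (map f [0..<Suc h])" "set (map f [0..<Suc h]) \<subseteq> W" "\<And>i. i \<le> h \<Longrightarrow> f i \<in> W"
proof -
  have fW: "f i \<in> W" if "i \<le> h" for i
    using that f(3)[of "i - 1"] assms(5) f(1) by (cases i) (auto simp: adj_in_def)
  show "\<And>i. i \<le> h \<Longrightarrow> f i \<in> W" by (rule fW)
  show "set (map f [0..<Suc h]) \<subseteq> W" using fW by auto
  have neq: "f i \<noteq> f j" if ij: "i < j" "j \<le> h" for i j
  proof
    assume "f i = f j"
    have "(adj_in E W ^^ (i - 0)) (f 0) (f i)" by (rule relpowp_segment[where h = h]) (use f ij in auto)
    moreover have "(adj_in E W ^^ (h - j)) (f j) (f h)" by (rule relpowp_segment[where h = h]) (use f ij in auto)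
    ultimately have "(adj_in E W ^^ (i + (h - j))) x y" using f \<open>f i = f j\<close>
      by (auto simp: relpowp_add)
    from min[OF this] show False using ij by linarith
  qed
  have "inj_on f {0..<Suc h}"
    by (rule inj_onI) (metis atLeastLessThan_iff less_Suc_eq_le linorder_neqE_nat neq)
  moreover have "successively (\<lambda>u v. {u, v} \<in> E) (map f [0..<Suc h])"
    unfolding successively_conv_nth using f(3) by (auto simp: adj_in_def simp del: upt_Suc)
  ultimately show "gpath E (map f [0..<Suc h])"
    by (simp add: gpath_def distinct_map del: upt_Suc)
qed

subsection \<open>Cycles of prescribed length\<close>

lemma cycle_in_nbh:
  assumes "gpath E xs" "set xs \<subseteq> nbh E W v" "2 \<le> length xs"
  shows "is_cycle E (v # xs)"
proof -
  have "hd xs \<in> set xs" "last xs \<in> set xs" using assms by (auto simp: gpath_def)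
  hence "hd xs \<in> nbh E W v" "last xs \<in> nbh E W v" using assms by auto
  hence "{v, hd xs} \<in> E" "{last xs, v} \<in> E" by (auto simp: nbh_def insert_commute)
  moreover have "v \<notin> set xs" using assms(2) by (auto simp: nbh_def)
  ultimately have "is_cycle E ([v] @ xs)" using assms by (intro is_cycle_append) auto
  thus ?thesis by simp
qed

text \<open>A triangle chain from \<open>x\<close> to \<open>y\<close> closes up to the desired length if \<open>x\<close> and \<open>y\<close> are close
  in the rest of \<open>Z\<close>. Otherwise every fourth vertex of a shortest path between them has a
  neighbourhood, these are pairwise non-adjacent, so one of them has small independence number
  and contains a path on \<open>l - 1\<close> vertices.\<close>

lemma short_cycle:
  assumes rob: "robust E Z d f" and al: "indep_le E Z a" and l: "3 \<le> l" "l \<le> f" and d: "8 * a + l + 2 \<le> d"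
  shows "\<exists>xs. is_cycle E xs \<and> set xs \<subseteq> Z \<and> length xs = l"
proof -
  have fZ: "finite Z" and deg: "\<And>v. v \<in> Z \<Longrightarrow> d \<le> card (nbh E Z v)"
    and con: "\<And>F x y. F \<subseteq> Z \<Longrightarrow> card F \<le> f \<Longrightarrow> x \<in> Z - F \<Longrightarrow> y \<in> Z - F \<Longrightarrow> (adj_in E (Z - F))\<^sup>*\<^sup>* x y"
    using rob by (auto simp: robust_def)
  obtain x where x: "x \<in> Z" using rob by (auto simp: robust_def)
  \<comment> \<open>With this choice the chain lengths \<open>r\<close> to \<open>2 * r\<close>
    contain \<open>l - h\<close> for every distance \<open>h\<close> from 1 to
    \<open>l - r\<close>.\<close>
  define r where "r = l div 2"
  have r: "1 \<le> r" "2 * r \<le> l" "l \<le> 2 * r + 1" using l by (auto simp: r_def)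
  have "card ({}::nat set) + 2 * r + a + 2 \<le> d" using d r by simp
  from triangle_chain[OF fZ al deg x _ this r(1)]
  obtain y U where yU: "y \<in> U" "U \<subseteq> Z - {}" "x \<notin> U" "card U = 2 * r"
    and P: "\<And>s. r \<le> s \<Longrightarrow> s \<le> 2 * r \<Longrightarrow>
      \<exists>xs. gpath E xs \<and> hd xs = x \<and> last xs = y \<and> length xs = Suc s \<and> set xs \<subseteq> insert x U"
    by auto
  have fU: "finite U" using yU fZ by (meson Diff_subset finite_subset)
  \<comment> \<open>The chain without its two ends, so that the connection back from
    \<open>y\<close> to \<open>x\<close> meets the chain only there.\<close>
  define F where "F = U - {y}"
  define W where "W = Z - F"
  have cF: "card F = 2 * r - 1" using yU fU by (simp add: F_def)
  have xW: "x \<in> W" and yW: "y \<in> W" using yU x by (auto simp: W_def F_def)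
  have "(adj_in E W)\<^sup>*\<^sup>* y x" unfolding W_def
    by (rule con) (use yU cF r l xW yW in \<open>auto simp: W_def F_def\<close>)
  then obtain h g where g: "g 0 = y" "g h = x" "\<And>i. i < h \<Longrightarrow> adj_in E W (g i) (g (Suc i))"
    and min: "\<And>h'. (adj_in E W ^^ h') y x \<Longrightarrow> h \<le> h'"
    using shortest_walk by metis
  note sp = shortest_walk_path[OF g min yW]
  have h1: "1 \<le> h" using g yU by (cases h) auto
  show ?thesis
  proof (cases "h \<le> l - r")
    case True
    have "r \<le> l - h" "l - h \<le> 2 * r" using True h1 r by auto
    from P[OF this] obtain xs where xs: "gpath E xs" "hd xs = x" "last xs = y" "length xs = Suc (l - h)"
      "set xs \<subseteq> insert x U" by blast
    have hl: "h < l" using True r l by linarith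
    show ?thesis
    proof (cases "h = 1")
      case True
      have "{y, x} \<in> E" using g(3)[of 0] g True by (simp add: adj_in_def)
      hence "is_cycle E xs" using xs True l by (simp add: is_cycle_iff_gpath)
      thus ?thesis using xs True l yU x by (intro exI[of _ xs]) auto
    next
      case False
      hence h2: "2 \<le> h" using h1 by simp
      define qs where "qs = map g [1..<h]"
      have e: "[0..<Suc h] = 0 # [1..<h] @ [h]" using h1 by (simp add: upt_conv_Cons)
      have full: "map g [0..<Suc h] = [y] @ qs @ [x]" unfolding e qs_def using g by simp
      have nq: "qs \<noteq> []" using h2 by (simp add: qs_def)
      have gq: "gpath E qs" "y \<notin> set qs" "x \<notin> set qs" "{y, hd qs} \<in> E" "{last qs, x} \<in> E"
        using sp(1) nq unfolding full by (auto simp: gpath_def successively_append_iff successively_Cons)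
      have qW: "set qs \<subseteq> W" using sp(2) unfolding full by auto
      have "set xs \<inter> set qs = {}" using xs(5) qW gq by (auto simp: W_def F_def)
      hence "is_cycle E (xs @ qs)" using xs gq l hl by (intro is_cycle_append) (auto simp: qs_def)
      moreover have "length (xs @ qs) = l" using xs hl h1 by (simp add: qs_def)
      moreover have "set (xs @ qs) \<subseteq> Z" using xs yU x qW by (auto simp: W_def)
      ultimately show ?thesis by blast
    qed
  next
    case False
    \<comment> \<open>Here \<open>h\<close> exceeds \<open>l / 2\<close>, so taking every fourth
      vertex of the shortest path gives \<open>c + 1\<close> vertices with
      \<open>l \<le> 8 * (c + 1)\<close>.\<close>
    define c where "c = h div 4"
    have c: "4 * c \<le> h" "h < 4 * c + 4" by (auto simp: c_def)
    have "l < r + h" using False r by arith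
    hence "l < 2 * h" using r(2) by linarith
    hence l8: "l \<le> 8 * (c + 1)" using c by simp
    define N where "N i = nbh E W (g (4 * i))" for i
    have fW: "finite W" using fZ by (simp add: W_def)
    have gW: "g (4 * i) \<in> W" if "i \<le> c" for i using sp(3) that c by simp
    have cN: "d - l \<le> card (N i)" if "i \<le> c" for i
    proof -
      have "nbh E Z (g (4 * i)) - F \<subseteq> N i" by (auto simp: N_def nbh_def W_def)
      hence "card (nbh E Z (g (4 * i)) - F) \<le> card (N i)" using fW by (intro card_mono) (auto simp: N_def)
      moreover have "card (nbh E Z (g (4 * i))) - card F \<le> card (nbh E Z (g (4 * i)) - F)"
        using fU by (intro diff_card_le_card_Diff) (simp add: F_def)
      moreover have "d \<le> card (nbh E Z (g (4 * i)))" using gW[OF that] by (intro deg) (simp add: W_def)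
      ultimately show ?thesis using cF r by linarith
    qed
    \<comment> \<open>A common vertex of, or an edge between, two of the neighbourhoods would be a
      shortcut of at most three edges between positions at distance at least four.\<close>
    have nonadj: "u \<noteq> v \<and> {u, v} \<notin> E" if ij: "i < j" "j \<le> c" and uv: "u \<in> N i" "v \<in> N j" for i j u v
    proof (rule ccontr)
      assume neg: "\<not> ?thesis"
      let ?A = "adj_in E W"
      have 1: "(?A ^^ (4 * i - 0)) (g 0) (g (4 * i))" by (rule relpowp_segment[where h = h]) (use g ij c in auto)
      have 2: "(?A ^^ (h - 4 * j)) (g (4 * j)) (g h)" by (rule relpowp_segment[where h = h]) (use g ij c in auto)
      have a1: "?A (g (4 * i)) u" using uv(1) gW[of i] ij by (auto simp: N_def nbh_def adj_in_def insert_commute)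
      have a2: "?A v (g (4 * j))" using uv(2) gW[of j] ij by (auto simp: N_def nbh_def adj_in_def)
      have w1: "(?A ^^ Suc (4 * i)) y u" using 1 a1 g by auto
      have w2: "(?A ^^ Suc (h - 4 * j)) v x" using relpowp_Suc_I2[of ?A, OF a2 2] g by simp
      have uW: "u \<in> W" "v \<in> W" using uv by (auto simp: N_def nbh_def)
      show False
      proof (cases "u = v")
        case True
        hence "(?A ^^ (Suc (4 * i) + Suc (h - 4 * j))) y x" using w1 w2 by (auto simp only: relpowp_add)
        from min[OF this] show False using ij c by linarith
      next
        case F: False
        hence "?A u v" using neg uW by (auto simp: adj_in_def)
        hence "(?A ^^ Suc (Suc (4 * i))) y v" using w1 by auto
        hence "(?A ^^ (Suc (Suc (4 * i)) + Suc (h - 4 * j))) y x" using w2 by (auto simp only: relpowp_add)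
        from min[OF this] show False using ij c by linarith
      qed
    qed
    show ?thesis
    proof (cases "\<exists>i xs. i \<le> c \<and> gpath E xs \<and> set xs \<subseteq> N i \<and> length xs = Suc (l - 2)")
      case True
      then obtain i xs where xs: "i \<le> c" "gpath E xs" "set xs \<subseteq> N i" "length xs = Suc (l - 2)" by blast
      have "is_cycle E (g (4 * i) # xs)" using xs l unfolding N_def by (intro cycle_in_nbh) auto
      moreover have "set (g (4 * i) # xs) \<subseteq> Z" using xs gW[of i] by (auto simp: N_def nbh_def W_def)
      moreover have "length (g (4 * i) # xs) = l" using xs l by simp
      ultimately show ?thesis by blast
    next
      case no: False
      have "\<exists>I \<subseteq> N i. indep E I \<and> card (N i) \<le> (l - 2) * card I" if "i \<le> c" for i
        using path_or_large_indep[of "N i" E "l - 2"] no that fW by (auto simp: N_def)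
      then obtain I where I: "\<And>i. i \<le> c \<Longrightarrow> I i \<subseteq> N i \<and> indep E (I i) \<and> card (N i) \<le> (l - 2) * card (I i)"
        by metis
      have IW: "I i \<subseteq> W" if "i \<le> c" for i using I[OF that] by (auto simp: N_def nbh_def)
      have fI: "finite (I i)" if "i \<le> c" for i using IW[OF that] fW finite_subset by blast
      define S where "S = (\<Union>i\<le>c. I i)"
      have na: "u \<noteq> v \<and> {u, v} \<notin> E" if "i \<noteq> j" "i \<le> c" "j \<le> c" "u \<in> I i" "v \<in> I j" for i j u v
      proof (cases "i < j")
        case True thus ?thesis using nonadj that I by blast
      next
        case False
        hence "j < i" using that by simp
        thus ?thesis using nonadj[of j i v u] that I by (metis insert_commute subsetD)
      qed
      have "indep E S" unfolding indep_def
      proof (intro ballI impI)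
        fix u v assume "u \<in> S" "v \<in> S" "u \<noteq> v"
        then obtain i j where ij: "i \<le> c" "j \<le> c" "u \<in> I i" "v \<in> I j" by (auto simp: S_def)
        show "{u, v} \<notin> E"
        proof (cases "i = j")
          case True thus ?thesis using I[of i] ij \<open>u \<noteq> v\<close> by (auto simp: indep_def)
        next
          case False thus ?thesis using na ij by blast
        qed
      qed
      moreover have "S \<subseteq> Z" using IW by (force simp: S_def W_def)
      ultimately have "card S \<le> a" using al fI by (auto simp: indep_le_def S_def)
      have "card S = (\<Sum>i\<le>c. card (I i))" unfolding S_def
        by (rule card_UN_disjoint) (use fI na in \<open>auto, blast\<close>)
      moreover have "(\<Sum>i\<le>c. d - l) \<le> (\<Sum>i\<le>c. (l - 2) * card (I i))"
        by (rule sum_mono) (use I cN in \<open>meson atMost_iff order_trans\<close>)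
      \<comment> \<open>Each of the \<open>c + 1\<close> sets has at least
        \<open>(d - l) / (l - 2)\<close> vertices, and their union is independent. By
        \<open>l \<le> 8 * (c + 1)\<close> and \<open>8 * a + 2 \<le> d - l\<close> the union has
        more than \<open>a\<close> vertices.\<close>
      ultimately have "(c + 1) * (d - l) \<le> (l - 2) * card S" by (simp flip: sum_distrib_left)
      also have "\<dots> \<le> (l - 2) * a" using \<open>card S \<le> a\<close> by (rule mult_le_mono2)
      finally have "(c + 1) * (d - l) \<le> (l - 2) * a" .
      hence "8 * ((c + 1) * (d - l)) \<le> 8 * ((l - 2) * a)" by (rule mult_le_mono2)
      hence "8 * (c + 1) * (d - l) \<le> 8 * ((l - 2) * a)" by (simp only: mult.assoc)
      moreover have "l * (d - l) \<le> 8 * (c + 1) * (d - l)" using l8 by (rule mult_le_mono1)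
      moreover have "l * (8 * a + 2) \<le> l * (d - l)" using d by (intro mult_le_mono2) simp
      moreover have "8 * ((l - 2) * a) \<le> l * (8 * a)" by (simp add: diff_mult_distrib)
      ultimately have "l * (8 * a + 2) \<le> l * (8 * a)" by linarith
      thus ?thesis using l by simp
    qed
  qed
qed

text \<open>A chain of \<open>2 * a\<close> triangles offers \<open>2 * a + 1\<close> consecutive
  lengths, which matches the uncertainty left by \<open>path_shorten\<close>. Joining its end
  \<open>z\<close> to \<open>y\<close> by a path shortened to at most \<open>2 * a\<close> edges
  merely shifts this interval.\<close>

lemma flexible_path:
  assumes rob: "robust E Z d f" and al: "indep_le E Z a" and a: "1 \<le> a" and d: "5 * a + 3 \<le> d" and f: "4 * a \<le> f"
    and xy: "x \<in> Z" "y \<in> Z" "x \<noteq> y"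
  shows "\<exists>q \<le> 4 * a. \<forall>s. q \<le> s \<and> s \<le> q + 2 * a \<longrightarrow>
     (\<exists>xs. gpath E xs \<and> hd xs = x \<and> last xs = y \<and> length xs = Suc s \<and> set xs \<subseteq> Z)"
proof -
  have fZ: "finite Z" and deg: "\<And>v. v \<in> Z \<Longrightarrow> d \<le> card (nbh E Z v)"
    and con: "\<And>F x y. F \<subseteq> Z \<Longrightarrow> card F \<le> f \<Longrightarrow> x \<in> Z - F \<Longrightarrow> y \<in> Z - F \<Longrightarrow> (adj_in E (Z - F))\<^sup>*\<^sup>* x y"
    using rob by (auto simp: robust_def)
  have "card {y} + 2 * (2 * a) + a + 2 \<le> d" using d by simp
  from triangle_chain[OF fZ al deg xy(1) _ this] a
  obtain z U where zU: "z \<in> U" "U \<subseteq> Z - {y}" "x \<notin> U" "card U = 4 * a"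
    and P: "\<And>s. 2 * a \<le> s \<Longrightarrow> s \<le> 4 * a \<Longrightarrow>
      \<exists>xs. gpath E xs \<and> hd xs = x \<and> last xs = z \<and> length xs = Suc s \<and> set xs \<subseteq> insert x U"
    by auto
  have fU: "finite U" using zU fZ by (meson Diff_subset finite_subset)
  define F where "F = insert x (U - {z})"
  define W where "W = Z - F"
  have cF: "card F = 4 * a" using zU fU a by (simp add: F_def)
  have zW: "z \<in> W" and yW: "y \<in> W" using zU xy by (auto simp: W_def F_def)
  have "(adj_in E W)\<^sup>*\<^sup>* z y" unfolding W_def
    by (rule con) (use zU cF f zW yW xy in \<open>auto simp: W_def F_def\<close>)
  then obtain h g where g: "g 0 = z" "g h = y" "\<And>i. i < h \<Longrightarrow> adj_in E W (g i) (g (Suc i))"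
    and min: "\<And>h'. (adj_in E W ^^ h') z y \<Longrightarrow> h \<le> h'"
    using shortest_walk by metis
  note sp = shortest_walk_path[OF g min zW]
  define ps where "ps = map g [0..<Suc h]"
  have ps: "gpath E ps" "set ps \<subseteq> W" "hd ps = z" "last ps = y"
    using sp g unfolding ps_def by (auto simp: hd_map hd_upt last_map simp del: upt_Suc)
  have "\<exists>ys. gpath E ys \<and> set ys \<subseteq> W \<and> hd ys = z \<and> last ys = y \<and> length ys \<le> 2 * a + 1"
  proof (cases "length ps \<le> 2 * a + 1")
    case True thus ?thesis using ps by blast
  next
    case False
    have "indep_le E (set ps) a" using al ps(2) unfolding W_def by (meson Diff_subset indep_le_mono order_refl order_trans)
    from path_shorten[OF ps(1) order_refl _ this] False show ?thesis using ps by fastforce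
  qed
  then obtain ys where ys: "gpath E ys" "set ys \<subseteq> W" "hd ys = z" "last ys = y" "length ys \<le> 2 * a + 1" by blast
  have zy: "z \<noteq> y" using zU by auto
  obtain ts where ts: "ys = z # ts" using ys by (metis gpath_def list.collapse)
  hence nt: "ts \<noteq> []" using ys zy by auto
  have gt: "gpath E ts" "{z, hd ts} \<in> E" "z \<notin> set ts" "last ts = y"
    using ys nt unfolding ts by (auto simp: gpath_def successively_Cons)
  define t where "t = length ts"
  have t: "1 \<le> t" "t \<le> 2 * a" using nt ys ts by (auto simp: t_def Suc_le_eq)
  show ?thesis
  proof (rule exI[of _ "2 * a + t"], intro conjI allI impI)
    show "2 * a + t \<le> 4 * a" using t by simp
    fix s assume s: "2 * a + t \<le> s \<and> s \<le> 2 * a + t + 2 * a"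
    hence "2 * a \<le> s - t" "s - t \<le> 4 * a" by auto
    from P[OF this] obtain xs where xs: "gpath E xs" "hd xs = x" "last xs = z" "length xs = Suc (s - t)" "set xs \<subseteq> insert x U"
      by blast
    have "set xs \<inter> set ts = {}" using xs(5) ys(2) gt(3) unfolding ts by (auto simp: W_def F_def)
    hence "gpath E (xs @ ts)" using xs gt by (intro gpath_append) auto
    moreover have "hd (xs @ ts) = x" using xs by (cases xs) auto
    moreover have "last (xs @ ts) = y" using nt gt by simp
    moreover have "length (xs @ ts) = Suc s" using xs s by (simp add: t_def)
    moreover have "set (xs @ ts) \<subseteq> Z" using xs ys(2) zU xy unfolding ts by (auto simp: W_def)
    ultimately show "\<exists>xs. gpath E xs \<and> hd xs = x \<and> last xs = y \<and> length xs = Suc s \<and> set xs \<subseteq> Z" by blast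
  qed
qed

text \<open>A greedy choice suffices, since every set is at least as large as the whole index
  set.\<close>

lemma distinct_representatives:
  assumes "finite A" "\<And>z. z \<in> A \<Longrightarrow> finite (N z) \<and> card A \<le> card (N z)"
  shows "\<exists>w. inj_on w A \<and> (\<forall>z\<in>A. w z \<in> N z)"
  using assms
proof (induction A)
  case (insert x A)
  have "\<And>z. z \<in> A \<Longrightarrow> finite (N z) \<and> card A \<le> card (N z)"
    using insert.prems insert.hyps by (metis card_insert_disjoint insertI2 Suc_leD)
  then obtain w where w: "inj_on w A" "\<forall>z\<in>A. w z \<in> N z" using insert.IH by blast
  have "card (w ` A) < card (N x)"
    using insert.prems[of x] insert.hyps card_image_le[of A w] by (simp add: less_eq_Suc_le)
  hence "\<not> N x \<subseteq> w ` A" using insert.hyps by (meson card_mono finite_imageI not_le)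
  then obtain b where b: "b \<in> N x" "b \<notin> w ` A" by blast
  have "inj_on (w(x := b)) (insert x A)" using w b insert.hyps by (auto simp: inj_on_def)
  moreover have "\<forall>z\<in>insert x A. (w(x := b)) z \<in> N z" using w b insert.hyps by auto
  ultimately show ?case by blast
qed auto

text \<open>The cycle becomes a spanning path between neighbours of two vertices of \<open>Z\<close>; shortening it
  leaves gaps of at most \<open>2 * a\<close> in the lengths, which the flexible path through \<open>Z\<close> fills.\<close>

lemma middle_cycle:
  assumes sub: "E \<subseteq> \<Gamma>" and cyc: "is_cycle \<Gamma> cs" "set cs = V1" and disj: "Z \<inter> V1 = {}"
    and al: "indep_le E (Z \<union> V1) a" and rob: "robust E Z d f"
    and a: "1 \<le> a" and d: "5 * a + 3 \<le> d" and f: "4 * a \<le> f"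
    and nb: "\<And>z. z \<in> Z \<Longrightarrow> a + 1 \<le> card (nbh E V1 z)"
    and l: "6 * a + 2 \<le> l" "l \<le> card V1"
  shows "\<exists>xs. is_cycle \<Gamma> xs \<and> set xs \<subseteq> Z \<union> V1 \<and> length xs = l"
proof -
  have fZ: "finite Z" and deg: "\<And>v. v \<in> Z \<Longrightarrow> d \<le> card (nbh E Z v)" and "Z \<noteq> {}"
    using rob by (auto simp: robust_def)
  then obtain v where v: "v \<in> Z" by blast
  have "d \<le> card Z" using deg[OF v] card_mono[OF fZ nbh_subset, of E v] by simp
  hence "a + 1 \<le> card Z" using d by linarith
  \<comment> \<open>With \<open>a + 1\<close> vertices, their distinct neighbours on the cycle form
    a set large enough for \<open>cycle_spanning_path\<close>, which then puts both path ends next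
    to vertices of \<open>Z\<close>.\<close>
  then obtain Z0 where Z0: "Z0 \<subseteq> Z" "card Z0 = a + 1" "finite Z0"
    using obtain_subset_with_card_n by metis
  have fV1: "finite V1" using cyc(2) by auto
  have "\<exists>w. inj_on w Z0 \<and> (\<forall>z\<in>Z0. w z \<in> nbh E V1 z)"
    by (rule distinct_representatives) (use Z0 nb fV1 in auto)
  then obtain w where w: "inj_on w Z0" "\<And>z. z \<in> Z0 \<Longrightarrow> w z \<in> nbh E V1 z" by blast
  have "w ` Z0 \<subseteq> set cs" using w cyc by (auto simp: nbh_def)
  moreover have "a < card (w ` Z0)" using w Z0 by (simp add: card_image)
  moreover have "indep_le \<Gamma> (set cs) a" using al sub cyc(2) by (meson Un_upper2 indep_le_mono)
  ultimately obtain ys where ys: "gpath \<Gamma> ys" "set ys = set cs" "hd ys \<in> w ` Z0" "last ys \<in> w ` Z0" "hd ys \<noteq> last ys"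
    using cycle_spanning_path[OF cyc(1)] by metis
  then obtain z z' where z: "z \<in> Z0" "z' \<in> Z0" "hd ys = w z" "last ys = w z'" by blast
  have zz: "z' \<noteq> z" using z ys by auto
  have alZ: "indep_le E Z a" using al by (meson Un_upper1 indep_le_mono order_refl)
  obtain q where q: "q \<le> 4 * a" and Q: "\<And>s. q \<le> s \<Longrightarrow> s \<le> q + 2 * a \<Longrightarrow>
     \<exists>xs. gpath E xs \<and> hd xs = z' \<and> last xs = z \<and> length xs = Suc s \<and> set xs \<subseteq> Z"
    using flexible_path[OF rob alZ a d f _ _ zz] z Z0 by (metis subsetD)
  \<comment> \<open>A path on \<open>t - 2 * a\<close> to \<open>t\<close> vertices leaves between
    \<open>q + 1\<close> and \<open>q + 1 + 2 * a\<close> vertices to be supplied, and these are the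
    sizes of the paths offered by \<open>Z\<close>. The bound \<open>6 * a + 2 \<le> l\<close> makes
    \<open>t\<close> at least \<open>2 * a + 1\<close>.\<close>
  define t where "t = l - q - 1"
  have t: "2 * a + 1 \<le> t" "t \<le> l" using q l by (auto simp: t_def)
  have ly: "length ys = card V1" using ys cyc by (metis distinct_card gpath_def)
  have "indep_le \<Gamma> (set ys) a" using al sub cyc(2) ys(2) by (metis Un_upper2 indep_le_mono)
  from path_shorten[OF ys(1) _ _ this, of t] obtain ps where ps: "gpath \<Gamma> ps" "set ps \<subseteq> set ys"
    "hd ps = hd ys" "last ps = last ys" "length ps \<le> t" "t \<le> length ps + 2 * a"
    using t ly l by (metis order_trans)
  have "q \<le> l - 1 - length ps" "l - 1 - length ps \<le> q + 2 * a" using ps q l by (auto simp: t_def)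
  from Q[OF this] obtain zs where zs: "gpath E zs" "hd zs = z'" "last zs = z" "length zs = Suc (l - 1 - length ps)" "set zs \<subseteq> Z"
    by blast
  have len: "length ps + length zs = l" using zs ps l q by (simp add: t_def)
  have "is_cycle \<Gamma> (ps @ zs)"
  proof (rule is_cycle_append)
    show "gpath \<Gamma> zs" using zs sub gpath_mono by blast
    show "{last ps, hd zs} \<in> \<Gamma>" using w(2)[OF z(2)] ps z zs sub by (auto simp: nbh_def)
    show "{last zs, hd ps} \<in> \<Gamma>" using w(2)[OF z(1)] ps z zs sub by (auto simp: nbh_def insert_commute)
    show "set ps \<inter> set zs = {}" using ps ys zs cyc disj by auto
    show "3 \<le> length ps + length zs" using len l a by simp
  qed fact
  moreover have "set (ps @ zs) \<subseteq> Z \<union> V1" using ps ys cyc zs by auto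
  ultimately show ?thesis using len by (metis length_append)
qed

section \<open>Highly connected subgraphs\<close>

definition edge_pairs :: "nat set set \<Rightarrow> nat set \<Rightarrow> (nat \<times> nat) set" where
  "edge_pairs E Z = Sigma Z (nbh E Z)"

text \<open>Mader's argument: a vertex set that is minimal subject to carrying many edges.\<close>

lemma exists_robust_subset:
  assumes fV: "finite V" "V \<noteq> {}" and deg: "\<And>v. v \<in> V \<Longrightarrow> 2 * d \<le> card (nbh E V v)"
    and f: "1 \<le> f" "2 * f \<le> d"
  shows "\<exists>Z \<subseteq> V. robust E Z d f"
proof -
  define e where "e Z = card (edge_pairs E Z)" for Z
  \<comment> \<open>\<open>edge_pairs\<close> counts each edge twice, so the last condition asks for
    more than \<open>d * (card Z - f)\<close> edges, written without subtraction.\<close>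
  define P where "P Z \<longleftrightarrow> Z \<subseteq> V \<and> 2 * f \<le> card Z \<and> 2 * d * card Z < e Z + 2 * d * f" for Z
  have e_sum: "e Z = (\<Sum>v\<in>Z. card (nbh E Z v))" if "finite Z" for Z
    unfolding e_def edge_pairs_def using that by (subst card_SigmaI) auto
  obtain v where v: "v \<in> V" using fV by blast
  have "2 * d \<le> card V" using deg[OF v] card_mono[OF fV(1) nbh_subset, of E v] by simp
  moreover have "(\<Sum>v\<in>V. 2 * d) \<le> e V" unfolding e_sum[OF fV(1)] by (rule sum_mono) (use deg in auto)
  ultimately have "P V" using f by (auto simp: P_def mult.commute intro: le_less_trans)
  then obtain Z where Z: "P Z" and min: "\<And>Y. P Y \<Longrightarrow> card Z \<le> card Y"
    using ex_has_least_nat[of P V card] by blast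
  have ZV: "Z \<subseteq> V" and cZ: "2 * f \<le> card Z" and eZ: "2 * d * card Z < e Z + 2 * d * f" using Z by (auto simp: P_def)
  have fZ: "finite Z" using ZV fV finite_subset by blast
  have small: "e Y + 2 * d * f \<le> 2 * d * card Y" if "Y \<subseteq> Z" "card Y < card Z" "2 * f \<le> card Y" for Y
    using min[of Y] that ZV by (force simp: P_def)
  have fe: "finite (edge_pairs E Y)" if "finite Y" for Y using that by (auto simp: edge_pairs_def)
  \<comment> \<open>Even a complete graph on \<open>2 * f\<close> vertices has too few edges. So a
    vertex can be deleted from the minimal set without violating the size condition.\<close>
  have "card Z \<noteq> 2 * f"
  proof
    assume c: "card Z = 2 * f"
    have "e Z \<le> card (Z \<times> Z)" unfolding e_def edge_pairs_def
      by (rule card_mono) (use fZ in \<open>auto simp: nbh_def\<close>)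
    hence "e Z \<le> 2 * (2 * f) * f" using c by (simp add: card_cartesian_product)
    also have "2 * (2 * f) * f \<le> 2 * d * f" using f by (intro mult_le_mono) auto
    finally have "e Z \<le> 2 * d * f" .
    thus False using eZ c by (simp add: mult.assoc)
  qed
  hence cZ': "2 * f < card Z" using cZ by simp
  \<comment> \<open>Deleting a vertex of degree at most \<open>d\<close> removes at most
    \<open>2 * d\<close> ordered pairs and would leave a smaller set satisfying
    \<open>P\<close>.\<close>
  have degZ: "d < card (nbh E Z v)" if v: "v \<in> Z" for v
  proof -
    have "edge_pairs E Z \<subseteq> edge_pairs E (Z - {v}) \<union> ({v} \<times> nbh E Z v \<union> nbh E Z v \<times> {v})"
      by (auto simp: edge_pairs_def nbh_def insert_commute)
    hence "e Z \<le> card (edge_pairs E (Z - {v}) \<union> ({v} \<times> nbh E Z v \<union> nbh E Z v \<times> {v}))"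
      unfolding e_def by (rule card_mono[rotated]) (use fZ fe in auto)
    also have "\<dots> \<le> e (Z - {v}) + (card ({v} \<times> nbh E Z v) + card (nbh E Z v \<times> {v}))"
      unfolding e_def by (meson add_left_mono card_Un_le order_trans)
    finally have "e Z \<le> e (Z - {v}) + 2 * card (nbh E Z v)" by (simp add: card_cartesian_product)
    moreover have "card (Z - {v}) = card Z - 1" using v fZ by simp
    moreover from this have "e (Z - {v}) + 2 * d * f \<le> 2 * d * (card Z - 1)"
      using small[of "Z - {v}"] cZ' by auto
    moreover have "2 * d * (card Z - 1) + 2 * d = 2 * d * card Z" using cZ'
      by (metis One_nat_def Suc_pred less_nat_zero_code mult_Suc_right neq0_conv add.commute)
    ultimately show ?thesis using eZ by linarith
  qed
  have "(adj_in E (Z - F))\<^sup>*\<^sup>* x y" if F: "F \<subseteq> Z" "card F \<le> f" and xy: "x \<in> Z - F" "y \<in> Z - F" for F x y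
  proof (rule ccontr)
    assume no: "\<not> ?thesis"
    define A where "A = {u \<in> Z - F. (adj_in E (Z - F))\<^sup>*\<^sup>* x u}"
    define B where "B = Z - F - A"
    have sep: "{u, v} \<notin> E" if "u \<in> A" "v \<in> B" for u v
    proof
      assume "{u, v} \<in> E"
      hence "adj_in E (Z - F) u v" using that by (auto simp: A_def B_def adj_in_def)
      hence "v \<in> A" using that by (auto simp: A_def B_def intro: rtranclp.rtrancl_into_rtrancl)
      thus False using that by (simp add: B_def)
    qed
    have xA: "x \<in> A" and yB: "y \<in> B" using xy no by (auto simp: A_def B_def)
    have fin: "finite A" "finite B" "finite F" using fZ F finite_subset by (auto simp: A_def B_def)
    have Zu: "Z = A \<union> B \<union> F" "A \<inter> B = {}" "A \<inter> F = {}" "B \<inter> F = {}" using F by (auto simp: A_def B_def)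
    have "nbh E Z x \<subseteq> A \<union> F"
      using sep[OF xA] xA Zu(1) by (auto simp: nbh_def insert_commute)
    hence "card (nbh E Z x) \<le> card (A \<union> F)" using fin by (intro card_mono) auto
    hence c1: "d < card (A \<union> F)" using degZ[of x] xy by simp
    have "nbh E Z y \<subseteq> B \<union> F"
      using sep[OF _ yB] yB Zu(1) by (auto simp: nbh_def)
    hence "card (nbh E Z y) \<le> card (B \<union> F)" using fin by (intro card_mono) auto
    hence c2: "d < card (B \<union> F)" using degZ[of y] xy by simp
    \<comment> \<open>Both sets contain a neighbourhood, hence more than \<open>d\<close> and so at
      least \<open>2 * f\<close> vertices, and by minimality they have few edges. When the two
      bounds are added, the overlap \<open>F\<close> is absorbed by the term
      \<open>2 * d * f\<close>.\<close>
    have "A \<union> F \<subset> Z" "B \<union> F \<subset> Z" using xA yB Zu xy by auto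
    hence "card (A \<union> F) < card Z" "card (B \<union> F) < card Z" using fZ by (auto intro: psubset_card_mono)
    hence s: "e (A \<union> F) + 2 * d * f \<le> 2 * d * card (A \<union> F)" "e (B \<union> F) + 2 * d * f \<le> 2 * d * card (B \<union> F)"
      using small[of "A \<union> F"] small[of "B \<union> F"] c1 c2 f Zu(1) by auto
    have "{u, v} \<notin> E" if "u \<in> B" "v \<in> A" for u v using sep[OF that(2,1)] by (simp add: insert_commute)
    hence "edge_pairs E Z \<subseteq> edge_pairs E (A \<union> F) \<union> edge_pairs E (B \<union> F)"
      using sep Zu(1) by (auto simp: edge_pairs_def nbh_def insert_commute)
    hence "e Z \<le> e (A \<union> F) + e (B \<union> F)" unfolding e_def using fin fe
      by (meson card_Un_le card_mono finite_UnI order_trans)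
    moreover have "card (A \<union> F) + card (B \<union> F) \<le> card Z + f"
      using Zu fin F(2) by (simp add: card_Un_disjoint Int_Un_distrib2)
    hence "2 * d * (card (A \<union> F) + card (B \<union> F)) \<le> 2 * d * (card Z + f)" by (rule mult_le_mono2)
    ultimately show False using s eZ by (simp add: algebra_simps)
  qed
  moreover have "Z \<noteq> {}" using cZ' by auto
  ultimately have "robust E Z d f" using fZ degZ by (auto simp: robust_def less_imp_le)
  thus ?thesis using ZV by blast
qed

subsection \<open>Partitioning the vertex set\<close>

text \<open>Repeatedly pick a vertex of degree below \<open>d\<close> and delete it with its
  neighbours, at most \<open>d\<close> vertices at a time. If this exhausts \<open>M\<close>, the
  picked vertices form the independent set; if it gets stuck, the remainder is the dense
  set.\<close>

lemma dense_subset_or_large_indep: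
  assumes "finite M"
  shows "(\<exists>V \<subseteq> M. V \<noteq> {} \<and> (\<forall>v\<in>V. d \<le> card (nbh E V v))) \<or>
    (\<exists>I \<subseteq> M. indep E I \<and> card M \<le> d * card I)"
  using assms
proof (induction "card M" arbitrary: M rule: less_induct)
  case less
  show ?case
  proof (cases "\<exists>v\<in>M. card (nbh E M v) < d")
    case False
    hence "M = {} \<or> M \<noteq> {} \<and> (\<forall>v\<in>M. d \<le> card (nbh E M v))" by (auto simp: not_less)
    moreover have "indep E {}" by (simp add: indep_def)
    ultimately show ?thesis by (metis card.empty order_refl zero_le)
  next
    case True
    then obtain v where v: "v \<in> M" "card (nbh E M v) < d" by blast
    define B where "B = insert v (nbh E M v)"
    have BM: "B \<subseteq> M" "finite B" using v less.prems by (auto simp: B_def nbh_def)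
    have cB: "card B \<le> d" using v less.prems by (simp add: B_def card_insert_if)
    have "card (M - B) < card M" using v less.prems BM by (intro psubset_card_mono) (auto simp: B_def)
    from less.hyps[OF this] less.prems consider
        "\<exists>V \<subseteq> M - B. V \<noteq> {} \<and> (\<forall>v\<in>V. d \<le> card (nbh E V v))"
      | I where "I \<subseteq> M - B" "indep E I" "card (M - B) \<le> d * card I" by (metis finite_Diff)
    thus ?thesis
    proof cases
      case 1 thus ?thesis by blast
    next
      case 2
      have "indep E (insert v I)"
        using 2 unfolding indep_def by (auto simp: B_def nbh_def insert_commute)
      moreover have "finite I" "v \<notin> I" using 2 less.prems finite_subset by (auto simp: B_def)
      moreover have "card M = card (M - B) + card B"
        using BM less.prems by (metis add.commute card_Diff_subset card_mono le_add_diff_inverse)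
      ultimately have "indep E (insert v I) \<and> card M \<le> d * card (insert v I)" using 2 cB by simp
      moreover have "insert v I \<subseteq> M" using 2 v by auto
      ultimately show ?thesis by blast
    qed
  qed
qed

text \<open>Markov's inequality with weight \<open>(3/4) ^ 4\<close> per element of \<open>N\<close>; the rate is
  \<open>337/384 = (1 + (3/4) ^ 4) / (2 * (3/4))\<close>.\<close>

lemma card_small_trace_le:
  assumes V: "finite V" and N: "N \<subseteq> V" "card N = k"
  shows "real (card {S \<in> Pow V. 4 * card (S \<inter> N) < k}) \<le> 2 ^ card V * (337/384) ^ k"
proof -
  define x where "x = (81/256 :: real)"
  define g where "g v = (if v \<in> N then x else 1)" for v
  have fN: "finite N" using N V finite_subset by blast
  have gS: "prod g S = x ^ card (S \<inter> N)" if "S \<subseteq> V" for S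
  proof -
    have fS: "finite S" using that V finite_subset by blast
    have "prod g S = prod g (S \<inter> N) * prod g (S - N)" by (rule prod.Int_Diff[OF fS])
    also have "\<dots> = x ^ card (S \<inter> N)" by (simp add: g_def)
    finally show ?thesis .
  qed
  have "(\<Sum>S\<in>Pow V. x ^ card (S \<inter> N)) = (\<Sum>S\<in>Pow V. prod g S * prod (\<lambda>_. 1) (V - S))"
    by (intro sum.cong) (auto simp: gS)
  also have "\<dots> = (\<Prod>v\<in>V. g v + 1)" by (rule prod_add[OF V, symmetric])
  also have "\<dots> = (\<Prod>v\<in>V \<inter> N. g v + 1) * (\<Prod>v\<in>V - N. g v + 1)" by (rule prod.Int_Diff[OF V])
  also have "\<dots> = (x + 1) ^ k * 2 ^ (card V - k)"
    using N V fN by (simp add: g_def Int_absorb1 card_Diff_subset)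
  finally have tot: "(\<Sum>S\<in>Pow V. x ^ card (S \<inter> N)) = (x + 1) ^ k * 2 ^ (card V - k)" .
  define B where "B = {S \<in> Pow V. 4 * card (S \<inter> N) < k}"
  have "real (card B) * (3/4) ^ k = (\<Sum>S\<in>B. (3/4) ^ k)" by simp
  also have "\<dots> \<le> (\<Sum>S\<in>B. x ^ card (S \<inter> N))"
  proof (rule sum_mono)
    fix S assume "S \<in> B"
    hence "4 * card (S \<inter> N) \<le> k" by (simp add: B_def)
    hence "(3/4::real) ^ k \<le> (3/4) ^ (4 * card (S \<inter> N))" by (intro power_decreasing) auto
    also have "\<dots> = x ^ card (S \<inter> N)" by (simp add: x_def power_mult power4_eq_xxxx)
    finally show "(3/4) ^ k \<le> x ^ card (S \<inter> N)" .
  qed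
  also have "\<dots> \<le> (\<Sum>S\<in>Pow V. x ^ card (S \<inter> N))"
    by (rule sum_mono2) (use V in \<open>auto simp: B_def x_def\<close>)
  also have "\<dots> = (x + 1) ^ k * 2 ^ (card V - k)" by (rule tot)
  finally have main: "real (card B) * (3/4) ^ k \<le> (x + 1) ^ k * 2 ^ (card V - k)" .
  have kV: "k \<le> card V" using N V card_mono by blast
  have "(2::real) ^ card V = 2 ^ (card V - k) * 2 ^ k" using kV by (simp flip: power_add)
  hence "2 ^ card V * (337/384) ^ k * (3/4) ^ k = (2 ^ (card V - k) :: real) * (2 * (337/384) * (3/4)) ^ k"
    by (simp only: power_mult_distrib mult_ac)
  also have "\<dots> = (x + 1) ^ k * 2 ^ (card V - k)" by (simp add: x_def)
  finally have "real (card B) * (3/4) ^ k \<le> 2 ^ card V * (337/384) ^ k * (3/4) ^ k" using main by simp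
  thus ?thesis unfolding B_def by simp
qed

text \<open>The probabilistic method by counting: for a uniformly random \<open>S\<close> a given
  vertex has too few neighbours in \<open>S\<close> or in its complement with probability at most
  \<open>2 * (337/384) ^ k\<close>, and the union bound over \<open>V\<close> stays below 1.\<close>

lemma balanced_partition:
  assumes V: "finite V" and deg: "\<And>v. v \<in> V \<Longrightarrow> k \<le> card (nbh E V v)"
    and small: "2 * real (card V) * (337/384) ^ k < 1"
  shows "\<exists>S \<subseteq> V. \<forall>v\<in>V. k \<le> 4 * card (nbh E S v) \<and> k \<le> 4 * card (nbh E (V - S) v)"
proof -
  have "\<exists>N. N \<subseteq> nbh E V v \<and> card N = k" if "v \<in> V" for v
    using obtain_subset_with_card_n[OF deg[OF that]] by metis
  then obtain N where N: "\<And>v. v \<in> V \<Longrightarrow> N v \<subseteq> nbh E V v \<and> card (N v) = k" by metis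
  have NV: "N v \<subseteq> V" if "v \<in> V" for v using N[OF that] by (auto simp: nbh_def)
  define B where "B v = {S \<in> Pow V. 4 * card (S \<inter> N v) < k}" for v
  define B' where "B' v = (\<lambda>S. V - S) ` B v" for v
  have fB: "finite (B v)" "finite (B' v)" for v using V by (auto simp: B_def B'_def)
  have cB: "real (card (B v)) \<le> 2 ^ card V * (337/384) ^ k" if "v \<in> V" for v
    unfolding B_def using card_small_trace_le[OF V NV[OF that]] N[OF that] by simp
  have cB': "real (card (B' v)) \<le> 2 ^ card V * (337/384) ^ k" if "v \<in> V" for v
    using cB[OF that] card_image_le[OF fB(1), of "\<lambda>S. V - S" v] unfolding B'_def by linarith
  have "real (card (\<Union>v\<in>V. B v \<union> B' v)) \<le> real (\<Sum>v\<in>V. card (B v \<union> B' v))"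
    using card_UN_le[OF V] by (simp del: of_nat_sum)
  also have "\<dots> \<le> (\<Sum>v\<in>V. 2 * (2 ^ card V * (337/384) ^ k))"
    unfolding of_nat_sum
  proof (rule sum_mono)
    fix v assume v: "v \<in> V"
    have "real (card (B v \<union> B' v)) \<le> real (card (B v)) + real (card (B' v))"
      using card_Un_le[of "B v" "B' v"] by linarith
    thus "real (card (B v \<union> B' v)) \<le> 2 * (2 ^ card V * (337/384) ^ k)" using cB[OF v] cB'[OF v] by linarith
  qed
  also have "\<dots> = (2 * real (card V) * (337/384) ^ k) * 2 ^ card V" by simp
  also have "\<dots> < 1 * 2 ^ card V" by (rule mult_strict_right_mono[OF small]) simp
  also have "\<dots> = real (card (Pow V))" using V by (simp add: card_Pow)
  finally have "card (\<Union>v\<in>V. B v \<union> B' v) < card (Pow V)" by simp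
  hence "\<not> Pow V \<subseteq> (\<Union>v\<in>V. B v \<union> B' v)" using V fB by (meson card_mono finite_UN_I finite_UnI not_le)
  then obtain S where S: "S \<subseteq> V" "\<And>v. v \<in> V \<Longrightarrow> S \<notin> B v \<and> S \<notin> B' v" by auto
  have "k \<le> 4 * card (nbh E S v) \<and> k \<le> 4 * card (nbh E (V - S) v)" if v: "v \<in> V" for v
  proof -
    have fS: "finite S" using S V finite_subset by blast
    have "k \<le> 4 * card (S \<inter> N v)" using S(1) S(2)[OF v] by (auto simp: B_def not_less)
    moreover have "card (S \<inter> N v) \<le> card (nbh E S v)"
      by (rule card_mono) (use fS N[OF v] in \<open>auto simp: nbh_def\<close>)
    moreover have "V - S \<notin> B v"
    proof
      assume "V - S \<in> B v"
      hence "V - (V - S) \<in> B' v" unfolding B'_def by blast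
      thus False using S v by (simp add: double_diff)
    qed
    hence "k \<le> 4 * card ((V - S) \<inter> N v)" by (auto simp: B_def not_less)
    moreover have "card ((V - S) \<inter> N v) \<le> card (nbh E (V - S) v)"
      by (rule card_mono) (use V N[OF v] in \<open>auto simp: nbh_def\<close>)
    ultimately show ?thesis by linarith
  qed
  thus ?thesis using S(1) by blast
qed

text \<open>For \<open>n < 5 * k ^ 5\<close> a random set works; otherwise \<open>V0\<close> can be found inside a small set of
  vertices avoiding the neighbourhoods of the few vertices of low degree.\<close>

lemma reservoir_partition:
  assumes n: "0 < n" and deg: "\<And>v. v < n \<Longrightarrow> k \<le> card (nbh E {..<n} v)"
    and al: "indep_le E {..<n} a" and a: "1 \<le> a" "1000 * a \<le> k"
    and small: "n < 5 * k ^ 5 \<Longrightarrow> 2 * real n * (337/384) ^ k < 1"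
  shows "\<exists>V1 \<subseteq> {..<n}. n \<le> 2 * card V1 \<and> (\<forall>v<n. k \<le> 4 * card (nbh E V1 v)) \<and>
    (\<exists>V0 \<subseteq> {..<n} - V1. V0 \<noteq> {} \<and> (\<forall>v\<in>V0. 40 * a \<le> card (nbh E V0 v)))"
proof (cases "n < 5 * k ^ 5")
  case True
  have "\<exists>S \<subseteq> {..<n}. \<forall>v\<in>{..<n}. k \<le> 4 * card (nbh E S v) \<and> k \<le> 4 * card (nbh E ({..<n} - S) v)"
    by (rule balanced_partition) (use deg small[OF True] in auto)
  then obtain S where S: "S \<subseteq> {..<n}"
    "\<And>v. v < n \<Longrightarrow> k \<le> 4 * card (nbh E S v) \<and> k \<le> 4 * card (nbh E ({..<n} - S) v)"
    by auto
  have cc: "card S + card ({..<n} - S) = n" using S(1)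
    by (metis card_Diff_subset card_lessThan card_mono finite_lessThan finite_subset le_add_diff_inverse)
  \<comment> \<open>Degrees are controlled on both sides, so the larger side may be taken.\<close>
  define V1 where "V1 = (if n \<le> 2 * card S then S else {..<n} - S)"
  have V1: "V1 \<subseteq> {..<n}" "n \<le> 2 * card V1" using S(1) cc by (auto simp: V1_def)
  have "{..<n} - V1 = (if n \<le> 2 * card S then {..<n} - S else S)" using S(1) by (auto simp: V1_def)
  hence V1d: "k \<le> 4 * card (nbh E V1 v)" "k \<le> 4 * card (nbh E ({..<n} - V1) v)" if "v < n" for v
    using S(2)[OF that] by (auto simp: V1_def)
  have "nbh E ({..<n} - V1) 0 \<noteq> {}" using V1d(2)[OF n] a by auto
  hence "{..<n} - V1 \<noteq> {}" by (auto simp: nbh_def)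
  moreover have "40 * a \<le> card (nbh E ({..<n} - V1) v)" if "v \<in> {..<n} - V1" for v
    using V1d(2)[of v] a that by simp
  ultimately show ?thesis using V1 V1d(1) by blast
next
  case False
  \<comment> \<open>Just above \<open>40 * a * a\<close>: a set of \<open>s\<close> vertices without
    a subgraph of minimum degree \<open>40 * a\<close> would contain more than \<open>a\<close>
    independent vertices.\<close>
  define s where "s = 40 * a * a + 1"
  \<comment> \<open>By this threshold a vertex outside \<open>L\<close> keeps \<open>k\<close>
    neighbours when \<open>s\<close> vertices are removed. Vertices of \<open>L\<close> will lose
    none, since the removed set avoids \<open>M\<close>.\<close>
  define L where "L = {v \<in> {..<n}. card (nbh E {..<n} v) < s + k}"
  define M where "M = (\<Union>v\<in>L. nbh E {..<n} v)"
  have fL: "finite L" by (simp add: L_def)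
  have cI: "card I \<le> a" if "I \<subseteq> {..<n}" "indep E I" for I
    using al that unfolding indep_le_def by (meson finite_lessThan finite_subset)
  \<comment> \<open>No subset of \<open>L\<close> has minimum degree \<open>s + k\<close>, so
    \<open>L\<close> is small because its independent sets are.\<close>
  have cL: "card L \<le> (s + k) * a"
  proof -
    from dense_subset_or_large_indep[OF fL, of "s + k" E] show ?thesis
    proof
      assume "\<exists>V \<subseteq> L. V \<noteq> {} \<and> (\<forall>v\<in>V. s + k \<le> card (nbh E V v))"
      then obtain V v where V: "V \<subseteq> L" "v \<in> V" "s + k \<le> card (nbh E V v)" by blast
      have "card (nbh E V v) \<le> card (nbh E {..<n} v)"
        by (rule card_mono) (use V in \<open>auto simp: nbh_def L_def\<close>)
      thus ?thesis using V by (auto simp: L_def)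
    next
      assume "\<exists>I \<subseteq> L. indep E I \<and> card L \<le> (s + k) * card I"
      then obtain I where I: "I \<subseteq> L" "indep E I" "card L \<le> (s + k) * card I" by blast
      have "card I \<le> a" using I by (intro cI) (auto simp: L_def)
      thus ?thesis using I(3) by (meson mult_le_mono2 order_trans)
    qed
  qed
  have "card M \<le> (\<Sum>v\<in>L. card (nbh E {..<n} v))" unfolding M_def by (rule card_UN_le[OF fL])
  also have "\<dots> \<le> (\<Sum>v\<in>L. s + k)" by (rule sum_mono) (simp add: L_def)
  also have "\<dots> \<le> ((s + k) * a) * (s + k)" using cL by (simp only: sum_constant of_nat_id mult_le_mono1)
  finally have cM: "card M \<le> ((s + k) * a) * (s + k)" .
  have k1: "1 \<le> k" using a by linarith
  have "s \<le> 40 * a * (40 * a)" using a unfolding s_def by simp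
  also have "\<dots> \<le> k * k" by (rule mult_le_mono) (use a in auto)
  finally have sk: "s \<le> k * k" .
  have "s + k \<le> 2 * (k * k)" using sk le_square[of k] by linarith
  \<comment> \<open>The origin of the fifth power: \<open>s + k \<le> 2 * (k * k)\<close> enters
    twice, and the remaining factor \<open>4 * a\<close> is at most \<open>k\<close>.\<close>
  hence "((s + k) * a) * (s + k) \<le> (2 * (k * k) * a) * (2 * (k * k))" by (intro mult_le_mono) auto
  also have "\<dots> = (4 * a) * (k * k * k * k)" by simp
  also have "\<dots> \<le> k * (k * k * k * k)" using a by (intro mult_le_mono) auto
  also have "\<dots> = k ^ 5" by (simp add: power_numeral_reduce)
  finally have "card M \<le> k ^ 5" using cM by linarith
  moreover have "k * k \<le> k ^ 5"
    using k1 power_increasing[of 2 5 k] by (simp add: power2_eq_square)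
  ultimately have cM5: "card M + 2 * s \<le> n" using False sk by linarith
  have MV: "M \<subseteq> {..<n}" by (auto simp: M_def nbh_def)
  have "card ({..<n} - M) = n - card M" using MV by (simp add: card_Diff_subset finite_subset[OF MV])
  hence "s \<le> card ({..<n} - M)" using cM5 by simp
  then obtain V2 where V2: "V2 \<subseteq> {..<n} - M" "card V2 = s" using obtain_subset_with_card_n by metis
  have fV2: "finite V2" using V2 finite_subset by blast
  define V1 where "V1 = {..<n} - V2"
  have V1: "V1 \<subseteq> {..<n}" "{..<n} - V1 = V2" using V2 by (auto simp: V1_def)
  have "card V1 = n - s" using V2 fV2 unfolding V1_def by (subst card_Diff_subset) auto
  hence "n \<le> 2 * card V1" using cM5 by simp
  moreover have "k \<le> 4 * card (nbh E V1 v)" if v: "v < n" for v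
  proof (cases "v \<in> L")
    case True
    have "nbh E {..<n} v \<subseteq> nbh E V1 v" using V2 True by (auto simp: nbh_def V1_def M_def)
    hence "card (nbh E {..<n} v) \<le> card (nbh E V1 v)" by (intro card_mono) (auto simp: V1_def)
    thus ?thesis using deg[OF v] by simp
  next
    case False
    hence "s + k \<le> card (nbh E {..<n} v)" using v by (simp add: L_def)
    moreover have "card (nbh E {..<n} v) - card V2 \<le> card (nbh E {..<n} v - V2)"
      using fV2 by (rule diff_card_le_card_Diff)
    moreover have "nbh E {..<n} v - V2 = nbh E V1 v" by (auto simp: nbh_def V1_def)
    ultimately show ?thesis using V2 by simp
  qed
  moreover have "\<exists>V0 \<subseteq> V2. V0 \<noteq> {} \<and> (\<forall>v\<in>V0. 40 * a \<le> card (nbh E V0 v))"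
  proof (rule ccontr)
    assume "\<not> ?thesis"
    then obtain I where I: "I \<subseteq> V2" "indep E I" "card V2 \<le> 40 * a * card I"
      using dense_subset_or_large_indep[OF fV2, of "40 * a" E] by blast
    have "card I \<le> a" using I V2 by (intro cI) auto
    hence "40 * a * card I \<le> 40 * a * a" by (rule mult_le_mono2)
    thus False using I(3) V2(2) unfolding s_def by linarith
  qed
  ultimately show ?thesis using V1 by (intro exI[of _ V1]) auto
qed

text \<open>The bound can hold for all \<open>k\<close> at once because \<open>n < 5 * k ^ 5\<close>
  forces \<open>k\<close> to grow with \<open>n\<close>.\<close>

lemma eventually_partition_condition:
  "\<forall>\<^sub>F n in sequentially. \<forall>k. n < 5 * k ^ 5 \<longrightarrow> 2 * real n * (337/384) ^ k < 1"
proof -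
  have "(\<lambda>k. 10 * real k ^ 5 * (337/384) ^ k) \<longlonglongrightarrow> 0" by real_asymp
  hence "\<forall>\<^sub>F k in sequentially. 10 * real k ^ 5 * (337/384) ^ k < 1"
    by (rule order_tendstoD) simp
  then obtain K where K: "\<And>k. K \<le> k \<Longrightarrow> 10 * real k ^ 5 * (337/384) ^ k < 1"
    by (auto simp: eventually_sequentially)
  show ?thesis
    unfolding eventually_sequentially
  proof (intro exI[of _ "5 * K ^ 5"] allI impI)
    fix n k :: nat assume n: "5 * K ^ 5 \<le> n" and k: "n < 5 * k ^ 5"
    have "K \<le> k"
    proof (rule ccontr)
      assume "\<not> K \<le> k"
      hence "k ^ 5 \<le> K ^ 5" by (intro power_mono) auto
      thus False using n k by linarith
    qed
    have "real n \<le> 5 * real k ^ 5" using k by (simp flip: of_nat_power)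
    hence "2 * real n * (337/384) ^ k \<le> 10 * real k ^ 5 * (337/384) ^ k" by simp
    also have "\<dots> < 1" by (rule K) fact
    finally show "2 * real n * (337/384) ^ k < 1" .
  qed
qed

subsection \<open>The binomial random graph\<close>

lemma finite_pairs [simp]: "finite (pairs n)"
  by (rule finite_subset[of _ "Pow {..<n}"]) (auto simp: pairs_def)

lemma pairs_iff: "{u, v} \<in> pairs n \<longleftrightarrow> u \<noteq> v \<and> u < n \<and> v < n"
  by (auto simp: pairs_def doubleton_eq_iff) (metis linorder_neqE_nat)+

definition rg_exp :: "nat \<Rightarrow> real \<Rightarrow> (nat set set \<Rightarrow> real) \<Rightarrow> real" where
  "rg_exp n p f = (\<Sum>R\<in>Pow (pairs n). p ^ card R * (1 - p) ^ (card (pairs n) - card R) * f R)"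

lemma rg_prob_eq_exp: "rg_prob n p P = rg_exp n p (\<lambda>R. of_bool (P R))"
proof -
  have "{R. R \<subseteq> pairs n \<and> P R} = {R \<in> Pow (pairs n). P R}" by auto
  thus ?thesis unfolding rg_prob_def rg_exp_def
    by (simp add: sum.If_cases Int_def of_bool_def if_distrib cong: if_cong)
qed

lemma rg_exp_mono:
  assumes "0 \<le> p" "p \<le> 1" "\<And>R. R \<subseteq> pairs n \<Longrightarrow> f R \<le> g R"
  shows "rg_exp n p f \<le> rg_exp n p g"
  unfolding rg_exp_def by (intro sum_mono mult_left_mono) (use assms in auto)

lemma rg_exp_sum: "rg_exp n p (\<lambda>R. \<Sum>i\<in>I. f i R) = (\<Sum>i\<in>I. rg_exp n p (f i))"
  unfolding rg_exp_def sum_distrib_left by (rule sum.swap)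

lemma rg_exp_add: "rg_exp n p (\<lambda>R. f R + g R) = rg_exp n p f + rg_exp n p g"
  by (simp add: rg_exp_def algebra_simps sum.distrib)

lemma rg_exp_cmult: "rg_exp n p (\<lambda>R. c * f R) = c * rg_exp n p f"
  by (simp add: rg_exp_def sum_distrib_left mult_ac)

lemma binomial_weight_sum:
  fixes p :: real
  assumes "finite A"
  shows "(\<Sum>R\<in>Pow A. p ^ card R * (1 - p) ^ (card A - card R)) = 1"
proof -
  have "(\<Sum>R\<in>Pow A. p ^ card R * (1 - p) ^ (card A - card R))
      = (\<Sum>R\<in>Pow A. (\<Prod>_\<in>R. p) * (\<Prod>_\<in>A - R. 1 - p))"
    by (intro sum.cong) (auto simp: card_Diff_subset finite_subset[OF _ assms])
  also have "\<dots> = (\<Prod>_\<in>A. p + (1 - p))" by (rule prod_add[OF assms, symmetric])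
  finally show ?thesis by simp
qed

text \<open>Independence of the edges enters all later estimates through this formula.\<close>

lemma rg_prob_avoid:
  assumes F: "F \<subseteq> pairs n"
  shows "rg_prob n p (\<lambda>R. R \<inter> F = {}) = (1 - p) ^ card F"
proof -
  let ?A = "pairs n - F"
  have fF: "finite F" using F finite_pairs by (rule finite_subset)
  have cA: "card (pairs n) = card ?A + card F"
    using F by (metis add.commute card_Diff_subset card_mono fF finite_pairs le_add_diff_inverse)
  have "{R. R \<subseteq> pairs n \<and> R \<inter> F = {}} = Pow ?A" by auto
  hence "rg_prob n p (\<lambda>R. R \<inter> F = {}) = (\<Sum>R\<in>Pow ?A. p ^ card R * (1 - p) ^ (card (pairs n) - card R))"
    by (simp add: rg_prob_def)
  also have "\<dots> = (\<Sum>R\<in>Pow ?A. (1 - p) ^ card F * (p ^ card R * (1 - p) ^ (card ?A - card R)))"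
  proof (rule sum.cong[OF refl])
    fix R assume "R \<in> Pow ?A"
    hence "card R \<le> card ?A" by (intro card_mono) auto
    hence "card (pairs n) - card R = card F + (card ?A - card R)" using cA by simp
    thus "p ^ card R * (1 - p) ^ (card (pairs n) - card R)
        = (1 - p) ^ card F * (p ^ card R * (1 - p) ^ (card ?A - card R))"
      by (simp add: power_add)
  qed
  also have "\<dots> = (1 - p) ^ card F" by (simp add: binomial_weight_sum flip: sum_distrib_left)
  finally show ?thesis .
qed

lemma rg_exp_const: "rg_exp n p (\<lambda>_. c) = c"
  using binomial_weight_sum[OF finite_pairs[of n], of p]
  by (simp add: rg_exp_def flip: sum_distrib_right)

lemma rg_prob_mono:
  assumes "0 \<le> p" "p \<le> 1" "\<And>R. R \<subseteq> pairs n \<Longrightarrow> P R \<Longrightarrow> Q R"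
  shows "rg_prob n p P \<le> rg_prob n p Q"
  unfolding rg_prob_eq_exp by (rule rg_exp_mono) (use assms in auto)

lemma rg_prob_compl: "rg_prob n p P = 1 - rg_prob n p (\<lambda>R. \<not> P R)"
proof -
  have "rg_exp n p (\<lambda>R. of_bool (P R) + of_bool (\<not> P R)) = rg_exp n p (\<lambda>_. 1)"
    by (rule arg_cong[where f = "rg_exp n p"]) auto
  thus ?thesis by (simp add: rg_prob_eq_exp rg_exp_add rg_exp_const)
qed

lemma rg_prob_nonneg: "0 \<le> p \<Longrightarrow> p \<le> 1 \<Longrightarrow> 0 \<le> rg_prob n p P"
  unfolding rg_prob_def by (intro sum_nonneg) auto

lemma rg_prob_le_1: "0 \<le> p \<Longrightarrow> p \<le> 1 \<Longrightarrow> rg_prob n p P \<le> 1"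
  using rg_prob_compl[of n p P] rg_prob_nonneg[of p n "\<lambda>R. \<not> P R"] by simp

lemma rg_prob_Ex_le:
  assumes p: "0 \<le> p" "p \<le> 1" and "finite I"
  shows "rg_prob n p (\<lambda>R. \<exists>i\<in>I. P i R) \<le> (\<Sum>i\<in>I. rg_prob n p (P i))"
proof -
  have "of_bool (\<exists>i\<in>I. P i R) \<le> (\<Sum>i\<in>I. of_bool (P i R) :: real)" for R
  proof (cases "\<exists>i\<in>I. P i R")
    case True
    then obtain i where i: "i \<in> I" "P i R" by blast
    have "of_bool (P i R) \<le> (\<Sum>i\<in>I. of_bool (P i R) :: real)"
      using i(1) assms(3) by (intro member_le_sum) auto
    thus ?thesis using True i by simp
  qed (simp add: sum_nonneg)
  thus ?thesis unfolding rg_prob_eq_exp rg_exp_sum[symmetric] using p by (intro rg_exp_mono) auto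
qed

lemma tendsto_1_prob:
  assumes "\<forall>\<^sub>F n in sequentially. 0 \<le> p n \<and> p n \<le> 1 \<and> rg_prob n (p n) (\<lambda>R. \<not> P n R) \<le> f n"
    and "f \<longlonglongrightarrow> 0"
  shows "(\<lambda>n. rg_prob n (p n) (P n)) \<longlonglongrightarrow> 1"
proof (rule tendsto_sandwich[where f = "\<lambda>n. 1 - f n" and h = "\<lambda>_. 1"])
  show "\<forall>\<^sub>F n in sequentially. 1 - f n \<le> rg_prob n (p n) (P n)"
    using assms(1) by eventually_elim (subst rg_prob_compl, simp)
  show "\<forall>\<^sub>F n in sequentially. rg_prob n (p n) (P n) \<le> 1"
    using assms(1) by eventually_elim (simp add: rg_prob_le_1)
  show "(\<lambda>n. 1 - f n) \<longlonglongrightarrow> 1" using tendsto_diff[OF tendsto_const[of 1] assms(2)] by simp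
qed simp

text \<open>Chebyshev's inequality for the number of sets \<open>F i\<close> missed by the random
  graph, whose mean is \<open>card I * (1 - p) ^ N\<close>. Two of the sets together have at least
  \<open>2 * N - d\<close> pairs, so a joint probability exceeds the product by a factor of at most
  \<open>1 / (1 - p) ^ d\<close>.\<close>

lemma avoiding_family_second_moment:
  assumes p: "0 \<le> p" "p < 1" and I: "finite I" and F: "\<And>i. i \<in> I \<Longrightarrow> F i \<subseteq> pairs n"
    and N: "\<And>i. i \<in> I \<Longrightarrow> card (F i) = N"
    and d: "\<And>i j. i \<in> I \<Longrightarrow> j \<in> I \<Longrightarrow> i \<noteq> j \<Longrightarrow> card (F i \<inter> F j) \<le> d"
    and t: "0 < t"
  shows "rg_prob n p (\<lambda>R. real (card {i \<in> I. R \<inter> F i = {}}) \<le> real (card I) * (1 - p) ^ N - t)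
    \<le> (real (card I) * (1 - p) ^ N + (real (card I) * (1 - p) ^ N)\<^sup>2 * (1 / (1 - p) ^ d - 1)) / t\<^sup>2"
proof -
  define b where "b = (1 - p) ^ N"
  define m where "m = real (card I)"
  define X where "X R = (\<Sum>i\<in>I. of_bool (R \<inter> F i = {}) :: real)" for R
  have X_card: "X R = real (card {i \<in> I. R \<inter> F i = {}})" for R
    unfolding X_def using I by (simp add: sum.If_cases of_bool_def Int_def)
  have q: "0 < 1 - p" "1 - p \<le> 1" using p by auto
  have EX: "rg_exp n p X = m * b"
    unfolding X_def rg_exp_sum rg_prob_eq_exp[symmetric] using F N
    by (simp add: rg_prob_avoid b_def m_def)
  \<comment> \<open>The off-diagonal bound is added on the diagonal as well; this is harmless and
    makes the double sum easy to evaluate.\<close>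
  have pair: "rg_exp n p (\<lambda>R. of_bool (R \<inter> F i = {}) * of_bool (R \<inter> F j = {}))
      \<le> (if i = j then b else 0) + b\<^sup>2 / (1 - p) ^ d" if ij: "i \<in> I" "j \<in> I" for i j
  proof -
    have "(\<lambda>R. of_bool (R \<inter> F i = {}) * of_bool (R \<inter> F j = {})) = (\<lambda>R. of_bool (R \<inter> (F i \<union> F j) = {}) :: real)"
      by (auto simp: fun_eq_iff)
    hence e: "rg_exp n p (\<lambda>R. of_bool (R \<inter> F i = {}) * of_bool (R \<inter> F j = {})) = (1 - p) ^ card (F i \<union> F j)"
      using rg_prob_avoid[of "F i \<union> F j" n p] F ij by (simp add: rg_prob_eq_exp)
    show ?thesis
    proof (cases "i = j")
      case True
      thus ?thesis unfolding e using N ij q by (simp add: b_def)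
    next
      case False
      have fin: "finite (F i)" "finite (F j)" using F ij finite_subset by (metis finite_pairs)+
      have "card (F i \<union> F j) + card (F i \<inter> F j) = 2 * N" using card_Un_Int[OF fin] N ij by simp
      hence le: "2 * N \<le> card (F i \<union> F j) + d" using d[OF ij False] by linarith
      have "(1 - p) ^ card (F i \<union> F j) * (1 - p) ^ d = (1 - p) ^ (card (F i \<union> F j) + d)" by (simp add: power_add)
      also have "\<dots> \<le> (1 - p) ^ (2 * N)" using le q by (intro power_decreasing) auto
      also have "\<dots> = b\<^sup>2" by (simp add: b_def mult.commute flip: power_mult)
      finally have "(1 - p) ^ card (F i \<union> F j) \<le> b\<^sup>2 / (1 - p) ^ d" using q by (simp add: pos_le_divide_eq)
      thus ?thesis unfolding e using False by simp
    qed
  qed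
  have "rg_exp n p (\<lambda>R. (X R)\<^sup>2)
      = (\<Sum>i\<in>I. \<Sum>j\<in>I. rg_exp n p (\<lambda>R. of_bool (R \<inter> F i = {}) * of_bool (R \<inter> F j = {})))"
    unfolding X_def power2_eq_square sum_product rg_exp_sum ..
  also have "\<dots> \<le> (\<Sum>i\<in>I. \<Sum>j\<in>I. (if i = j then b else 0) + b\<^sup>2 / (1 - p) ^ d)"
    by (intro sum_mono pair)
  also have "\<dots> = m * b + m\<^sup>2 * (b\<^sup>2 / (1 - p) ^ d)"
    using I by (simp add: sum.distrib m_def power2_eq_square distrib_left)
  finally have EX2: "rg_exp n p (\<lambda>R. (X R)\<^sup>2) \<le> m * b + m\<^sup>2 * (b\<^sup>2 / (1 - p) ^ d)" .
  have "rg_exp n p (\<lambda>R. (X R - m * b)\<^sup>2) = rg_exp n p (\<lambda>R. (X R)\<^sup>2 + ((- 2 * (m * b)) * X R + (m * b)\<^sup>2))"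
    by (rule arg_cong[where f = "rg_exp n p"]) (simp add: fun_eq_iff power2_diff)
  also have "\<dots> = rg_exp n p (\<lambda>R. (X R)\<^sup>2) - (m * b)\<^sup>2"
    unfolding rg_exp_add rg_exp_cmult rg_exp_const EX by (simp add: power2_eq_square)
  also have "\<dots> \<le> m * b + (m * b)\<^sup>2 * (1 / (1 - p) ^ d - 1)"
    using EX2 by (simp add: algebra_simps power_mult_distrib)
  finally have var: "rg_exp n p (\<lambda>R. (X R - m * b)\<^sup>2) \<le> m * b + (m * b)\<^sup>2 * (1 / (1 - p) ^ d - 1)" .
  have "t\<^sup>2 * rg_prob n p (\<lambda>R. X R \<le> m * b - t) = rg_exp n p (\<lambda>R. t\<^sup>2 * of_bool (X R \<le> m * b - t))"
    by (simp add: rg_prob_eq_exp rg_exp_cmult)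
  also have "\<dots> \<le> rg_exp n p (\<lambda>R. (X R - m * b)\<^sup>2)"
  proof (rule rg_exp_mono)
    fix R
    show "t\<^sup>2 * of_bool (X R \<le> m * b - t) \<le> (X R - m * b)\<^sup>2"
    proof (cases "X R \<le> m * b - t")
      case True
      hence "t\<^sup>2 \<le> (m * b - X R)\<^sup>2" using t by (intro power_mono) auto
      thus ?thesis using True by (simp add: power2_commute)
    qed simp
  qed (use p in auto)
  finally have "t\<^sup>2 * rg_prob n p (\<lambda>R. X R \<le> m * b - t) \<le> m * b + (m * b)\<^sup>2 * (1 / (1 - p) ^ d - 1)"
    using var by linarith
  thus ?thesis using t by (simp add: X_card b_def m_def pos_le_divide_eq mult.commute)
qed

section \<open>Obstructions to Hamilton cycles\<close>

lemma cycle_successor: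
  assumes "is_cycle E xs"
  obtains s where "inj_on s (set xs)" "s ` set xs \<subseteq> set xs" "\<And>u. u \<in> set xs \<Longrightarrow> {u, s u} \<in> E"
    "\<And>K. K \<subseteq> set xs \<Longrightarrow> K \<noteq> {} \<Longrightarrow> s ` K \<subseteq> K \<Longrightarrow> set xs \<subseteq> K"
proof -
  define m where "m = length xs"
  have m: "3 \<le> m" and d: "distinct xs" and e: "\<And>i. i < m \<Longrightarrow> {xs ! i, xs ! ((i + 1) mod m)} \<in> E"
    using assms by (auto simp: is_cycle_def m_def)
  define ix where "ix u = (THE i. i < m \<and> xs ! i = u)" for u
  have ix: "ix (xs ! i) = i" if "i < m" for i
    unfolding ix_def using that d by (auto simp: m_def nth_eq_iff_index_eq intro!: the_equality)
  \<comment> \<open>The step along the cycle. Injectivity and the absence of proper closed subsets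
    are what the two obstructions to Hamiltonicity rely on.\<close>
  define s where "s u = xs ! ((ix u + 1) mod m)" for u
  have ex: "\<exists>i<m. u = xs ! i" if "u \<in> set xs" for u using that by (metis in_set_conv_nth m_def)
  have sx: "s (xs ! i) = xs ! ((i + 1) mod m)" if "i < m" for i using ix[OF that] by (simp add: s_def)
  have modm: "(i + 1) mod m < m" for i using m by simp
  have "inj_on s (set xs)"
  proof (rule inj_onI)
    fix u v assume uv: "u \<in> set xs" "v \<in> set xs" "s u = s v"
    then obtain i j where ij: "i < m" "j < m" "u = xs ! i" "v = xs ! j" using ex by metis
    hence "(i + 1) mod m = (j + 1) mod m" using uv sx modm d by (simp add: nth_eq_iff_index_eq m_def)
    hence "i = j" using ij by (cases "i + 1 = m"; cases "j + 1 = m"; simp)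
    thus "u = v" using ij by simp
  qed
  moreover have "s ` set xs \<subseteq> set xs"
  proof
    fix v assume "v \<in> s ` set xs"
    then obtain i where "i < m" "v = s (xs ! i)" using ex by blast
    thus "v \<in> set xs" using sx modm[of i] by (simp add: m_def)
  qed
  moreover have "{u, s u} \<in> E" if "u \<in> set xs" for u using ex[OF that] e sx by metis
  moreover have "set xs \<subseteq> K" if K: "K \<subseteq> set xs" "K \<noteq> {}" "s ` K \<subseteq> K" for K
  proof -
    obtain i where i: "i < m" "xs ! i \<in> K" using K ex by (metis all_not_in_conv subsetD)
    have step: "xs ! ((i + j) mod m) \<in> K" for j
    proof (induction j)
      case 0 thus ?case using i by simp
    next
      case (Suc j)
      have "(i + j) mod m < m" using m by simp
      hence "s (xs ! ((i + j) mod m)) = xs ! ((i + Suc j) mod m)" by (subst sx) (auto simp: mod_Suc_eq)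
      thus ?case using Suc K(3) by (metis image_subset_iff)
    qed
    show ?thesis
    proof
      fix v assume "v \<in> set xs"
      then obtain k where k: "k < m" "v = xs ! k" using ex by blast
      have "(i + (m - i + k)) mod m = k" using i k by simp
      thus "v \<in> K" using step[of "m - i + k"] k by simp
    qed
  qed
  ultimately show ?thesis by (rule that)
qed

text \<open>The successor map along a Hamilton cycle embeds \<open>J\<close> into
  \<open>S\<close>.\<close>

lemma hamiltonian_card_le:
  assumes "hamiltonian n E" "finite S" "J \<subseteq> {..<n}"
    "\<And>u v. u \<in> J \<Longrightarrow> v < n \<Longrightarrow> {u, v} \<in> E \<Longrightarrow> v \<in> S"
  shows "card J \<le> card S"
proof -
  obtain xs where xs: "is_cycle E xs" "set xs = {..<n}" using assms by (auto simp: hamiltonian_def)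
  obtain s where s: "inj_on s {..<n}" "s ` {..<n} \<subseteq> {..<n}" "\<And>u. u \<in> {..<n} \<Longrightarrow> {u, s u} \<in> E"
    using cycle_successor[OF xs(1)] xs(2) by metis
  have "s u \<in> S" if "u \<in> J" for u
  proof (rule assms(4)[OF that])
    show "{u, s u} \<in> E" using s(3) assms(3) that by blast
    show "s u < n" using s(2) assms(3) that by blast
  qed
  hence "s ` J \<subseteq> S" by blast
  moreover have "inj_on s J" using s(1) assms(3) inj_on_subset by blast
  ultimately show ?thesis using assms(2) card_inj_on_le by blast
qed

lemma hamiltonian_no_closed_subset:
  assumes "hamiltonian n E" "K \<subseteq> {..<n}" "K \<noteq> {}" "\<And>u v. u \<in> K \<Longrightarrow> v < n \<Longrightarrow> {u, v} \<in> E \<Longrightarrow> v \<in> K"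
  shows "K = {..<n}"
proof -
  obtain xs where xs: "is_cycle E xs" "set xs = {..<n}" using assms by (auto simp: hamiltonian_def)
  obtain s where s: "s ` {..<n} \<subseteq> {..<n}" "\<And>u. u \<in> {..<n} \<Longrightarrow> {u, s u} \<in> E"
    "\<And>K. K \<subseteq> {..<n} \<Longrightarrow> K \<noteq> {} \<Longrightarrow> s ` K \<subseteq> K \<Longrightarrow> {..<n} \<subseteq> K"
    using cycle_successor[OF xs(1)] xs(2) by metis
  have "s u \<in> K" if "u \<in> K" for u
  proof (rule assms(4)[OF that])
    show "{u, s u} \<in> E" using s(2) assms(2) that by blast
    show "s u < n" using s(1) assms(2) that by blast
  qed
  hence "s ` K \<subseteq> K" by blast
  thus ?thesis using s(3) assms(2,3) by blast
qed

section \<open>Minimum degree, independence number and cross edges\<close>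

lemma deg_eq_card_nbh: "graph n E \<Longrightarrow> deg E v = card (nbh E {..<n} v)"
  unfolding deg_def nbh_def graph_def by (rule arg_cong[where f = card]) (auto simp: pairs_iff dest: subsetD)

lemma min_deg_ge: "0 < n \<Longrightarrow> (\<And>v. v < n \<Longrightarrow> m \<le> deg E v) \<Longrightarrow> m \<le> min_deg n E"
  unfolding min_deg_def by (subst Min_ge_iff) auto

lemma min_deg_le: "v < n \<Longrightarrow> min_deg n E \<le> deg E v"
  unfolding min_deg_def by (intro Min_le) auto

lemma indep_num_altdef: "indep_num n E = Max (card ` {S. S \<subseteq> {..<n} \<and> indep E S})"
  unfolding indep_num_def indep_def by (rule arg_cong[where f = Max]) auto

lemma indep_le_indep_num: "indep_le E {..<n} (indep_num n E)"
  unfolding indep_num_altdef indep_le_def by (auto intro!: Max_ge)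

lemma indep_num_le: "(\<And>S. S \<subseteq> {..<n} \<Longrightarrow> indep E S \<Longrightarrow> card S \<le> m) \<Longrightarrow> indep_num n E \<le> m"
  unfolding indep_num_altdef by (subst Max_le_iff) (auto simp: indep_def)

lemma indep_num_ge: "S \<subseteq> {..<n} \<Longrightarrow> indep E S \<Longrightarrow> card S \<le> indep_num n E"
  unfolding indep_num_altdef by (intro Max_ge) auto

definition cross_edges :: "nat set \<Rightarrow> nat set \<Rightarrow> nat set set" where
  "cross_edges A B = (\<lambda>(u, v). {u, v}) ` (A \<times> B)"

lemma card_cross_edges:
  assumes "finite A" "finite B" "A \<inter> B = {}"
  shows "card (cross_edges A B) = card A * card B"
proof -
  have "inj_on (\<lambda>(u, v). {u, v}) (A \<times> B)"
    using assms(3) by (auto simp: inj_on_def doubleton_eq_iff)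
  thus ?thesis using assms by (simp add: cross_edges_def card_image card_cartesian_product)
qed

subsection \<open>Components\<close>

definition vcomp :: "nat set set \<Rightarrow> nat set \<Rightarrow> nat \<Rightarrow> nat set" where
  "vcomp E W v = {u \<in> W. (adj_in E W)\<^sup>*\<^sup>* v u}"

lemma num_comps_altdef: "num_comps E W = card (vcomp E W ` W)"
  unfolding num_comps_def vcomp_def by (rule arg_cong[where f = card]) auto

lemma adj_in_rtranclp_sym: "(adj_in E W)\<^sup>*\<^sup>* u v \<Longrightarrow> (adj_in E W)\<^sup>*\<^sup>* v u"
proof (induction rule: rtranclp_induct)
  case (step y z)
  have "adj_in E W z y" using step(2) by (simp add: adj_in_def insert_commute)
  thus ?case using step(3) by (rule converse_rtranclp_into_rtranclp)
qed simp

lemma vcomp_self: "v \<in> W \<Longrightarrow> v \<in> vcomp E W v"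
  by (simp add: vcomp_def)

lemma vcomp_subset: "vcomp E W v \<subseteq> W"
  by (auto simp: vcomp_def)

lemma vcomp_eq: "u \<in> vcomp E W v \<Longrightarrow> vcomp E W u = vcomp E W v"
  unfolding vcomp_def by (auto intro: rtranclp_trans dest: adj_in_rtranclp_sym)

lemma vcomp_adj: "u \<in> vcomp E W v \<Longrightarrow> w \<in> W \<Longrightarrow> {u, w} \<in> E \<Longrightarrow> w \<in> vcomp E W v"
  unfolding vcomp_def by (auto intro: rtranclp.rtrancl_into_rtrancl simp: adj_in_def)

lemma vcomp_mono: "E \<subseteq> E' \<Longrightarrow> vcomp E W v \<subseteq> vcomp E' W v"
  unfolding vcomp_def by (auto elim!: rtranclp_mono[THEN predicate2D, rotated] simp: adj_in_def)

text \<open>The hypothesis concerns graphs on initial segments of the naturals. The subgraph on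
  \<open>X\<close> is carried to one by a bijection \<open>h\<close>, which preserves components and
  hence toughness; the cycle is carried back.\<close>

lemma hamiltonian_cycle_on_subset:
  assumes hyp: "\<And>n E. 3 \<le> n \<Longrightarrow> graph n E \<Longrightarrow> tough n E t0 \<Longrightarrow> hamiltonian n E"
    and X: "finite X" "3 \<le> card X" and E: "\<And>x. {x} \<notin> E"
    and tough: "\<And>S. S \<subseteq> X \<Longrightarrow> real (num_comps E (X - S)) \<le> max 1 (real (card S) / t0)"
  shows "\<exists>xs. is_cycle E xs \<and> set xs = X"
proof -
  define m where "m = card X"
  obtain h where "bij_betw h {0..<m} X" using ex_bij_betw_nat_finite[OF X(1)] by (auto simp: m_def)
  hence h: "bij_betw h {..<m} X" by (simp add: atLeast0LessThan)
  have inj: "inj_on h {..<m}" and im: "h ` {..<m} = X" using h by (auto simp: bij_betw_def)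
  define E' where "E' = {e \<in> pairs m. h ` e \<in> E}"
  \<comment> \<open>For \<open>i = j\<close> both sides fail, the right one because \<open>E\<close>
    contains no singletons.\<close>
  have E'_iff: "{i, j} \<in> E' \<longleftrightarrow> {h i, h j} \<in> E" if "i < m" "j < m" for i j
    using that E by (cases "i = j") (auto simp: E'_def pairs_iff)
  have adj: "adj_in E' W i j \<longleftrightarrow> adj_in E (h ` W) (h i) (h j)" if W: "W \<subseteq> {..<m}" and ij: "i \<in> W" "j \<in> W" for W i j
    using E'_iff[of i j] ij W by (auto simp: adj_in_def)
  have reach1: "(adj_in E (h ` W))\<^sup>*\<^sup>* (h i) (h j)" if "(adj_in E' W)\<^sup>*\<^sup>* i j" "W \<subseteq> {..<m}" for W i j
    using that(1)
  proof (induction rule: rtranclp_induct)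
    case (step y z)
    hence "adj_in E (h ` W) (h y) (h z)" using adj[OF that(2), of y z] by (auto simp: adj_in_def)
    thus ?case using step by simp
  qed simp
  have reach2: "\<exists>j\<in>W. y = h j \<and> (adj_in E' W)\<^sup>*\<^sup>* i j"
    if "(adj_in E (h ` W))\<^sup>*\<^sup>* (h i) y" "W \<subseteq> {..<m}" "i \<in> W" for W i y
    using that(1)
  proof (induction rule: rtranclp_induct)
    case base thus ?case using that by auto
  next
    case (step y z)
    then obtain j where j: "j \<in> W" "y = h j" "(adj_in E' W)\<^sup>*\<^sup>* i j" by blast
    have "z \<in> h ` W" using step by (simp add: adj_in_def)
    then obtain j' where j': "j' \<in> W" "z = h j'" by blast
    have "adj_in E' W j j'" using adj[OF that(2) j(1) j'(1)] step j j' by simp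
    with j(3) have "(adj_in E' W)\<^sup>*\<^sup>* i j'" by (rule rtranclp.rtrancl_into_rtrancl)
    thus ?case using j' by blast
  qed
  have comps: "vcomp E (h ` W) (h i) = h ` vcomp E' W i" if "W \<subseteq> {..<m}" "i \<in> W" for W i
  proof
    show "vcomp E (h ` W) (h i) \<subseteq> h ` vcomp E' W i"
      using reach2[OF _ that] by (auto simp: vcomp_def)
    show "h ` vcomp E' W i \<subseteq> vcomp E (h ` W) (h i)"
      using reach1[OF _ that(1)] by (auto simp: vcomp_def)
  qed
  have nc: "num_comps E (h ` W) = num_comps E' W" if W: "W \<subseteq> {..<m}" for W
  proof -
    have "vcomp E (h ` W) ` (h ` W) = (`) h ` (vcomp E' W ` W)"
      unfolding image_image by (rule image_cong) (simp_all add: comps[OF W])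
    moreover have "inj_on ((`) h) (vcomp E' W ` W)"
    proof (rule inj_on_subset[OF inj_on_image_Pow[OF inj]])
      show "vcomp E' W ` W \<subseteq> Pow {..<m}" using W vcomp_subset[of E' W] by blast
    qed
    ultimately show ?thesis by (simp add: num_comps_altdef card_image)
  qed
  have "tough m E' t0" unfolding tough_def
  proof (intro allI impI)
    fix S assume S: "S \<subseteq> {..<m}"
    have "h ` ({..<m} - S) = X - h ` S" using inj_on_image_set_diff[OF inj _ S] im by auto
    hence "num_comps E' ({..<m} - S) = num_comps E (X - h ` S)" using nc[of "{..<m} - S"] by auto
    moreover have "card (h ` S) = card S" using inj S by (meson card_image inj_on_subset)
    moreover have "h ` S \<subseteq> X" using S im by auto
    ultimately show "real (num_comps E' ({..<m} - S)) \<le> max 1 (real (card S) / t0)" using tough by metis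
  qed
  moreover have "graph m E'" by (auto simp: graph_def E'_def)
  ultimately have "hamiltonian m E'" using hyp X by (simp add: m_def)
  then obtain xs where xs: "is_cycle E' xs" "set xs = {..<m}" by (auto simp: hamiltonian_def)
  have "is_cycle E (map h xs)" unfolding is_cycle_def
  proof (intro conjI allI impI)
    show "3 \<le> length (map h xs)" using xs by (simp add: is_cycle_def)
    show "distinct (map h xs)" using xs inj by (simp add: is_cycle_def distinct_map)
    fix i assume i: "i < length (map h xs)"
    hence "0 < length xs" by auto
    hence i': "i < length xs" "(i + 1) mod length xs < length xs" using i by auto
    hence "{xs ! i, xs ! ((i + 1) mod length xs)} \<in> E'" using xs by (simp add: is_cycle_def)
    hence "{h (xs ! i), h (xs ! ((i + 1) mod length xs))} \<in> E" by (simp add: E'_def)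
    thus "{map h xs ! i, map h xs ! ((i + 1) mod length (map h xs))} \<in> E" using i' by simp
  qed
  moreover have "set (map h xs) = X" using xs im by simp
  ultimately show ?thesis by blast
qed

subsection \<open>Toughness of the perturbed graph\<close>

text \<open>Too many components after deleting \<open>S\<close> yield a union \<open>U\<close> of components of the perturbed
  graph covering at most half of \<open>X\<close>. It is encoded by the set \<open>T\<close> of representatives of the
  components of the unperturbed graph inside \<open>U\<close>, of which there are at least \<open>card S / (3 * t0)\<close>.\<close>

lemma not_tough_witness:
  fixes t0 k :: real
  assumes X: "finite X" and al: "indep_le G X a" and deg: "\<And>v. v \<in> X \<Longrightarrow> k \<le> real (card (nbh G X v))"
    and t0: "1 \<le> t0" "2 * t0 * real a \<le> k" and S: "S \<subseteq> X"
    and bad: "max 1 (real (card S) / t0) < real (num_comps (G \<union> R) (X - S))"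
  obtains T U where "T \<subseteq> X" "T \<noteq> {}" "U = (\<Union>t\<in>T. vcomp G (X - S) t)" "real (card S) \<le> 3 * t0 * real (card T)"
    "2 * real (card S) \<le> k" "k / 2 * real (card T) \<le> real (card U)" "2 * card U \<le> card X"
    "\<And>u v. u \<in> U \<Longrightarrow> v \<in> X - S - U \<Longrightarrow> {u, v} \<notin> R"
proof -
  define W where "W = X - S"
  define \<Gamma> where "\<Gamma> = G \<union> R"
  define \<C> where "\<C> = vcomp \<Gamma> W ` W"
  define q where "q = card \<C>"
  have fW: "finite W" using X by (simp add: W_def)
  have WX: "W \<subseteq> X" by (auto simp: W_def)
  have fC: "finite \<C>" using fW by (simp add: \<C>_def)
  have qq: "q = num_comps (G \<union> R) (X - S)" by (simp add: q_def \<C>_def num_comps_altdef W_def \<Gamma>_def)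
  have q2: "2 \<le> q" and Sq: "real (card S) < t0 * real q" using bad t0 unfolding qq by (auto simp: divide_simps mult.commute)
  have Cfin: "finite C" "C \<noteq> {}" "C \<subseteq> W" if CC: "C \<in> \<C>" for C
  proof -
    obtain v where v: "v \<in> W" "C = vcomp \<Gamma> W v" using CC by (auto simp: \<C>_def)
    show "C \<noteq> {}" using vcomp_self[OF v(1), of \<Gamma>] v by auto
    show "C \<subseteq> W" using v vcomp_subset by simp
    thus "finite C" using fW by (rule finite_subset)
  qed
  have Ceq: "vcomp \<Gamma> W u = C" if "C \<in> \<C>" "u \<in> C" for C u
    using that vcomp_eq[of u \<Gamma> W] by (auto simp: \<C>_def)
  \<comment> \<open>One vertex from each component gives an independent set of \<open>G\<close>. So
    \<open>card S\<close> is below \<open>t0 * a\<close>, and every vertex keeps at least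
    \<open>k / 2\<close> neighbours after the deletion.\<close>
  have qa: "q \<le> a"
  proof -
    have MinC: "Min C \<in> C" if "C \<in> \<C>" for C using Cfin[OF that] by simp
    have injM: "inj_on Min \<C>" using Ceq MinC by (metis inj_onI)
    have "indep G (Min ` \<C>)" unfolding indep_def
    proof (intro ballI impI)
      fix u v assume "u \<in> Min ` \<C>" "v \<in> Min ` \<C>" "u \<noteq> v"
      then obtain C D where CD: "C \<in> \<C>" "D \<in> \<C>" "u = Min C" "v = Min D" "C \<noteq> D" by blast
      show "{u, v} \<notin> G"
      proof
        assume "{u, v} \<in> G"
        hence "{u, v} \<in> \<Gamma>" by (simp add: \<Gamma>_def)
        moreover have "v \<in> W" using CD MinC Cfin(3) by blast
        ultimately have "v \<in> vcomp \<Gamma> W u"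
          using vcomp_adj[of u \<Gamma> W u v] vcomp_self[of u W \<Gamma>] CD MinC Cfin(3) by blast
        hence "v \<in> C" using Ceq[of C u] CD MinC by simp
        thus False using Ceq CD MinC by metis
      qed
    qed
    moreover have "Min ` \<C> \<subseteq> X" using MinC Cfin(3) WX by blast
    ultimately have "card (Min ` \<C>) \<le> a" using al fC by (auto simp: indep_le_def)
    thus ?thesis using injM by (simp add: card_image q_def)
  qed
  have "t0 * real q \<le> t0 * real a" using qa t0 by (intro mult_left_mono) auto
  hence Sk: "2 * real (card S) \<le> k" using Sq t0 by linarith
  \<comment> \<open>Divide the components into two groups of almost equal number: both have at least
    \<open>q div 2\<close> members, and one of them covers at most half of \<open>X\<close>.\<close>
  have "\<exists>\<B> \<subseteq> \<C>. q div 2 \<le> card \<B> \<and> 2 * card (\<Union>\<B>) \<le> card X"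
  proof -
    obtain \<A> where A: "\<A> \<subseteq> \<C>" "card \<A> = q div 2" using obtain_subset_with_card_n[of "q div 2" \<C>] by (auto simp: q_def)
    have fin: "finite (\<Union>\<A>)" "finite (\<Union>(\<C> - \<A>))" using A Cfin fC finite_subset by (auto intro!: finite_Union)
    have "\<Union>\<A> \<inter> \<Union>(\<C> - \<A>) = {}"
    proof (rule ccontr)
      assume "\<not> ?thesis"
      then obtain x C D where "C \<in> \<A>" "D \<in> \<C> - \<A>" "x \<in> C" "x \<in> D" by blast
      thus False using Ceq A by (metis DiffD1 DiffD2 subsetD)
    qed
    hence "card (\<Union>\<A>) + card (\<Union>(\<C> - \<A>)) = card (\<Union>\<A> \<union> \<Union>(\<C> - \<A>))" using fin by (simp add: card_Un_disjoint)
    also have "\<dots> \<le> card X" by (rule card_mono[OF X]) (use A Cfin(3) WX in blast)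
    finally have cases: "2 * card (\<Union>\<A>) \<le> card X \<or> 2 * card (\<Union>(\<C> - \<A>)) \<le> card X" by linarith
    have half: "q div 2 \<le> card (\<C> - \<A>)" using A fC by (simp add: card_Diff_subset finite_subset q_def)
    from cases show ?thesis
    proof
      assume "2 * card (\<Union>\<A>) \<le> card X"
      thus ?thesis using A by (intro exI[of _ \<A>]) simp
    next
      assume "2 * card (\<Union>(\<C> - \<A>)) \<le> card X"
      thus ?thesis using half by (intro exI[of _ "\<C> - \<A>"]) auto
    qed
  qed
  then obtain \<B> where B: "\<B> \<subseteq> \<C>" "q div 2 \<le> card \<B>" "2 * card (\<Union>\<B>) \<le> card X" by blast
  define U where "U = \<Union>\<B>"
  have UW: "U \<subseteq> W" using B Cfin(3) by (auto simp: U_def)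
  have closed: "vcomp \<Gamma> W u \<subseteq> U" if uU: "u \<in> U" for u
  proof -
    obtain C where C: "C \<in> \<B>" "u \<in> C" using uU by (auto simp: U_def)
    hence "vcomp \<Gamma> W u = C" using Ceq B by blast
    thus ?thesis using C by (auto simp: U_def)
  qed
  have closedG: "vcomp G W u \<subseteq> U" if "u \<in> U" for u
    using closed[OF that] vcomp_mono[of G \<Gamma> W u] by (auto simp: \<Gamma>_def)
  \<comment> \<open>Taking the least vertex makes the representative of a component canonical, so
    distinct elements of \<open>T\<close> lie in distinct components of \<open>G\<close>.\<close>
  define r where "r u = Min (vcomp G W u)" for u
  have fcomp: "finite (vcomp G W u)" for u by (rule finite_subset[OF vcomp_subset fW])
  have r: "r u \<in> vcomp G W u" if "u \<in> W" for u unfolding r_def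
    using vcomp_self[OF that, of G] by (intro Min_in fcomp) blast
  have rr: "vcomp G W (r u) = vcomp G W u" if "u \<in> W" for u by (rule vcomp_eq[OF r[OF that]])
  define T where "T = r ` U"
  have fU: "finite U" by (rule finite_subset[OF UW fW])
  have TU: "T \<subseteq> U" using r UW closedG by (auto simp: T_def)
  have r_id: "r t = t" if "t \<in> T" for t
    using that rr UW unfolding T_def r_def by (metis (no_types, lifting) imageE subsetD)
  have Ueq: "U = (\<Union>t\<in>T. vcomp G W t)"
  proof
    show "U \<subseteq> (\<Union>t\<in>T. vcomp G W t)"
    proof
      fix u assume u: "u \<in> U"
      hence "u \<in> W" using UW by blast
      hence "u \<in> vcomp G W (r u)" using rr vcomp_self by simp
      thus "u \<in> (\<Union>t\<in>T. vcomp G W t)" using u by (auto simp: T_def)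
    qed
    show "(\<Union>t\<in>T. vcomp G W t) \<subseteq> U" using closedG TU by blast
  qed
  have big: "k / 2 \<le> real (card (vcomp G W t))" if "t \<in> T" for t
  proof -
    have tW: "t \<in> W" using that TU UW by blast
    have "nbh G X t - S \<subseteq> vcomp G W t"
      using vcomp_adj[OF vcomp_self[OF tW]] by (auto simp: nbh_def W_def insert_commute)
    hence "card (nbh G X t - S) \<le> card (vcomp G W t)" by (rule card_mono[OF fcomp])
    moreover have "card (nbh G X t) - card S \<le> card (nbh G X t - S)"
      by (rule diff_card_le_card_Diff[OF finite_subset[OF S X]])
    moreover have "k \<le> real (card (nbh G X t))" using deg tW WX by blast
    ultimately show ?thesis using Sk by linarith
  qed
  have "card U = (\<Sum>t\<in>T. card (vcomp G W t))" unfolding Ueq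
  proof (rule card_UN_disjoint)
    show "finite T" using fU by (simp add: T_def)
    show "\<forall>i\<in>T. finite (vcomp G W i)" using fcomp by blast
    show "\<forall>i\<in>T. \<forall>j\<in>T. i \<noteq> j \<longrightarrow> vcomp G W i \<inter> vcomp G W j = {}"
    proof (intro ballI impI)
      fix i j assume ij: "i \<in> T" "j \<in> T" "i \<noteq> j"
      show "vcomp G W i \<inter> vcomp G W j = {}"
      proof (rule ccontr)
        assume "\<not> ?thesis"
        then obtain x where "x \<in> vcomp G W i" "x \<in> vcomp G W j" by blast
        hence "vcomp G W i = vcomp G W j" using vcomp_eq by metis
        hence "r i = r j" by (simp add: r_def)
        thus False using r_id ij by simp
      qed
    qed
  qed
  moreover have "(\<Sum>t\<in>T. k / 2) \<le> (\<Sum>t\<in>T. real (card (vcomp G W t)))" by (rule sum_mono) (use big in auto)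
  ultimately have kU: "k / 2 * real (card T) \<le> real (card U)" by (simp add: mult.commute)
  \<comment> \<open>Every component of the perturbed graph contains a component of \<open>G\<close>,
    so \<open>T\<close> is at least as large as \<open>\<B>\<close>.\<close>
  have "\<B> \<subseteq> vcomp \<Gamma> W ` T"
  proof
    fix C assume C: "C \<in> \<B>"
    hence CC: "C \<in> \<C>" using B by blast
    then obtain v where v: "v \<in> C" "v \<in> W" using Cfin(2,3)[OF CC] by blast
    have "v \<in> U" using v C by (auto simp: U_def)
    moreover have "r v \<in> vcomp \<Gamma> W v" using r[OF v(2)] vcomp_mono[of G \<Gamma> W v] by (auto simp: \<Gamma>_def)
    hence "vcomp \<Gamma> W (r v) = vcomp \<Gamma> W v" by (rule vcomp_eq)
    moreover have "vcomp \<Gamma> W v = C" by (rule Ceq[OF CC v(1)])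
    ultimately show "C \<in> vcomp \<Gamma> W ` T" unfolding T_def by blast
  qed
  hence "card \<B> \<le> card T" using fU by (metis T_def finite_imageI surj_card_le)
  \<comment> \<open>As \<open>q\<close> is at least 2, \<open>q div 2\<close> is at least
    \<open>q / 3\<close>; hence the factor 3.\<close>
  hence qT: "q \<le> 3 * card T" and T0: "0 < card T" using B(2) q2 by linarith+
  have "real q \<le> 3 * real (card T)" using qT by linarith
  hence "t0 * real q \<le> t0 * (3 * real (card T))" using t0 by (intro mult_left_mono) auto
  hence ST: "real (card S) \<le> 3 * t0 * real (card T)" using Sq by simp
  have cross: "{u, v} \<notin> R" if "u \<in> U" "v \<in> X - S - U" for u v
  proof
    assume "{u, v} \<in> R"
    moreover have "u \<in> W" "v \<in> W" using that UW by (auto simp: W_def)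
    ultimately have "v \<in> vcomp \<Gamma> W u" by (intro vcomp_adj[OF vcomp_self]) (auto simp: \<Gamma>_def)
    thus False using closed that by blast
  qed
  have "T \<subseteq> X" using TU UW WX by blast
  moreover have "T \<noteq> {}" using T0 by auto
  moreover have "2 * card U \<le> card X" using B(3) by (simp add: U_def)
  ultimately show ?thesis using that[of T U] Ueq ST Sk kU cross by (simp add: W_def)
qed

lemma sum_power_card_Pow:
  fixes y :: real
  assumes "finite X"
  shows "(\<Sum>S\<in>Pow X. y ^ card S) = (1 + y) ^ card X"
proof -
  have "(\<Prod>_\<in>X. y + 1) = (\<Sum>S\<in>Pow X. (\<Prod>_\<in>S. y) * (\<Prod>_\<in>X - S. 1))" by (rule prod_add[OF assms])
  thus ?thesis by (simp add: add.commute)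
qed

text \<open>A pair \<open>(S, T)\<close> forces at least \<open>n * k * card T / 64\<close> pairs to
  be missed, and \<open>3 * card S\<close> is at most \<open>9 * t0 * card T\<close>. So it has
  probability at most \<open>y ^ card S * y ^ card T\<close> with \<open>y = 1 / n ^ 3\<close>, and
  the sum over all \<open>S\<close> and all nonempty \<open>T\<close> factorises.\<close>

lemma prob_not_tough_le:
  fixes t0 p :: real
  assumes X: "X \<subseteq> {..<n}" "n \<le> 2 * card X" and al: "indep_le G {..<n} a"
    and deg: "\<And>v. v \<in> X \<Longrightarrow> k \<le> 4 * card (nbh G X v)"
    and t0: "1 \<le> t0" "8 * t0 * real a \<le> real k" and kn: "k \<le> n" "1 \<le> n"
    and p: "0 \<le> p" "p \<le> 1" "64 * (9 * t0 + 3) * ln (real n) \<le> p * (real n * real k)"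
  shows "rg_prob n p (\<lambda>R. \<exists>S\<subseteq>X. max 1 (real (card S) / t0) < real (num_comps (G \<union> R) (X - S)))
    \<le> (1 + 1 / real n ^ 3) ^ n * ((1 + 1 / real n ^ 3) ^ n - 1)"
proof -
  define y where "y = 1 / real n ^ 3"
  define U where "U S T = (\<Union>t\<in>T. vcomp G (X - S) t)" for S T
  define F where "F S T = cross_edges (U S T) (X - S - U S T)" for S T
  \<comment> \<open>The last \<open>n / 8\<close> is what remains of \<open>card X\<close>, at least
    \<open>n / 2\<close>, when \<open>U\<close> takes at most half of it and \<open>S\<close> at
    most \<open>k / 8\<close>.\<close>
  define J where "J = {(S, T) \<in> Pow X \<times> (Pow X - {{}}). real (card S) \<le> 3 * t0 * real (card T) \<and>
     real k / 8 * real (card T) \<le> real (card (U S T)) \<and> real n / 8 \<le> real (card (X - S - U S T))}"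
  have fX: "finite X" using X finite_subset by blast
  have fJ: "finite J" by (rule finite_subset[of _ "Pow X \<times> Pow X"]) (use fX in \<open>auto simp: J_def\<close>)
  have y0: "0 \<le> y" by (simp add: y_def)
  have n0: "0 < real n" using kn by simp
  have UX: "U S T \<subseteq> X - S" for S T using vcomp_subset[of G "X - S"] by (auto simp: U_def)
  have "rg_prob n p (\<lambda>R. \<exists>S\<subseteq>X. max 1 (real (card S) / t0) < real (num_comps (G \<union> R) (X - S)))
      \<le> rg_prob n p (\<lambda>R. \<exists>st\<in>J. R \<inter> F (fst st) (snd st) = {})"
  proof (rule rg_prob_mono)
    fix R assume "\<exists>S\<subseteq>X. max 1 (real (card S) / t0) < real (num_comps (G \<union> R) (X - S))"
    then obtain S where S: "S \<subseteq> X" "max 1 (real (card S) / t0) < real (num_comps (G \<union> R) (X - S))" by blast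
    have d: "real k / 4 \<le> real (card (nbh G X v))" if "v \<in> X" for v using deg[OF that] by linarith
    have t: "2 * t0 * real a \<le> real k / 4" using t0 by simp
    have alX: "indep_le G X a" using al X by (meson indep_le_mono order_refl)
    obtain T where T: "T \<subseteq> X" "T \<noteq> {}" "real (card S) \<le> 3 * t0 * real (card T)"
      "2 * real (card S) \<le> real k / 4" "real k / 4 / 2 * real (card T) \<le> real (card (U S T))" "2 * card (U S T) \<le> card X"
      "\<And>u v. u \<in> U S T \<Longrightarrow> v \<in> X - S - U S T \<Longrightarrow> {u, v} \<notin> R"
      using not_tough_witness[OF fX alX d t0(1) t S] unfolding U_def by metis
    have "card (X - S - U S T) = card X - card S - card (U S T)"
      using UX[of S T] S fX by (simp add: card_Diff_subset finite_subset)
    moreover have "real (card S) \<le> real n / 8" using T(4) kn by linarith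
    ultimately have "real n / 8 \<le> real (card (X - S - U S T))" using T(6) X(2) by linarith
    hence "(S, T) \<in> J" using S T by (simp add: J_def)
    moreover have "R \<inter> F S T = {}" using T(7) by (auto simp: F_def cross_edges_def)
    ultimately show "\<exists>st\<in>J. R \<inter> F (fst st) (snd st) = {}" by force
  qed (use p in auto)
  also have "\<dots> \<le> (\<Sum>st\<in>J. rg_prob n p (\<lambda>R. R \<inter> F (fst st) (snd st) = {}))"
    by (rule rg_prob_Ex_le[OF p(1,2) fJ])
  also have "\<dots> \<le> (\<Sum>st\<in>J. y ^ card (fst st) * y ^ card (snd st))"
  proof (rule sum_mono)
    fix st assume "st \<in> J"
    then obtain S T where st: "st = (S, T)" "S \<subseteq> X" "T \<subseteq> X" "real (card S) \<le> 3 * t0 * real (card T)"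
      "real k / 8 * real (card T) \<le> real (card (U S T))" "real n / 8 \<le> real (card (X - S - U S T))"
      by (auto simp: J_def)
    have "F S T \<subseteq> pairs n"
      using UX[of S T] X(1) unfolding F_def cross_edges_def by (fastforce simp: pairs_iff)
    hence "rg_prob n p (\<lambda>R. R \<inter> F S T = {}) = (1 - p) ^ card (F S T)" by (rule rg_prob_avoid)
    also have "\<dots> \<le> exp (- p) ^ card (F S T)" using p exp_ge_add_one_self[of "- p"] by (intro power_mono) auto
    also have "\<dots> = exp (- (p * real (card (F S T))))" by (simp flip: exp_of_nat_mult add: mult.commute)
    also have "\<dots> \<le> exp (- (3 * (real (card S) + real (card T)) * ln (real n)))"
    proof -
      have "card (F S T) = card (U S T) * card (X - S - U S T)" unfolding F_def
        by (rule card_cross_edges) (use UX[of S T] fX finite_subset in auto)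
      moreover have "(real k / 8 * real (card T)) * (real n / 8) \<le> real (card (U S T)) * real (card (X - S - U S T))"
        using st by (intro mult_mono) auto
      ultimately have "(real k / 8 * real (card T)) * (real n / 8) \<le> real (card (F S T))" by simp
      hence le: "p * ((real k / 8 * real (card T)) * (real n / 8)) \<le> p * real (card (F S T))" using p by (intro mult_left_mono) auto
      have "(9 * t0 + 3) * ln (real n) * real (card T) = (64 * (9 * t0 + 3) * ln (real n)) * (real (card T) / 64)" by simp
      also have "\<dots> \<le> (p * (real n * real k)) * (real (card T) / 64)"
        using p by (intro mult_right_mono) auto
      also have "\<dots> = p * ((real k / 8 * real (card T)) * (real n / 8))" by simp
      also note le
      finally have 1: "(9 * t0 + 3) * ln (real n) * real (card T) \<le> p * real (card (F S T))" .
      have "3 * (real (card S) + real (card T)) \<le> (9 * t0 + 3) * real (card T)" using st by (simp add: algebra_simps)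
      hence "3 * (real (card S) + real (card T)) * ln (real n) \<le> (9 * t0 + 3) * real (card T) * ln (real n)"
        using kn by (intro mult_right_mono) auto
      thus ?thesis using 1 by (simp add: mult_ac)
    qed
    also have "\<dots> = y ^ card S * y ^ card T"
    proof -
      have "exp (3 * ln (real n)) = real n ^ 3" using exp_of_nat_mult[of 3 "ln (real n)"] n0 by simp
      hence "y = exp (- (3 * ln (real n)))" by (simp add: y_def exp_minus inverse_eq_divide)
      hence "y ^ (card S + card T) = exp (real (card S + card T) * - (3 * ln (real n)))"
        by (simp only: exp_of_nat_mult)
      thus ?thesis by (simp add: power_add algebra_simps)
    qed
    finally show "rg_prob n p (\<lambda>R. R \<inter> F (fst st) (snd st) = {}) \<le> y ^ card (fst st) * y ^ card (snd st)"
      by (simp add: st)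
  qed
  also have "\<dots> \<le> (\<Sum>st\<in>Pow X \<times> (Pow X - {{}}). y ^ card (fst st) * y ^ card (snd st))"
    by (rule sum_mono2) (use fX y0 in \<open>auto simp: J_def\<close>)
  also have "\<dots> = (\<Sum>S\<in>Pow X. y ^ card S) * (\<Sum>T\<in>Pow X - {{}}. y ^ card T)"
    by (simp add: sum_product sum.cartesian_product split_beta)
  \<comment> \<open>Removing \<open>T = {}\<close> subtracts 1, which produces the small
    factor.\<close>
  also have "\<dots> = (1 + y) ^ card X * ((1 + y) ^ card X - 1)"
    using fX by (simp add: sum_diff1 sum_power_card_Pow)
  also have "\<dots> \<le> (1 + y) ^ n * ((1 + y) ^ n - 1)"
  proof -
    have "card X \<le> n" using X(1) card_mono[of "{..<n}" X] by simp
    hence "(1 + y) ^ card X \<le> (1 + y) ^ n" using y0 by (intro power_increasing) auto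
    moreover have "1 \<le> (1 + y) ^ card X" using y0 by (intro one_le_power) auto
    ultimately show ?thesis by (intro mult_mono) auto
  qed
  finally show ?thesis by (simp only: y_def)
qed

subsection \<open>Pancyclicity of the perturbed graph\<close>

lemma pancyclic_of_cycles_on_subsets:
  assumes G: "graph n G" and R: "R \<subseteq> pairs n" and al: "indep_le G {..<n} a" and a: "1 \<le> a"
    and V1: "V1 \<subseteq> {..<n}" "3 \<le> card V1" "\<And>v. v < n \<Longrightarrow> a + 1 \<le> card (nbh G V1 v)"
    and V0: "V0 \<subseteq> {..<n} - V1" "V0 \<noteq> {}" "\<And>v. v \<in> V0 \<Longrightarrow> 40 * a \<le> card (nbh G V0 v)"
    and cyc: "\<And>l. card V1 \<le> l \<Longrightarrow> l \<le> n \<Longrightarrow> \<exists>xs. is_cycle (G \<union> R) xs \<and> set xs \<subseteq> {..<n} \<and> length xs = l"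
    and cyc1: "\<exists>xs. is_cycle (G \<union> R) xs \<and> set xs = V1"
  shows "pancyclic n (G \<union> R)"
proof -
  have fV0: "finite V0" using V0(1) by (rule finite_subset) simp
  \<comment> \<open>For lengths up to \<open>6 * a + 2\<close>, \<open>short_cycle\<close> asks for
    degree \<open>14 * a + 4\<close> and connectivity parameter \<open>6 * a + 2\<close>; since
    \<open>1 \<le> a\<close>, \<open>20 * a\<close> and \<open>10 * a\<close> are enough. Degree
    \<open>40 * a\<close> in \<open>V0\<close> is the factor 2 lost in
    \<open>exists_robust_subset\<close>.\<close>
  have "\<exists>Z \<subseteq> V0. robust G Z (20 * a) (10 * a)"
    by (rule exists_robust_subset) (use V0 fV0 a in auto)
  then obtain Z where Z: "Z \<subseteq> V0" "robust G Z (20 * a) (10 * a)" by blast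
  have Zn: "Z \<subseteq> {..<n}" "Z \<inter> V1 = {}" using Z V0 by auto
  obtain cs where cs: "is_cycle (G \<union> R) cs" "set cs = V1" using cyc1 by blast
  show ?thesis unfolding pancyclic_def
  proof (intro allI impI)
    fix l assume l: "3 \<le> l \<and> l \<le> n"
    show "\<exists>xs. is_cycle (G \<union> R) xs \<and> set xs \<subseteq> {..<n} \<and> length xs = l"
    proof (cases "card V1 \<le> l")
      case True thus ?thesis using cyc l by blast
    next
      case False
      show ?thesis
      proof (cases "l \<le> 6 * a + 2")
        case True
        have "indep_le G Z a" using indep_le_mono[OF al order_refl Zn(1)] .
        from short_cycle[OF Z(2) this, of l] obtain xs where xs: "is_cycle G xs" "set xs \<subseteq> Z" "length xs = l"
          using l True a by auto
        have "is_cycle (G \<union> R) xs" using xs(1) gpath_mono[of G xs "G \<union> R"] by (auto simp: is_cycle_iff_gpath)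
        thus ?thesis using xs Zn by blast
      next
        case big: False
        have "indep_le G (Z \<union> V1) a" by (rule indep_le_mono[OF al order_refl]) (use Zn V1 in auto)
        from middle_cycle[OF _ cs Zn(2) this Z(2) a, of l]
        obtain xs where "is_cycle (G \<union> R) xs" "set xs \<subseteq> Z \<union> V1" "length xs = l"
          using V1(3) Zn(1) big False a by auto
        thus ?thesis using Zn V1 by blast
      qed
    qed
  qed
qed

text \<open>For each \<open>l\<close> a single superset \<open>X l\<close> of \<open>V1\<close> is
  fixed independently of the random graph. It inherits the degrees into \<open>V1\<close>, so the
  union bound runs over at most \<open>n + 1\<close> sets.\<close>

lemma prob_not_pancyclic_le:
  fixes t0 p :: real
  assumes hyp: "\<And>n E. 3 \<le> n \<Longrightarrow> graph n E \<Longrightarrow> tough n E t0 \<Longrightarrow> hamiltonian n E"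
    and t0: "1 \<le> t0" and G: "graph n G" and n: "1 \<le> n"
    and small: "\<And>k. n < 5 * k ^ 5 \<Longrightarrow> 2 * real n * (337/384) ^ k < 1"
    and al: "1000 * t0 * real (indep_num n G) \<le> real (min_deg n G)"
    and p: "0 \<le> p" "p \<le> 1" "64 * (9 * t0 + 3) * ln (real n) \<le> p * (real n * real (min_deg n G))"
  shows "rg_prob n p (\<lambda>R. \<not> pancyclic n (G \<union> R))
    \<le> (real n + 1) * ((1 + 1 / real n ^ 3) ^ n * ((1 + 1 / real n ^ 3) ^ n - 1))"
proof -
  define a where "a = indep_num n G"
  define k where "k = min_deg n G"
  have ind: "indep_le G {..<n} a" unfolding a_def by (rule indep_le_indep_num)
  have "card {0::nat} \<le> indep_num n G" by (rule indep_num_ge) (use n in \<open>auto simp: indep_def\<close>)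
  hence a: "1 \<le> a" by (simp add: a_def)
  have deg: "k \<le> card (nbh G {..<n} v)" if "v < n" for v
    using min_deg_le[OF that, of G] deg_eq_card_nbh[OF G, of v] by (simp add: k_def)
  have "1 * real a \<le> t0 * real a" using t0 by (intro mult_right_mono) auto
  hence "1000 * real a \<le> real k" and tk: "8 * t0 * real a \<le> real k" using al by (auto simp: a_def k_def)
  hence ak: "1000 * a \<le> k" by linarith
  have kn: "k \<le> n" using deg[of 0] n card_mono[OF _ nbh_subset, of "{..<n}" G 0] by simp
  have "\<exists>V1 \<subseteq> {..<n}. n \<le> 2 * card V1 \<and> (\<forall>v<n. k \<le> 4 * card (nbh G V1 v)) \<and>
    (\<exists>V0 \<subseteq> {..<n} - V1. V0 \<noteq> {} \<and> (\<forall>v\<in>V0. 40 * a \<le> card (nbh G V0 v)))"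
    by (rule reservoir_partition) (use n deg ind a ak small in auto)
  then obtain V1 V0 where V1: "V1 \<subseteq> {..<n}" "n \<le> 2 * card V1" "\<And>v. v < n \<Longrightarrow> k \<le> 4 * card (nbh G V1 v)"
    and V0: "V0 \<subseteq> {..<n} - V1" "V0 \<noteq> {}" "\<And>v. v \<in> V0 \<Longrightarrow> 40 * a \<le> card (nbh G V0 v)"
    by blast
  have fV1: "finite V1" using V1(1) by (rule finite_subset) simp
  have c3: "3 \<le> card V1" using V1(2) kn ak a by linarith
  have cV1: "card V1 \<le> n" using card_mono[OF _ V1(1)] by simp
  have "\<exists>X. V1 \<subseteq> X \<and> X \<subseteq> {..<n} \<and> card X = l" if "card V1 \<le> l" "l \<le> n" for l
    using exists_subset_between[of V1 l "{..<n}"] that V1(1) by auto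
  then obtain X where X: "\<And>l. card V1 \<le> l \<Longrightarrow> l \<le> n \<Longrightarrow> V1 \<subseteq> X l \<and> X l \<subseteq> {..<n} \<and> card (X l) = l" by metis
  have XV1: "X (card V1) = V1" using X[OF order_refl cV1] fV1
    by (metis card_subset_eq finite_lessThan finite_subset)
  define B where "B l R \<longleftrightarrow> (\<exists>S\<subseteq>X l. max 1 (real (card S) / t0) < real (num_comps (G \<union> R) (X l - S)))" for l R
  have pB: "rg_prob n p (B l) \<le> (1 + 1 / real n ^ 3) ^ n * ((1 + 1 / real n ^ 3) ^ n - 1)" if l: "l \<in> {card V1..n}" for l
    unfolding B_def
  proof (rule prob_not_tough_le)
    show "X l \<subseteq> {..<n}" "n \<le> 2 * card (X l)" using X[of l] l V1(2) by auto
    fix v assume "v \<in> X l"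
    hence "v < n" using X[of l] l by auto
    moreover have "card (nbh G V1 v) \<le> card (nbh G (X l) v)"
    proof (rule card_mono)
      show "finite (nbh G (X l) v)" using X[of l] l finite_subset[of "X l" "{..<n}"] by auto
      show "nbh G V1 v \<subseteq> nbh G (X l) v" using X[of l] l by (auto simp: nbh_def)
    qed
    ultimately show "k \<le> 4 * card (nbh G (X l) v)" using V1(3)[of v] by linarith
  qed (use ind t0 tk kn n p in \<open>auto simp: k_def\<close>)
  have "rg_prob n p (\<lambda>R. \<not> pancyclic n (G \<union> R)) \<le> rg_prob n p (\<lambda>R. \<exists>l\<in>{card V1..n}. B l R)"
  proof (rule rg_prob_mono)
    fix R assume R: "R \<subseteq> pairs n" and np: "\<not> pancyclic n (G \<union> R)"
    show "\<exists>l\<in>{card V1..n}. B l R"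
    proof (rule ccontr)
      assume "\<not> ?thesis"
      hence nB: "\<not> B l R" if "card V1 \<le> l" "l \<le> n" for l using that by auto
      have nos: "{x} \<notin> G \<union> R" for x using G R pairs_iff[of x x n] by (auto simp: graph_def)
      have cyc: "\<exists>xs. is_cycle (G \<union> R) xs \<and> set xs = X l" if l: "card V1 \<le> l" "l \<le> n" for l
      proof (rule hamiltonian_cycle_on_subset[OF hyp])
        show "finite (X l)" using X[OF l] finite_subset[of "X l" "{..<n}"] by auto
        show "3 \<le> card (X l)" using X[OF l] l c3 by simp
        show "{x} \<notin> G \<union> R" for x by (rule nos)
        show "real (num_comps (G \<union> R) (X l - S)) \<le> max 1 (real (card S) / t0)" if "S \<subseteq> X l" for S
          using nB[OF l] that unfolding B_def by (meson not_le)
      qed auto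
      have "pancyclic n (G \<union> R)"
      proof (rule pancyclic_of_cycles_on_subsets[OF G R ind a V1(1) c3 _ V0])
        show "a + 1 \<le> card (nbh G V1 v)" if "v < n" for v using V1(3)[OF that] ak a by linarith
        show "\<exists>xs. is_cycle (G \<union> R) xs \<and> set xs = V1" using cyc[OF order_refl cV1] XV1 by simp
        fix l assume l: "card V1 \<le> l" "l \<le> n"
        obtain xs where xs: "is_cycle (G \<union> R) xs" "set xs = X l" using cyc[OF l] by blast
        have "length xs = l" using xs X[OF l] distinct_card[of xs] by (simp add: is_cycle_def)
        thus "\<exists>xs. is_cycle (G \<union> R) xs \<and> set xs \<subseteq> {..<n} \<and> length xs = l" using xs X[OF l] by blast
      qed
      thus False using np by simp
    qed
  qed (use p in auto)
  also have "\<dots> \<le> (\<Sum>l\<in>{card V1..n}. rg_prob n p (B l))" by (rule rg_prob_Ex_le) (use p in auto)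
  also have "\<dots> \<le> (\<Sum>l\<in>{card V1..n}. (1 + 1 / real n ^ 3) ^ n * ((1 + 1 / real n ^ 3) ^ n - 1))"
    by (rule sum_mono) (rule pB)
  also have "\<dots> \<le> (real n + 1) * ((1 + 1 / real n ^ 3) ^ n * ((1 + 1 / real n ^ 3) ^ n - 1))"
    unfolding sum_constant by (intro mult_right_mono mult_nonneg_nonneg) (auto simp: one_le_power)
  finally show ?thesis .
qed

lemma tough_hamiltonian_imp_perturbed_pancyclic:
  fixes t0 :: real
  assumes t0: "t0 \<ge> 1" and hyp: "\<And>n E. 3 \<le> n \<Longrightarrow> graph n E \<Longrightarrow> tough n E t0 \<Longrightarrow> hamiltonian n E"
  shows "\<exists>c1 c2::real. c1 > 0 \<and> c2 > 0 \<and>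
        (\<forall>(G :: nat \<Rightarrow> nat set set) (p :: nat \<Rightarrow> real).
           (\<forall>\<^sub>F n in sequentially. graph n (G n)
               \<and> real (indep_num n (G n)) \<le> c2 * real (min_deg n (G n))
               \<and> c1 * ln (real n) / (real n * real (min_deg n (G n))) \<le> p n \<and> p n \<le> 1)
           \<longrightarrow> (\<lambda>n. rg_prob n (p n) (\<lambda>R. pancyclic n (G n \<union> R))) \<longlonglongrightarrow> 1)"
proof -
  define c1 where "c1 = 64 * (9 * t0 + 3)"
  define c2 where "c2 = 1 / (1000 * t0)"
  have c: "0 < c1" "0 < c2" using t0 by (auto simp: c1_def c2_def)
  have "(\<lambda>n. rg_prob n (p n) (\<lambda>R. pancyclic n (G n \<union> R))) \<longlonglongrightarrow> 1"
    if ev: "\<forall>\<^sub>F n in sequentially. graph n (G n)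
               \<and> real (indep_num n (G n)) \<le> c2 * real (min_deg n (G n))
               \<and> c1 * ln (real n) / (real n * real (min_deg n (G n))) \<le> p n \<and> p n \<le> 1"
    for G :: "nat \<Rightarrow> nat set set" and p :: "nat \<Rightarrow> real"
  proof (rule tendsto_1_prob)
    \<comment> \<open>\<open>(1 + 1 / n ^ 3) ^ n - 1\<close> has order \<open>1 / n ^ 2\<close>, so
      the union over all lengths leaves order \<open>1 / n\<close>; this is the reason for third
      powers.\<close>
    show "(\<lambda>n. (real n + 1) * ((1 + 1 / real n ^ 3) ^ n * ((1 + 1 / real n ^ 3) ^ n - 1))) \<longlonglongrightarrow> 0"
      by real_asymp
    show "\<forall>\<^sub>F n in sequentially. 0 \<le> p n \<and> p n \<le> 1 \<and> rg_prob n (p n) (\<lambda>R. \<not> pancyclic n (G n \<union> R))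
        \<le> (real n + 1) * ((1 + 1 / real n ^ 3) ^ n * ((1 + 1 / real n ^ 3) ^ n - 1))"
      using ev eventually_partition_condition eventually_ge_at_top[of 1]
    proof eventually_elim
      case (elim n)
      let ?k = "min_deg n (G n)"
      \<comment> \<open>Independence number at least 1 forces a positive minimum degree, so the
        lower bound on \<open>p\<close> is a genuine quotient and not a division by 0.\<close>
      have "card {0::nat} \<le> indep_num n (G n)" by (rule indep_num_ge) (use elim(3) in \<open>auto simp: indep_def\<close>)
      hence "1 \<le> real (indep_num n (G n))" by simp
      hence "0 < c2 * real ?k" using elim by linarith
      hence k0: "0 < real ?k" using c by (simp add: zero_less_mult_iff)
      have nk: "0 < real n * real ?k" using k0 elim(3) by simp
      have "0 \<le> c1 * ln (real n) / (real n * real ?k)" using c elim(3) by simp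
      hence p0: "0 \<le> p n" "p n \<le> 1" using elim(1) by linarith+
      have "c1 * ln (real n) \<le> p n * (real n * real ?k)" using elim(1) nk by (simp add: pos_divide_le_eq)
      moreover have "1000 * t0 * real (indep_num n (G n)) \<le> real ?k"
        using elim(1) t0 by (simp add: c2_def field_simps)
      ultimately have "rg_prob n (p n) (\<lambda>R. \<not> pancyclic n (G n \<union> R))
        \<le> (real n + 1) * ((1 + 1 / real n ^ 3) ^ n * ((1 + 1 / real n ^ 3) ^ n - 1))"
        by (intro prob_not_pancyclic_le[OF hyp t0]) (use elim p0 in \<open>auto simp: c1_def\<close>)
      thus ?case using p0 by simp
    qed
  qed
  thus ?thesis using c by blast
qed

lemma card_star_edges:
  assumes "finite A" "v \<notin> A"
  shows "card ((\<lambda>u. {v, u}) ` A) = card A"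
  using assms by (intro card_image) (auto simp: inj_on_def doubleton_eq_iff)

subsection \<open>Sparse random perturbation of a split-like graph\<close>

text \<open>As the condition is on the smaller endpoint, the first \<open>s\<close> vertices are adjacent to everything,
  the next \<open>m\<close> only to those, and the rest form a clique.\<close>

definition split_graph :: "nat \<Rightarrow> nat \<Rightarrow> nat \<Rightarrow> nat set set" where
  "split_graph n s m = {e. \<exists>u v. e = {u, v} \<and> u < v \<and> v < n \<and> (u < s \<or> s + m \<le> u)}"

lemma split_graph_iff:
  "u < v \<Longrightarrow> {u, v} \<in> split_graph n s m \<longleftrightarrow> v < n \<and> (u < s \<or> s + m \<le> u)"
  by (auto simp: split_graph_def doubleton_eq_iff)

lemma graph_split_graph: "graph n (split_graph n s m)"
  by (auto simp: graph_def split_graph_def pairs_def)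

lemma split_graph_dominating:
  assumes "u < s" "v < n" "u < n" "u \<noteq> v"
  shows "{u, v} \<in> split_graph n s m"
  using assms split_graph_iff[of u v n s m] split_graph_iff[of v u n s m]
  by (cases "u < v") (auto simp: insert_commute)

lemma min_deg_split_graph:
  assumes "s < n"
  shows "s \<le> min_deg n (split_graph n s m)"
proof (rule min_deg_ge)
  fix v assume v: "v < n"
  show "s \<le> deg (split_graph n s m) v"
  proof (cases "v < s")
    case True
    have "{..<n} - {v} \<subseteq> nbh (split_graph n s m) {..<n} v"
      using split_graph_dominating[OF True] v by (auto simp: nbh_def insert_commute)
    hence "card ({..<n} - {v}) \<le> card (nbh (split_graph n s m) {..<n} v)" by (intro card_mono) auto
    thus ?thesis using v assms by (simp add: deg_eq_card_nbh[OF graph_split_graph])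
  next
    case False
    have "{..<s} \<subseteq> nbh (split_graph n s m) {..<n} v"
      using split_graph_dominating[of _ s v n m] v assms False by (auto simp: nbh_def)
    hence "card {..<s} \<le> card (nbh (split_graph n s m) {..<n} v)" by (intro card_mono) auto
    thus ?thesis by (simp add: deg_eq_card_nbh[OF graph_split_graph])
  qed
qed (use assms in simp)

text \<open>Any two vertices outside the middle block are adjacent, so an independent set has at
  most one of them, and \<open>s + m\<close> does extend the middle block. Hence a block of size
  \<open>k - 1\<close> for independence number \<open>k\<close>.\<close>

lemma indep_num_split_graph:
  assumes "s + m < n"
  shows "indep_num n (split_graph n s m) = m + 1"
proof (rule antisym)
  show "indep_num n (split_graph n s m) \<le> m + 1"
  proof (rule indep_num_le)
    fix T assume T: "T \<subseteq> {..<n}" "indep (split_graph n s m) T"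
    have fT: "finite T" using T finite_subset by blast
    have "card (T - {s..<s + m}) \<le> 1"
    proof (rule ccontr)
      assume "\<not> ?thesis"
      then obtain u v where uv: "u \<in> T - {s..<s + m}" "v \<in> T - {s..<s + m}" "u \<noteq> v"
        using card_le_Suc0_iff_eq[of "T - {s..<s + m}"] fT by (metis One_nat_def finite_Diff)
      define x y where "x = min u v" and "y = max u v"
      have xy: "x \<in> T - {s..<s + m}" "y \<in> T" "x < y" using uv by (auto simp: x_def y_def min_def max_def)
      hence "{x, y} \<in> split_graph n s m" using T(1) by (subst split_graph_iff) auto
      thus False using T(2) xy by (auto simp: indep_def)
    qed
    moreover have "card (T \<inter> {s..<s + m}) \<le> m" using card_mono[of "{s..<s + m}" "T \<inter> {s..<s + m}"] by simp
    moreover have "card T = card (T \<inter> {s..<s + m}) + card (T - {s..<s + m})"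
      using fT by (metis card_Int_Diff)
    ultimately show "card T \<le> m + 1" by linarith
  qed
  have ind: "indep (split_graph n s m) {s..<s + m + 1}" unfolding indep_def
  proof (intro ballI impI)
    fix u v assume uv: "u \<in> {s..<s + m + 1}" "v \<in> {s..<s + m + 1}" "u \<noteq> v"
    show "{u, v} \<notin> split_graph n s m"
      using uv split_graph_iff[of u v n s m] split_graph_iff[of v u n s m]
      by (cases "u < v") (auto simp: insert_commute)
  qed
  have "{s..<s + m + 1} \<subseteq> {..<n}" using assms by auto
  from indep_num_ge[OF this ind] show "m + 1 \<le> indep_num n (split_graph n s m)" by simp
qed

text \<open>A vertex of the middle block without random edges to \<open>{s..<n}\<close> has all its
  neighbours among the first \<open>s\<close> vertices. At least two thirds of the block are
  expected to be like this, while \<open>s\<close> is only about \<open>k / 2\<close>.\<close>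

lemma split_graph_perturbed:
  assumes k: "14 \<le> k" "2 * k \<le> n" and p: "0 \<le> p" "p \<le> 1 / (3 * real n)"
  defines "s \<equiv> (k + 1) div 2"
  shows "rg_prob n p (\<lambda>R. hamiltonian n (split_graph n s (k - 1) \<union> R)) \<le> 180 / real k"
proof -
  define m where "m = k - 1"
  define I where "I = {s..<s + m}"
  define F where "F i = (\<lambda>u. {i, u}) ` ({s..<n} - {i})" for i :: nat
  define N where "N = n - s - 1"
  define b where "b = (1 - p) ^ N"
  have n0: "0 < n" and s: "2 * s \<le> k + 1" "k \<le> 2 * s" "s + m < n" using k by (auto simp: s_def m_def)
  have "1 / (3 * real n) \<le> 1 / 3" using n0 by (intro divide_left_mono) auto
  hence p3: "p \<le> 1 / 3" using p by linarith
  have cI: "card I = m" by (simp add: I_def)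
  have F1: "F i \<subseteq> pairs n" if "i \<in> I" for i using that s by (auto simp: F_def I_def pairs_iff)
  have F2: "card (F i) = N" if "i \<in> I" for i
    using that s unfolding F_def by (subst card_star_edges) (auto simp: I_def N_def)
  have F3: "card (F i \<inter> F j) \<le> 1" if "i \<noteq> j" for i j
  proof -
    have "F i \<inter> F j \<subseteq> {{i, j}}" using that by (auto simp: F_def doubleton_eq_iff)
    from card_mono[OF _ this] show ?thesis by simp
  qed
  \<comment> \<open>By Bernoulli's inequality and \<open>p \<le> 1 / (3 * n)\<close>, a star of
    fewer than \<open>n\<close> pairs is missed with probability at least
    \<open>2 / 3\<close>.\<close>
  have "1 - real N * p \<le> b"
    unfolding b_def using Bernoulli_inequality[of "- p" N] p3 by simp
  moreover have "real N * p \<le> 1 / 3"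
  proof -
    have "real N * p \<le> real n * (1 / (3 * real n))" using p by (intro mult_mono) (auto simp: N_def)
    thus ?thesis using n0 by simp
  qed
  ultimately have b: "2 / 3 \<le> b" by linarith
  have b1: "b \<le> 1" unfolding b_def using p p3 by (intro power_le_one) auto
  have m: "real m = real k - 1" using k by (simp add: m_def of_nat_diff)
  have "real m * (2 / 3) \<le> real m * b" using b by (intro mult_left_mono) auto
  hence "2 / 3 * real k - 2 / 3 \<le> real m * b" using m by simp
  moreover have "2 * real s \<le> real k + 1" using s(1) by linarith
  moreover have "14 \<le> real k" using k by simp
  \<comment> \<open>\<open>2 / 3 * (k - 1) - (k + 1) / 2 = k / 6 - 7 / 6\<close>, which is at least
    \<open>k / 12\<close> from \<open>k = 14\<close> on.\<close>
  ultimately have st: "real s \<le> real m * b - real k / 12" by linarith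
  have "rg_prob n p (\<lambda>R. hamiltonian n (split_graph n s (k - 1) \<union> R))
      \<le> rg_prob n p (\<lambda>R. real (card {i \<in> I. R \<inter> F i = {}}) \<le> real (card I) * (1 - p) ^ N - real k / 12)"
  proof (rule rg_prob_mono)
    fix R assume R: "R \<subseteq> pairs n" and ham: "hamiltonian n (split_graph n s (k - 1) \<union> R)"
    have "card {i \<in> I. R \<inter> F i = {}} \<le> card {..<s}"
    proof (rule hamiltonian_card_le[OF ham])
      show "{i \<in> I. R \<inter> F i = {}} \<subseteq> {..<n}" using s by (auto simp: I_def)
      fix u v assume u: "u \<in> {i \<in> I. R \<inter> F i = {}}" and v: "v < n" "{u, v} \<in> split_graph n s (k - 1) \<union> R"
      have "{u, v} \<in> pairs n" using v(2) R graph_split_graph[of n s "k - 1"] unfolding graph_def by blast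
      hence neq: "u \<noteq> v" by (simp add: pairs_iff)
      show "v \<in> {..<s}"
      proof (rule ccontr)
        assume vs: "v \<notin> {..<s}"
        hence "{u, v} \<in> F u" using v neq by (auto simp: F_def)
        hence "{u, v} \<notin> R" using u by auto
        hence "{u, v} \<in> split_graph n s m" using v by (simp add: m_def)
        thus False using u vs neq split_graph_iff[of u v n s m] split_graph_iff[of v u n s m]
          by (cases "u < v") (auto simp: I_def insert_commute)
      qed
    qed simp
    thus "real (card {i \<in> I. R \<inter> F i = {}}) \<le> real (card I) * (1 - p) ^ N - real k / 12"
      using st by (simp add: cI b_def)
  qed (use p p3 in auto)
  also have "\<dots> \<le> (real (card I) * (1 - p) ^ N + (real (card I) * (1 - p) ^ N)\<^sup>2 * (1 / (1 - p) ^ 1 - 1)) / (real k / 12)\<^sup>2"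
    by (rule avoiding_family_second_moment) (use p p3 F1 F2 F3 k in \<open>auto simp: I_def\<close>)
  also have "\<dots> \<le> (real k + (real k)\<^sup>2 * (1 / (2 * real n))) / (real k / 12)\<^sup>2"
  proof (intro divide_right_mono add_mono mult_mono)
    have mb: "real m * b \<le> real k * 1" using b b1 m by (intro mult_mono) auto
    show "real (card I) * (1 - p) ^ N \<le> real k" using mb by (simp add: cI b_def)
    show "(real (card I) * (1 - p) ^ N)\<^sup>2 \<le> (real k)\<^sup>2" using mb b by (intro power_mono) (auto simp: cI b_def)
    have "1 / (1 - p) - 1 = p / (1 - p)" using p3 by (simp add: field_simps)
    also have "\<dots> \<le> p / (2 / 3)" using p p3 by (intro divide_left_mono) auto
    also have "\<dots> \<le> 1 / (2 * real n)" using p by (simp add: field_simps)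
    finally show "1 / (1 - p) ^ 1 - 1 \<le> 1 / (2 * real n)" by simp
    show "0 \<le> 1 / (1 - p) ^ 1 - 1" using p p3 by simp
  qed auto
  also have "\<dots> \<le> (real k + real k / 4) / (real k / 12)\<^sup>2"
  proof (intro divide_right_mono add_mono order_refl)
    have "(real k)\<^sup>2 * (1 / (2 * real n)) \<le> (real k)\<^sup>2 * (1 / (4 * real k))"
      using k by (intro mult_left_mono divide_left_mono) auto
    also have "\<dots> = real k / 4" using k by (simp add: power2_eq_square)
    finally show "(real k)\<^sup>2 * (1 / (2 * real n)) \<le> real k / 4" .
  qed auto
  also have "\<dots> = 180 / real k" using k by (simp add: power2_eq_square field_simps)
  finally show ?thesis .
qed

lemma exists_perturbed_not_hamiltonian_linear:
  fixes k :: "nat \<Rightarrow> nat"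
  assumes kn: "\<forall>\<^sub>F n in sequentially. 2 * k n \<le> n" and k: "filterlim k at_top sequentially"
  shows "\<exists>H :: nat \<Rightarrow> nat set set.
         (\<forall>\<^sub>F n in sequentially. graph n (H n) \<and> indep_num n (H n) = k n
             \<and> real (min_deg n (H n)) \<ge> real (k n) / 2) \<and>
         (\<forall>p :: nat \<Rightarrow> real.
            (\<forall>\<^sub>F n in sequentially. 0 \<le> p n \<and> p n \<le> 1 / (3 * real n))
            \<longrightarrow> (\<lambda>n. rg_prob n (p n) (\<lambda>R. \<not> hamiltonian n (H n \<union> R))) \<longlonglongrightarrow> 1)"
proof -
  define H where "H n = split_graph n ((k n + 1) div 2) (k n - 1)" for n
  have k14: "\<forall>\<^sub>F n in sequentially. 14 \<le> k n" using k by (simp add: filterlim_at_top)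
  have "\<forall>\<^sub>F n in sequentially. graph n (H n) \<and> indep_num n (H n) = k n \<and> real (min_deg n (H n)) \<ge> real (k n) / 2"
    using kn k14
  proof eventually_elim
    case (elim n)
    have "(k n + 1) div 2 \<le> min_deg n (H n)"
      unfolding H_def by (rule min_deg_split_graph) (use elim in auto)
    moreover have "indep_num n (H n) = k n - 1 + 1"
      unfolding H_def by (rule indep_num_split_graph) (use elim in auto)
    ultimately show ?case using elim graph_split_graph by (auto simp: H_def)
  qed
  moreover have "(\<lambda>n. rg_prob n (p n) (\<lambda>R. \<not> hamiltonian n (H n \<union> R))) \<longlonglongrightarrow> 1"
    if p: "\<forall>\<^sub>F n in sequentially. 0 \<le> p n \<and> p n \<le> 1 / (3 * real n)" for p :: "nat \<Rightarrow> real"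
  proof (rule tendsto_1_prob)
    have "filterlim (\<lambda>n. real (k n)) at_top sequentially"
      using filterlim_compose[OF filterlim_real_sequentially k] .
    thus "(\<lambda>n. 180 / real (k n)) \<longlonglongrightarrow> 0" by (rule tendsto_divide_0[OF tendsto_const filterlim_at_top_imp_at_infinity])
    show "\<forall>\<^sub>F n in sequentially. 0 \<le> p n \<and> p n \<le> 1 \<and>
        rg_prob n (p n) (\<lambda>R. \<not> \<not> hamiltonian n (H n \<union> R)) \<le> 180 / real (k n)"
      using p kn k14
    proof eventually_elim
      case (elim n)
      have "1 / (3 * real n) \<le> 1" using elim by (simp add: divide_simps)
      hence "p n \<le> 1" using elim by linarith
      thus ?case using split_graph_perturbed[of "k n" n "p n"] elim by (simp add: H_def)
    qed
  qed
  ultimately show ?thesis by (intro exI[of _ H]) blast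
qed

subsection \<open>Sparse random perturbation of a union of cliques\<close>

text \<open>There are \<open>q\<close> cliques of size \<open>k + 1\<close>; truncating the quotient at \<open>q\<close> makes one more clique of
  all remaining vertices.\<close>

definition clique_union :: "nat \<Rightarrow> nat \<Rightarrow> nat \<Rightarrow> nat set set" where
  "clique_union n k q = {e. \<exists>u v. e = {u, v} \<and> u < v \<and> v < n \<and> min (u div Suc k) q = min (v div Suc k) q}"

lemma clique_union_iff:
  "{u, v} \<in> clique_union n k q \<longleftrightarrow> u \<noteq> v \<and> u < n \<and> v < n \<and> min (u div Suc k) q = min (v div Suc k) q"
proof
  assume "{u, v} \<in> clique_union n k q"
  thus "u \<noteq> v \<and> u < n \<and> v < n \<and> min (u div Suc k) q = min (v div Suc k) q"
    by (auto simp: clique_union_def doubleton_eq_iff)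
next
  assume r: "u \<noteq> v \<and> u < n \<and> v < n \<and> min (u div Suc k) q = min (v div Suc k) q"
  show "{u, v} \<in> clique_union n k q"
  proof (cases "u < v")
    case True thus ?thesis using r unfolding clique_union_def by blast
  next
    case False
    hence "v < u" using r by simp
    moreover have "{u, v} = {v, u}" by auto
    ultimately show ?thesis using r unfolding clique_union_def by (metis (mono_tags, lifting) mem_Collect_eq)
  qed
qed

lemma graph_clique_union: "graph n (clique_union n k q)"
  by (auto simp: graph_def clique_union_def pairs_def)

definition block :: "nat \<Rightarrow> nat \<Rightarrow> nat set" where
  "block k i = {i * Suc k..<Suc i * Suc k}"

lemma mem_block_iff: "u \<in> block k i \<longleftrightarrow> u div Suc k = i"
proof
  assume "u \<in> block k i"
  thus "u div Suc k = i" unfolding block_def by (intro div_nat_eqI) (auto simp: mult.commute)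
next
  assume i: "u div Suc k = i"
  have "i * Suc k \<le> u" using i div_times_less_eq_dividend by blast
  moreover have "u < Suc i * Suc k" using i dividend_less_div_times[of "Suc k" u] by simp
  ultimately show "u \<in> block k i" by (simp add: block_def)
qed

lemma card_block: "card (block k i) = Suc k"
  by (simp add: block_def)

lemma block_subset: "i < q \<Longrightarrow> block k i \<subseteq> {..<q * Suc k}"
proof
  fix u assume i: "i < q" and u: "u \<in> block k i"
  hence "u < Suc i * Suc k" by (simp add: block_def)
  also have "\<dots> \<le> q * Suc k" using i by (intro mult_le_mono1) simp
  finally show "u \<in> {..<q * Suc k}" by simp
qed

lemma nbh_clique_union:
  assumes "v < n"
  shows "nbh (clique_union n k q) {..<n} v = {u. u < n \<and> min (u div Suc k) q = min (v div Suc k) q} - {v}"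
  using assms by (auto simp: nbh_def clique_union_iff)

text \<open>The first block attains \<open>k\<close>. No vertex has a smaller degree, as the last
  clique has at least \<open>k + 1\<close> vertices too.\<close>

lemma min_deg_clique_union:
  assumes q: "1 \<le> q" and n: "q * Suc k + Suc k \<le> n"
  shows "min_deg n (clique_union n k q) = k"
proof (rule antisym)
  have "u < n \<and> min (u div Suc k) q = min (0 div Suc k) q \<longleftrightarrow> u \<in> block k 0" for u
  proof -
    have "u < n" if "u \<in> block k 0"
    proof -
      have "u < q * Suc k" using block_subset[of 0 q k] that q by auto
      thus ?thesis using n by linarith
    qed
    thus ?thesis using q by (auto simp: mem_block_iff min_def)
  qed
  hence "nbh (clique_union n k q) {..<n} 0 = block k 0 - {0}"
    using n by (subst nbh_clique_union) auto
  hence "deg (clique_union n k q) 0 = k"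
    by (simp add: deg_eq_card_nbh[OF graph_clique_union] block_def)
  thus "min_deg n (clique_union n k q) \<le> k" using min_deg_le[of 0 n "clique_union n k q"] n by simp
  show "k \<le> min_deg n (clique_union n k q)"
  proof (rule min_deg_ge)
    fix v assume v: "v < n"
    let ?A = "{u. u < n \<and> min (u div Suc k) q = min (v div Suc k) q}"
    have "Suc k \<le> card ?A"
    proof (cases "v div Suc k < q")
      case True
      have "block k (v div Suc k) \<subseteq> ?A" using block_subset[OF True] n by (force simp: mem_block_iff)
      from card_mono[OF _ this] show ?thesis by (simp add: card_block)
    next
      case False
      have "{q * Suc k..<n} \<subseteq> ?A"
      proof
        fix u assume u: "u \<in> {q * Suc k..<n}"
        hence "q \<le> u div Suc k" using less_eq_div_iff_mult_less_eq[of "Suc k" q u] by simp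
        thus "u \<in> ?A" using u False by simp
      qed
      from card_mono[OF _ this] show ?thesis using n by simp
    qed
    moreover have "card ?A - 1 \<le> card (?A - {v})" by (simp add: card_Diff1_le card_Diff_singleton_if)
    ultimately show "k \<le> deg (clique_union n k q) v"
      using v by (simp add: deg_eq_card_nbh[OF graph_clique_union] nbh_clique_union)
  qed (use n in simp)
qed

lemma indep_num_clique_union: "indep_num n (clique_union n k q) \<le> q + 1"
proof (rule indep_num_le)
  fix S assume S: "S \<subseteq> {..<n}" "indep (clique_union n k q) S"
  have "inj_on (\<lambda>u. min (u div Suc k) q) S"
    using S by (auto simp: inj_on_def indep_def clique_union_iff)
  moreover have "(\<lambda>u. min (u div Suc k) q) ` S \<subseteq> {..q}" by auto
  ultimately have "card S \<le> card {..q}" by (intro card_inj_on_le) auto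
  thus "card S \<le> q + 1" by simp
qed

text \<open>A block that no random edge leaves is closed and excludes a Hamilton cycle. The second
  moment bound is used with the whole mean as deviation, so it estimates the probability that no
  such block exists.\<close>

lemma clique_union_perturbed:
  assumes q: "1 \<le> q" and n: "q * Suc k + Suc k \<le> n" and p: "0 \<le> p" "p < 1"
  shows "rg_prob n p (\<lambda>R. hamiltonian n (clique_union n k q \<union> R))
    \<le> 1 / (real q * (1 - p) ^ (Suc k * (n - Suc k))) + (1 / (1 - p) ^ (Suc k * Suc k) - 1)"
proof -
  define F where "F i = cross_edges (block k i) ({..<n} - block k i)" for i
  define N where "N = Suc k * (n - Suc k)"
  define b where "b = (1 - p) ^ N"
  have bn: "block k i \<subseteq> {..<n}" if "i < q" for i using block_subset[OF that, of k] n by auto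
  have b0: "0 < b" using p by (simp add: b_def)
  have F1: "F i \<subseteq> pairs n" if "i \<in> {..<q}" for i
    using bn[of i] that by (auto simp: F_def cross_edges_def pairs_iff)
  have F2: "card (F i) = N" if "i \<in> {..<q}" for i
  proof -
    have "card (F i) = card (block k i) * card ({..<n} - block k i)"
      unfolding F_def by (rule card_cross_edges) (auto simp: block_def)
    also have "card ({..<n} - block k i) = n - Suc k"
      using bn[of i] that by (subst card_Diff_subset) (auto simp: card_block, simp add: block_def)
    finally show ?thesis by (simp add: N_def card_block)
  qed
  \<comment> \<open>Two cuts share only pairs that join the two blocks.\<close>
  have F3: "card (F i \<inter> F j) \<le> Suc k * Suc k" if "i \<noteq> j" for i j
  proof -
    have "F i \<inter> F j \<subseteq> cross_edges (block k i) (block k j)"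
    proof
      fix e assume "e \<in> F i \<inter> F j"
      hence "e \<in> F i" "e \<in> F j" by auto
      from this(1) obtain u v where e: "e = {u, v}" "u \<in> block k i" by (auto simp: F_def cross_edges_def)
      from \<open>e \<in> F j\<close> obtain x y where e': "e = {x, y}" "x \<in> block k j" by (auto simp: F_def cross_edges_def)
      have "x \<noteq> u" using e e' that by (auto simp: mem_block_iff)
      hence "x = v" using e e' by (auto simp: doubleton_eq_iff)
      thus "e \<in> cross_edges (block k i) (block k j)" using e e' by (auto simp: cross_edges_def)
    qed
    hence "card (F i \<inter> F j) \<le> card (cross_edges (block k i) (block k j))"
      by (rule card_mono[rotated]) (simp add: block_def cross_edges_def)
    also have "\<dots> \<le> card (block k i \<times> block k j)" unfolding cross_edges_def by (rule card_image_le) (simp add: block_def)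
    finally show ?thesis by (simp add: card_cartesian_product card_block)
  qed
  have "rg_prob n p (\<lambda>R. hamiltonian n (clique_union n k q \<union> R))
      \<le> rg_prob n p (\<lambda>R. real (card {i \<in> {..<q}. R \<inter> F i = {}}) \<le> real (card {..<q}) * (1 - p) ^ N - real q * b)"
  proof (rule rg_prob_mono)
    fix R assume R: "R \<subseteq> pairs n" and ham: "hamiltonian n (clique_union n k q \<union> R)"
    have "R \<inter> F i \<noteq> {}" if i: "i < q" for i
    proof
      assume no: "R \<inter> F i = {}"
      have "block k i = {..<n}"
      proof (rule hamiltonian_no_closed_subset[OF ham bn[OF i]])
        show "block k i \<noteq> {}" by (simp add: block_def)
        fix u v assume uv: "u \<in> block k i" "v < n" "{u, v} \<in> clique_union n k q \<union> R"
        show "v \<in> block k i"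
        proof (rule ccontr)
          assume v: "v \<notin> block k i"
          hence "{u, v} \<in> F i" using uv by (auto simp: F_def cross_edges_def)
          hence "{u, v} \<in> clique_union n k q" using no uv by auto
          hence "min (v div Suc k) q = i" using uv(1) i by (simp add: clique_union_iff mem_block_iff)
          thus False using v i by (simp add: mem_block_iff min_def split: if_splits)
        qed
      qed
      hence "card (block k i) = n" by simp
      thus False using n q by (simp add: card_block)
    qed
    hence "{i \<in> {..<q}. R \<inter> F i = {}} = {}" by auto
    hence "card {i \<in> {..<q}. R \<inter> F i = {}} = 0" by (simp only: card.empty)
    thus "real (card {i \<in> {..<q}. R \<inter> F i = {}}) \<le> real (card {..<q}) * (1 - p) ^ N - real q * b"
      by (simp add: b_def)
  qed (use p in auto)
  also have "\<dots> \<le> (real (card {..<q}) * (1 - p) ^ N + (real (card {..<q}) * (1 - p) ^ N)\<^sup>2 *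
      (1 / (1 - p) ^ (Suc k * Suc k) - 1)) / (real q * b)\<^sup>2"
    by (rule avoiding_family_second_moment) (use p F1 F2 F3 q b0 in auto)
  also have "\<dots> = 1 / (real q * b) + (1 / (1 - p) ^ (Suc k * Suc k) - 1)"
  proof -
    have "real q * b \<noteq> 0" using q b0 by simp
    thus ?thesis by (simp add: b_def add_divide_distrib power2_eq_square del: mult_Suc mult_Suc_right)
  qed
  finally show ?thesis by (simp only: b_def N_def)
qed

lemma exists_perturbed_not_hamiltonian_log:
  fixes \<epsilon> c :: real and k :: "nat \<Rightarrow> nat"
  assumes eps: "0 < \<epsilon>" "\<epsilon> < 1/2" and c: "0 < c"
    and k: "\<forall>\<^sub>F n in sequentially. real n powr \<epsilon> \<le> real (k n) \<and> real (k n) \<le> real n powr (1 - \<epsilon>)"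
  shows "\<exists>c'::real. c' > 0 \<and> (\<exists>H :: nat \<Rightarrow> nat set set.
         (\<forall>\<^sub>F n in sequentially. graph n (H n) \<and> min_deg n (H n) = k n
             \<and> real (indep_num n (H n)) \<le> c * real (k n)) \<and>
         (\<forall>p :: nat \<Rightarrow> real.
            (\<forall>\<^sub>F n in sequentially. 0 \<le> p n \<and> p n \<le> c' * ln (real n) / (real n * real (k n)))
            \<longrightarrow> (\<lambda>n. rg_prob n (p n) (\<lambda>R. \<not> hamiltonian n (H n \<union> R))) \<longlonglongrightarrow> 1))"
proof -
  \<comment> \<open>A small power of \<open>n\<close>: \<open>q + 1\<close> stays below
    \<open>c * k\<close> and the blocks fit into \<open>n\<close> vertices, while about
    \<open>n powr (\<epsilon> / 4)\<close> candidates outweigh an isolation probability of at least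
    \<open>n powr (- (\<epsilon> / 8))\<close>.\<close>
  define q where "q n = nat \<lfloor>real n powr (\<epsilon> / 4)\<rfloor>" for n :: nat
  define H where "H n = clique_union n (k n) (q n)" for n
  \<comment> \<open>By \<open>- 2 * p \<le> ln (1 - p)\<close> and \<open>k + 1 \<le> 2 * k\<close>,
    the logarithm of the isolation probability is at least \<open>- 4 * c' * ln n\<close>, which
    becomes \<open>- (\<epsilon> / 8) * ln n\<close>.\<close>
  define c' where "c' = \<epsilon> / 32"
  have c': "0 < c'" "c' < 1" using eps by (auto simp: c'_def)
  have q_le: "real (q n) \<le> real n powr (\<epsilon> / 4)" for n
    unfolding q_def by (simp add: of_nat_floor)
  have q_ge: "real n powr (\<epsilon> / 4) - 1 \<le> real (q n)" for n
    unfolding q_def by linarith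
  have ev1: "\<forall>\<^sub>F n in sequentially. 2 \<le> real n powr (\<epsilon> / 4)" using eps by real_asymp
  have ev2: "\<forall>\<^sub>F n in sequentially. 2 * real n powr (\<epsilon> / 4) * (2 * real n powr (1 - \<epsilon>)) \<le> real n"
    using eps by real_asymp
  have ev3: "\<forall>\<^sub>F n in sequentially. real n powr (\<epsilon> / 4) + 1 \<le> c * real n powr \<epsilon>"
    using eps c by real_asymp
  have good: "\<forall>\<^sub>F n in sequentially. 1 \<le> q n \<and> q n * Suc (k n) + Suc (k n) \<le> n \<and> 1 \<le> k n \<and> 1 \<le> n"
    using ev1 ev2 k eventually_ge_at_top[of 1]
  proof eventually_elim
    case (elim n)
    have "1 \<le> real n powr \<epsilon>" using elim(4) eps by (intro ge_one_powr_ge_zero) auto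
    hence k1: "1 \<le> real (k n)" using elim by linarith
    have q1: "1 \<le> real (q n)" using elim q_ge[of n] by linarith
    have "1 * real (Suc (k n)) \<le> real (q n) * real (Suc (k n))" using q1 by (intro mult_right_mono) auto
    hence "real (q n) * real (Suc (k n)) + real (Suc (k n)) \<le> 2 * (real (q n) * real (Suc (k n)))"
      by (simp only: mult_2 mult_1 add_left_mono)
    also have "\<dots> = 2 * real (q n) * real (Suc (k n))" by (simp only: mult.assoc)
    also have "\<dots> \<le> 2 * real n powr (\<epsilon> / 4) * (2 * real n powr (1 - \<epsilon>))"
      using q_le[of n] k1 elim by (intro mult_mono) auto
    also have "\<dots> \<le> real n" using elim by simp
    finally have "real (q n * Suc (k n) + Suc (k n)) \<le> real n" by (simp only: of_nat_add of_nat_mult)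
    thus ?case using q1 k1 elim by (simp only: of_nat_le_iff) simp
  qed
  have "\<forall>\<^sub>F n in sequentially. graph n (H n) \<and> min_deg n (H n) = k n \<and> real (indep_num n (H n)) \<le> c * real (k n)"
    using good ev3 k
  proof eventually_elim
    case (elim n)
    have "real (indep_num n (H n)) \<le> real (q n) + 1"
      using indep_num_clique_union[of n "k n" "q n"] by (simp add: H_def)
    also have "\<dots> \<le> c * real n powr \<epsilon>" using q_le[of n] elim by linarith
    also have "\<dots> \<le> c * real (k n)" using elim c by (intro mult_left_mono) auto
    finally show ?case using elim min_deg_clique_union[of "q n" "k n" n] graph_clique_union
      by (simp add: H_def)
  qed
  moreover have "(\<lambda>n. rg_prob n (p n) (\<lambda>R. \<not> hamiltonian n (H n \<union> R))) \<longlonglongrightarrow> 1"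
    if p: "\<forall>\<^sub>F n in sequentially. 0 \<le> p n \<and> p n \<le> c' * ln (real n) / (real n * real (k n))" for p :: "nat \<Rightarrow> real"
  proof (rule tendsto_1_prob)
    let ?f = "\<lambda>n::nat. 1 / ((real n powr (\<epsilon> / 4) - 1) * real n powr (- (\<epsilon> / 8))) +
        (1 / (1 - \<epsilon> / 8 * ln (real n) * real n powr (- \<epsilon>)) - 1)"
    have "(\<lambda>n::nat. 1 / ((real n powr (\<epsilon> / 4) - 1) * real n powr (- (\<epsilon> / 8)))) \<longlonglongrightarrow> 0"
      using eps by real_asymp
    moreover have "(\<lambda>n::nat. 1 / (1 - \<epsilon> / 8 * ln (real n) * real n powr (- \<epsilon>)) - 1) \<longlonglongrightarrow> 0"
      using eps by real_asymp
    ultimately show "?f \<longlonglongrightarrow> 0" by (rule tendsto_add_zero)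
    have ev4: "\<forall>\<^sub>F n in sequentially. ln (real n) / real n \<le> 1 / 2" by real_asymp
    have ev5: "\<forall>\<^sub>F n in sequentially. \<epsilon> / 8 * ln (real n) * real n powr (- \<epsilon>) \<le> 1 / 2"
      using eps by real_asymp
    show "\<forall>\<^sub>F n in sequentially. 0 \<le> p n \<and> p n \<le> 1 \<and>
        rg_prob n (p n) (\<lambda>R. \<not> \<not> hamiltonian n (H n \<union> R)) \<le> ?f n"
      using p good k ev1 ev4 ev5
    proof eventually_elim
      case (elim n)
      have n1: "1 \<le> real n" and k1: "1 \<le> real (k n)" using elim by auto
      have ln0: "0 \<le> ln (real n)" using n1 by simp
      have nk: "real n * 1 \<le> real n * real (k n)" using n1 k1 by (intro mult_left_mono) auto
      have "c' * ln (real n) / (real n * real (k n)) \<le> 1 * ln (real n) / (real n * 1)"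
        using c' ln0 n1 nk by (intro frac_le mult_right_mono) auto
      hence "c' * ln (real n) / (real n * real (k n)) \<le> ln (real n) / real n" by simp
      hence p2: "p n \<le> 1 / 2" "0 \<le> p n" using elim by linarith+
      have pnk: "p n * (real n * real (k n)) \<le> c' * ln (real n)"
        using elim n1 k1 by (simp add: pos_le_divide_eq)
      have "- 2 * p n \<le> ln (1 - p n)"
      proof -
        have "p n * p n \<le> 1 / 2 * p n" using p2 by (intro mult_right_mono) auto
        hence "2 * (p n)\<^sup>2 \<le> p n" by (simp add: power2_eq_square)
        thus ?thesis using ln_one_minus_pos_lower_bound[OF p2(2,1)] by linarith
      qed
      hence "real (Suc (k n) * (n - Suc (k n))) * (- 2 * p n) \<le> real (Suc (k n) * (n - Suc (k n))) * ln (1 - p n)"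
        by (rule mult_left_mono) simp
      moreover have "real (Suc (k n) * (n - Suc (k n))) * p n \<le> (2 * real (k n) * real n) * p n"
        using k1 p2 unfolding of_nat_mult by (intro mult_right_mono mult_mono) auto
      moreover have "(2 * real (k n) * real n) * p n \<le> 2 * (c' * ln (real n))" using pnk by (simp add: mult_ac)
      ultimately have "- (\<epsilon> / 8) * ln (real n) \<le> real (Suc (k n) * (n - Suc (k n))) * ln (1 - p n)"
        unfolding c'_def by argo
      hence "exp (- (\<epsilon> / 8) * ln (real n)) \<le> exp (real (Suc (k n) * (n - Suc (k n))) * ln (1 - p n))" by simp
      also have "\<dots> = (1 - p n) ^ (Suc (k n) * (n - Suc (k n)))"
        using p2 by (simp only: exp_of_nat_mult) simp
      finally have b: "real n powr (- (\<epsilon> / 8)) \<le> (1 - p n) ^ (Suc (k n) * (n - Suc (k n)))"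
        using n1 by (simp add: powr_def)
      have x: "0 < (real n powr (\<epsilon> / 4) - 1) * real n powr (- (\<epsilon> / 8))" using elim n1 by simp
      have "(real n powr (\<epsilon> / 4) - 1) * real n powr (- (\<epsilon> / 8)) \<le> real (q n) * (1 - p n) ^ (Suc (k n) * (n - Suc (k n)))"
        by (rule mult_mono[OF q_ge b]) auto
      hence t1: "1 / (real (q n) * (1 - p n) ^ (Suc (k n) * (n - Suc (k n))))
          \<le> 1 / ((real n powr (\<epsilon> / 4) - 1) * real n powr (- (\<epsilon> / 8)))"
        using x by (intro frac_le) auto
      \<comment> \<open>The correlation of two blocks vanishes: \<open>(k + 1) ^ 2 * p\<close> tends
        to 0 because \<open>k / n\<close> is at most \<open>n powr (- \<epsilon>)\<close>.\<close>
      have "real (Suc (k n) * Suc (k n)) * p n \<le> (2 * real (k n) * (2 * real (k n))) * p n"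
        using k1 p2 unfolding of_nat_mult by (intro mult_right_mono mult_mono) auto
      also have "\<dots> = 4 * (p n * (real n * real (k n))) * (real (k n) / real n)" using n1 by simp
      also have "\<dots> \<le> 4 * (c' * ln (real n)) * (real n powr (1 - \<epsilon>) / real n)"
        by (rule mult_mono[OF mult_left_mono[OF pnk] divide_right_mono]) (use elim c' ln0 in auto)
      also have "real n powr (1 - \<epsilon>) / real n = real n powr (- \<epsilon>)"
        using n1 powr_diff[of "real n" "1 - \<epsilon>" 1] by simp
      finally have "real (Suc (k n) * Suc (k n)) * p n \<le> \<epsilon> / 8 * ln (real n) * real n powr (- \<epsilon>)"
        by (simp add: c'_def)
      moreover have "1 - real (Suc (k n) * Suc (k n)) * p n \<le> (1 - p n) ^ (Suc (k n) * Suc (k n))"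
        using Bernoulli_inequality[of "- p n" "Suc (k n) * Suc (k n)"] p2 by simp
      ultimately have y: "1 - \<epsilon> / 8 * ln (real n) * real n powr (- \<epsilon>) \<le> (1 - p n) ^ (Suc (k n) * Suc (k n))"
        by linarith
      have t2: "1 / (1 - p n) ^ (Suc (k n) * Suc (k n)) \<le> 1 / (1 - \<epsilon> / 8 * ln (real n) * real n powr (- \<epsilon>))"
        using y elim by (intro frac_le) auto
      have "rg_prob n (p n) (\<lambda>R. hamiltonian n (H n \<union> R))
        \<le> 1 / (real (q n) * (1 - p n) ^ (Suc (k n) * (n - Suc (k n)))) + (1 / (1 - p n) ^ (Suc (k n) * Suc (k n)) - 1)"
        unfolding H_def by (rule clique_union_perturbed) (use elim p2 in auto)
      hence "rg_prob n (p n) (\<lambda>R. hamiltonian n (H n \<union> R)) \<le> ?f n" using t1 t2 by linarith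
      thus ?case using p2 by simp
    qed
  qed
  ultimately show ?thesis using c' by blast
qed

theorem theorem1p5:
  shows
  "(\<forall>t0::real. t0 \<ge> 1 \<longrightarrow>
      (\<forall>n E. 3 \<le> n \<and> graph n E \<and> tough n E t0 \<longrightarrow> hamiltonian n E) \<longrightarrow>
      (\<exists>c1 c2::real. c1 > 0 \<and> c2 > 0 \<and>
        (\<forall>(G :: nat \<Rightarrow> nat set set) (p :: nat \<Rightarrow> real).
           (\<forall>\<^sub>F n in sequentially. graph n (G n)
               \<and> real (indep_num n (G n)) \<le> c2 * real (min_deg n (G n))
               \<and> c1 * ln (real n) / (real n * real (min_deg n (G n))) \<le> p n \<and> p n \<le> 1)
           \<longrightarrow> (\<lambda>n. rg_prob n (p n) (\<lambda>R. pancyclic n (G n \<union> R))) \<longlonglongrightarrow> 1)))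
   \<and>
   (\<forall>(\<epsilon>::real) (c::real) (k :: nat \<Rightarrow> nat).
      0 < \<epsilon> \<and> \<epsilon> < 1/2 \<and> 0 < c \<and> c < 1 \<and>
      (\<forall>\<^sub>F n in sequentially. real n powr \<epsilon> \<le> real (k n) \<and> real (k n) \<le> real n powr (1 - \<epsilon>))
      \<longrightarrow>
      (\<exists>c'::real. c' > 0 \<and> (\<exists>H :: nat \<Rightarrow> nat set set.
         (\<forall>\<^sub>F n in sequentially. graph n (H n) \<and> min_deg n (H n) = k n
             \<and> real (indep_num n (H n)) \<le> c * real (k n)) \<and>
         (\<forall>p :: nat \<Rightarrow> real.
            (\<forall>\<^sub>F n in sequentially. 0 \<le> p n \<and> p n \<le> c' * ln (real n) / (real n * real (k n)))
            \<longrightarrow> (\<lambda>n. rg_prob n (p n) (\<lambda>R. \<not> hamiltonian n (H n \<union> R))) \<longlonglongrightarrow> 1))))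
   \<and>
   (\<forall>k :: nat \<Rightarrow> nat.
      (\<forall>\<^sub>F n in sequentially. 2 * k n \<le> n) \<and> filterlim k at_top sequentially
      \<longrightarrow>
      (\<exists>H :: nat \<Rightarrow> nat set set.
         (\<forall>\<^sub>F n in sequentially. graph n (H n) \<and> indep_num n (H n) = k n
             \<and> real (min_deg n (H n)) \<ge> real (k n) / 2) \<and>
         (\<forall>p :: nat \<Rightarrow> real.
            (\<forall>\<^sub>F n in sequentially. 0 \<le> p n \<and> p n \<le> 1 / (3 * real n))
            \<longrightarrow> (\<lambda>n. rg_prob n (p n) (\<lambda>R. \<not> hamiltonian n (H n \<union> R))) \<longlonglongrightarrow> 1)))"
proof (intro conjI allI impI, goal_cases)
  case (1 t0)
  thus ?case by (intro tough_hamiltonian_imp_perturbed_pancyclic) auto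
next
  case (2 \<epsilon> c k)
  thus ?case by (intro exists_perturbed_not_hamiltonian_log[of \<epsilon> c k]) auto
next
  case (3 k)
  thus ?case by (intro exists_perturbed_not_hamiltonian_linear) auto
qed

end
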